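(* Let $(G,\nabla^+,g^+)$ be a flat affine pseudo-Hessian Lie group with Lie algebra $\mathfrak{g}$. Then the cotangent bundle $T^*(G)=\mathfrak{g}^*\rtimes_{\rho}G$, endowed with the product $$(\alpha,\sigma)(\beta,\tau)=(\alpha+\rho(\sigma)(\beta),\sigma\tau),$$ where $\rho$ is the representation of $G$ on $\mathfrak{g}^*$ with $\rho_{*,\epsilon}(a)=-{}^tL_a$ for $a\in\mathfrak{g}$, is a pseudo-Kähler Lie group.
   Context: A flat affine Lie group $(G,\nabla^+)$ is a Lie group $G$ with a flat, torsion free, left invariant linear connection $\nabla^+$. Identifying $\mathfrak{g}=T_\epsilon G$ ($\epsilon$ the unit), it corresponds to the bilinear (left symmetric) product $a\cdot b=L_a(b)$ on $\mathfrak{g}$ given by $\nabla^+_{a^+}b^+=(a\cdot b)^+$, where $x^+$ denotes the left invariant vector field determined by $x\in\mathfrak{g}$. ${}^tL_a$ is the transpose of $L_a$, acting on $\mathfrak{g}^*$. $(G,\nabla^+,g^+)$ is pseudo-Hessian if $g^+=\langle\ ,\ \rangle$ is a left invariant pseudo-Riemannian metric on $G$ such that for all left invariant vector fields $X^+,Y^+,Z^+$: $\langle \nabla_{X^+}^+Y^+,Z^+\rangle-\langle X^+,\nabla_{Y^+}^+Z^+\rangle=\langle \nabla_{Y^+}^+X^+,Z^+\rangle-\langle Y^+,\nabla_{X^+}^+Z^+\rangle$. A symplectic Lie group is a Lie group with a left invariant symplectic form $\omega^+$. A pseudo-Kähler Lie group is a symplectic Lie group $(H,\omega^+)$ provided with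 a left invariant (integrable) complex structure $j^+$ such that $(a,b)\mapsto \omega^+(a,j^+(b))$ defines a left invariant pseudo-Riemannian metric on $H$. *)

theory Defs
  imports "HOL-Analysis.Analysis" "HOL-Library.Function_Algebras" "HOL-Algebra.Group"
begin

instantiation "fun" :: (type, real_vector) real_vector
begin

definition scaleR_fun_def: "c *\<^sub>R f = (\<lambda>x. c *\<^sub>R f x)"

instance
  by standard (simp_all add: scaleR_fun_def fun_eq_iff scaleR_add_right scaleR_add_left)

end

definition lin_on :: "'v::real_vector set \<Rightarrow> ('v \<Rightarrow> 'w::real_vector) \<Rightarrow> bool" where
  "lin_on V f \<longleftrightarrow>
     (\<forall>u\<in>V. \<forall>v\<in>V. f (u + v) = f u + f v) \<and> (\<forall>c. \<forall>u\<in>V. f (c *\<^sub>R u) = c *\<^sub>R f u)"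

definition bilin_form_on :: "'v::real_vector set \<Rightarrow> ('v \<Rightarrow> 'v \<Rightarrow> real) \<Rightarrow> bool" where
  "bilin_form_on V b \<longleftrightarrow> (\<forall>u\<in>V. lin_on V (b u)) \<and> (\<forall>v\<in>V. lin_on V (\<lambda>u. b u v))"

definition nondegenerate_on :: "'v::real_vector set \<Rightarrow> ('v \<Rightarrow> 'v \<Rightarrow> real) \<Rightarrow> bool" where
  "nondegenerate_on V b \<longleftrightarrow> (\<forall>u\<in>V. (\<forall>v\<in>V. b u v = 0) \<longrightarrow> u = 0)"

text \<open>Functionals are normalised to be \<open>0\<close> outside \<open>V\<close>, so that equality of
  elements of the dual space is equality of functions and the dual is a linear subspace of
  the function space.\<close>

definition dual_space :: "'v::real_vector set \<Rightarrow> ('v \<Rightarrow> real) set" where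
  "dual_space V = {\<alpha>. lin_on V \<alpha> \<and> (\<forall>v. v \<notin> V \<longrightarrow> \<alpha> v = 0)}"

definition transpose_on :: "'v::real_vector set \<Rightarrow> ('v \<Rightarrow> 'v) \<Rightarrow> ('v \<Rightarrow> real) \<Rightarrow> ('v \<Rightarrow> real)" where
  "transpose_on V L \<alpha> = (\<lambda>v. if v \<in> V then \<alpha> (L v) else 0)"

text \<open>Only used for open \<open>S\<close>. Since the domain is finite-dimensional, \<open>f\<close> is of class
  \<open>C\<^sup>k\<^sup>+\<^sup>1\<close> iff it is differentiable and all its directional derivatives are of class \<open>C\<^sup>k\<close>.\<close>

fun Ck_on :: "nat \<Rightarrow> 'e::euclidean_space set \<Rightarrow> ('e \<Rightarrow> 'f::real_normed_vector) \<Rightarrow> bool" where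
  "Ck_on 0 S f \<longleftrightarrow> continuous_on S f"
| "Ck_on (Suc k) S f \<longleftrightarrow>
     (\<forall>x\<in>S. f differentiable (at x)) \<and> (\<forall>v. Ck_on k S (\<lambda>x. frechet_derivative f (at x) v))"

definition smooth_on :: "'e::euclidean_space set \<Rightarrow> ('e \<Rightarrow> 'f::real_normed_vector) \<Rightarrow> bool" where
  "smooth_on S f \<longleftrightarrow> (\<forall>k. Ck_on k S f)"

text \<open>A chart is a pair \<open>(U, \<phi>)\<close>; the values of \<open>\<phi>\<close> outside \<open>U\<close> are irrelevant, and the
  inverse of the chart is \<open>inv_into U \<phi>\<close>. The atlas need not be maximal.\<close>

record ('m, 'e) manifold =
  mtop :: "'m topology"
  atlas :: "('m set \<times> ('m \<Rightarrow> 'e)) set"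

abbreviation points :: "('m, 'e) manifold \<Rightarrow> 'm set" where
  "points M \<equiv> topspace (mtop M)"

locale smooth_manifold =
  fixes M :: "('m, 'e::euclidean_space) manifold"
  assumes Hausdorff: "Hausdorff_space (mtop M)"
    and second_countable: "second_countable (mtop M)"
    and chart_domain: "(U, \<phi>) \<in> atlas M \<Longrightarrow> openin (mtop M) U"
    and chart_image: "(U, \<phi>) \<in> atlas M \<Longrightarrow> open (\<phi> ` U)"
    and chart_homeo:
      "(U, \<phi>) \<in> atlas M \<Longrightarrow> homeomorphic_map (subtopology (mtop M) U) (top_of_set (\<phi> ` U)) \<phi>"
    and charts_cover: "(\<Union>(U, \<phi>)\<in>atlas M. U) = points M"
    and charts_compatible:
      "(U, \<phi>) \<in> atlas M \<Longrightarrow> (V, \<psi>) \<in> atlas M \<Longrightarrow> smooth_on (\<phi> ` (U \<inter> V)) (\<psi> \<circ> inv_into U \<phi>)"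

definition product_manifold ::
  "('m, 'e) manifold \<Rightarrow> ('n, 'f) manifold \<Rightarrow> ('m \<times> 'n, 'e \<times> 'f) manifold" where
  "product_manifold M N =
     \<lparr>mtop = prod_topology (mtop M) (mtop N),
      atlas = {(U \<times> V, map_prod \<phi> \<psi>) | U \<phi> V \<psi>. (U, \<phi>) \<in> atlas M \<and> (V, \<psi>) \<in> atlas N}\<rparr>"

text \<open>The canonical manifold structure of a finite-dimensional vector space \<open>V\<close>: the charts are
  the linear isomorphisms onto the model space \<open>'e\<close>, whose dimension has to be that of
  \<open>V\<close>. The topology is the one making these isomorphisms homeomorphisms.\<close>

definition lin_isos :: "'v::real_vector set \<Rightarrow> ('v \<Rightarrow> 'e::euclidean_space) set" where
  "lin_isos V = {\<phi>. lin_on V \<phi> \<and> bij_betw \<phi> V UNIV}"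

definition vector_space_manifold ::
  "'v::real_vector set \<Rightarrow> ('v, 'e::euclidean_space) manifold" where
  "vector_space_manifold V =
     \<lparr>mtop = topology (\<lambda>W. W \<subseteq> V \<and> (\<forall>\<phi>\<in>(lin_isos V :: ('v \<Rightarrow> 'e) set). open (\<phi> ` W))),
      atlas = {V} \<times> lin_isos V\<rparr>"

definition smooth_fun ::
  "('m, 'e::euclidean_space) manifold \<Rightarrow> 'm set \<Rightarrow> ('m \<Rightarrow> real) \<Rightarrow> bool" where
  "smooth_fun M W f \<longleftrightarrow>
     openin (mtop M) W \<and> (\<forall>(U, \<phi>)\<in>atlas M. smooth_on (\<phi> ` (U \<inter> W)) (f \<circ> inv_into U \<phi>))"

definition smooth_near :: "('m, 'e::euclidean_space) manifold \<Rightarrow> 'm \<Rightarrow> ('m \<Rightarrow> real) \<Rightarrow> bool" where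
  "smooth_near M p f \<longleftrightarrow> (\<exists>W. p \<in> W \<and> smooth_fun M W f)"

definition smooth_map ::
  "('m, 'e::euclidean_space) manifold \<Rightarrow> ('n, 'f::euclidean_space) manifold \<Rightarrow> ('m \<Rightarrow> 'n) \<Rightarrow> bool" where
  "smooth_map M N F \<longleftrightarrow>
     continuous_map (mtop M) (mtop N) F \<and>
     (\<forall>(U, \<phi>)\<in>atlas M. \<forall>(V, \<psi>)\<in>atlas N.
        smooth_on (\<phi> ` (U \<inter> F -` V)) (\<psi> \<circ> F \<circ> inv_into U \<phi>))"

text \<open>A tangent vector at \<open>p\<close> is a directional derivative operator on the functions that are
  smooth near \<open>p\<close>; it is \<open>0\<close> on all other functions. No choice of chart enters, and tangent
  vectors are added and scaled pointwise.\<close>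

type_synonym 'm tangent = "('m \<Rightarrow> real) \<Rightarrow> real"

definition tangent_space :: "('m, 'e::euclidean_space) manifold \<Rightarrow> 'm \<Rightarrow> 'm tangent set" where
  "tangent_space M p =
     {v. \<exists>U \<phi> w. (U, \<phi>) \<in> atlas M \<and> p \<in> U \<and>
        v = (\<lambda>f. if smooth_near M p f
                 then frechet_derivative (f \<circ> inv_into U \<phi>) (at (\<phi> p)) w else 0)}"

text \<open>The source manifold of \<open>F\<close> is not needed, since \<open>v\<close> already acts on functions on it.\<close>

definition differential ::
  "('n, 'f::euclidean_space) manifold \<Rightarrow> ('m \<Rightarrow> 'n) \<Rightarrow> 'm \<Rightarrow> 'm tangent \<Rightarrow> 'n tangent" where
  "differential N F p v = (\<lambda>f. if smooth_near N (F p) f then v (f \<circ> F) else 0)"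

type_synonym 'm vfield = "'m \<Rightarrow> 'm tangent"

definition vector_fields :: "('m, 'e::euclidean_space) manifold \<Rightarrow> 'm vfield set" where
  "vector_fields M =
     {X. (\<forall>p\<in>points M. X p \<in> tangent_space M p) \<and> (\<forall>p. p \<notin> points M \<longrightarrow> X p = 0) \<and>
         (\<forall>W f. smooth_fun M W f \<longrightarrow> smooth_fun M W (\<lambda>p. X p f))}"

definition fun_times_field :: "('m \<Rightarrow> real) \<Rightarrow> 'm vfield \<Rightarrow> 'm vfield" where
  "fun_times_field h X = (\<lambda>p. h p *\<^sub>R X p)"

definition lie_bracket :: "('m, 'e::euclidean_space) manifold \<Rightarrow> 'm vfield \<Rightarrow> 'm vfield \<Rightarrow> 'm vfield" where
  "lie_bracket M X Y =
     (\<lambda>p f. if smooth_near M p f then X p (\<lambda>q. Y q f) - Y p (\<lambda>q. X q f) else 0)"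

definition linear_connection ::
  "('m, 'e::euclidean_space) manifold \<Rightarrow> ('m vfield \<Rightarrow> 'm vfield \<Rightarrow> 'm vfield) \<Rightarrow> bool" where
  "linear_connection M D \<longleftrightarrow>
     (\<forall>X\<in>vector_fields M. \<forall>Y\<in>vector_fields M.
        D X Y \<in> vector_fields M \<and>
        (\<forall>Z\<in>vector_fields M. D (X + Y) Z = D X Z + D Y Z \<and> D X (Y + Z) = D X Y + D X Z) \<and>
        (\<forall>h. smooth_fun M (points M) h \<longrightarrow>
           D (fun_times_field h X) Y = fun_times_field h (D X Y) \<and>
           D X (fun_times_field h Y) =
             fun_times_field (\<lambda>p. X p h) Y + fun_times_field h (D X Y)))"

definition torsion_free ::
  "('m, 'e::euclidean_space) manifold \<Rightarrow> ('m vfield \<Rightarrow> 'm vfield \<Rightarrow> 'm vfield) \<Rightarrow> bool" where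
  "torsion_free M D \<longleftrightarrow>
     (\<forall>X\<in>vector_fields M. \<forall>Y\<in>vector_fields M. D X Y - D Y X = lie_bracket M X Y)"

definition flat ::
  "('m, 'e::euclidean_space) manifold \<Rightarrow> ('m vfield \<Rightarrow> 'm vfield \<Rightarrow> 'm vfield) \<Rightarrow> bool" where
  "flat M D \<longleftrightarrow>
     (\<forall>X\<in>vector_fields M. \<forall>Y\<in>vector_fields M. \<forall>Z\<in>vector_fields M.
        D X (D Y Z) - D Y (D X Z) - D (lie_bracket M X Y) Z = 0)"

definition smooth_bilinear_field ::
  "('m, 'e::euclidean_space) manifold \<Rightarrow> ('m \<Rightarrow> 'm tangent \<Rightarrow> 'm tangent \<Rightarrow> real) \<Rightarrow> bool" where
  "smooth_bilinear_field M b \<longleftrightarrow>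
     (\<forall>p\<in>points M. bilin_form_on (tangent_space M p) (b p)) \<and>
     (\<forall>X\<in>vector_fields M. \<forall>Y\<in>vector_fields M. smooth_fun M (points M) (\<lambda>p. b p (X p) (Y p)))"

definition pseudo_riemannian_metric ::
  "('m, 'e::euclidean_space) manifold \<Rightarrow> ('m \<Rightarrow> 'm tangent \<Rightarrow> 'm tangent \<Rightarrow> real) \<Rightarrow> bool" where
  "pseudo_riemannian_metric M g \<longleftrightarrow>
     smooth_bilinear_field M g \<and>
     (\<forall>p\<in>points M. nondegenerate_on (tangent_space M p) (g p) \<and>
        (\<forall>u\<in>tangent_space M p. \<forall>v\<in>tangent_space M p. g p u v = g p v u))"

definition closed_two_form ::
  "('m, 'e::euclidean_space) manifold \<Rightarrow> ('m \<Rightarrow> 'm tangent \<Rightarrow> 'm tangent \<Rightarrow> real) \<Rightarrow> bool" where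
  "closed_two_form M \<omega> \<longleftrightarrow>
     (\<forall>X\<in>vector_fields M. \<forall>Y\<in>vector_fields M. \<forall>Z\<in>vector_fields M. \<forall>p\<in>points M.
        X p (\<lambda>q. \<omega> q (Y q) (Z q)) - Y p (\<lambda>q. \<omega> q (X q) (Z q)) + Z p (\<lambda>q. \<omega> q (X q) (Y q))
        - \<omega> p (lie_bracket M X Y p) (Z p) + \<omega> p (lie_bracket M X Z p) (Y p)
        - \<omega> p (lie_bracket M Y Z p) (X p) = 0)"

definition symplectic_form ::
  "('m, 'e::euclidean_space) manifold \<Rightarrow> ('m \<Rightarrow> 'm tangent \<Rightarrow> 'm tangent \<Rightarrow> real) \<Rightarrow> bool" where
  "symplectic_form M \<omega> \<longleftrightarrow>
     smooth_bilinear_field M \<omega> \<and>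
     (\<forall>p\<in>points M. nondegenerate_on (tangent_space M p) (\<omega> p) \<and>
        (\<forall>u\<in>tangent_space M p. \<omega> p u u = 0)) \<and>
     closed_two_form M \<omega>"

definition endo_apply ::
  "('m, 'e::euclidean_space) manifold \<Rightarrow> ('m \<Rightarrow> 'm tangent \<Rightarrow> 'm tangent) \<Rightarrow> 'm vfield \<Rightarrow> 'm vfield" where
  "endo_apply M j X = (\<lambda>p. if p \<in> points M then j p (X p) else 0)"

definition almost_complex_structure ::
  "('m, 'e::euclidean_space) manifold \<Rightarrow> ('m \<Rightarrow> 'm tangent \<Rightarrow> 'm tangent) \<Rightarrow> bool" where
  "almost_complex_structure M j \<longleftrightarrow>
     (\<forall>p\<in>points M. lin_on (tangent_space M p) (j p) \<and>
        (\<forall>u\<in>tangent_space M p. j p u \<in> tangent_space M p \<and> j p (j p u) = - u)) \<and>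
     (\<forall>X\<in>vector_fields M. endo_apply M j X \<in> vector_fields M)"

text \<open>Integrability is the vanishing of the Nijenhuis tensor.\<close>

definition complex_structure ::
  "('m, 'e::euclidean_space) manifold \<Rightarrow> ('m \<Rightarrow> 'm tangent \<Rightarrow> 'm tangent) \<Rightarrow> bool" where
  "complex_structure M j \<longleftrightarrow>
     almost_complex_structure M j \<and>
     (\<forall>X\<in>vector_fields M. \<forall>Y\<in>vector_fields M.
        lie_bracket M (endo_apply M j X) (endo_apply M j Y)
        - endo_apply M j (lie_bracket M (endo_apply M j X) Y)
        - endo_apply M j (lie_bracket M X (endo_apply M j Y))
        - lie_bracket M X Y = 0)"

locale lie_group = group G + smooth_manifold M
  for G :: "('m, 'r) monoid_scheme" (structure) and M :: "('m, 'e::euclidean_space) manifold" +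
  assumes points_eq_carrier: "points M = carrier G"
    and smooth_mult: "smooth_map (product_manifold M M) M (\<lambda>(x, y). x \<otimes> y)"
    and smooth_inv: "smooth_map M M (\<lambda>x. inv x)"

definition lie_algebra ::
  "('m, 'r) monoid_scheme \<Rightarrow> ('m, 'e::euclidean_space) manifold \<Rightarrow> 'm tangent set" where
  "lie_algebra G M = tangent_space M \<one>\<^bsub>G\<^esub>"

definition left_diff ::
  "('m, 'r) monoid_scheme \<Rightarrow> ('m, 'e::euclidean_space) manifold \<Rightarrow> 'm \<Rightarrow> 'm \<Rightarrow> 'm tangent \<Rightarrow> 'm tangent" where
  "left_diff G M \<sigma> \<tau> = differential M (\<lambda>x. \<sigma> \<otimes>\<^bsub>G\<^esub> x) \<tau>"

definition left_push ::
  "('m, 'r) monoid_scheme \<Rightarrow> ('m, 'e::euclidean_space) manifold \<Rightarrow> 'm \<Rightarrow> 'm vfield \<Rightarrow> 'm vfield" where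
  "left_push G M \<sigma> X =
     (\<lambda>\<tau>. if \<tau> \<in> carrier G
          then left_diff G M \<sigma> (inv\<^bsub>G\<^esub> \<sigma> \<otimes>\<^bsub>G\<^esub> \<tau>) (X (inv\<^bsub>G\<^esub> \<sigma> \<otimes>\<^bsub>G\<^esub> \<tau>)) else 0)"

definition left_invariant_fields ::
  "('m, 'r) monoid_scheme \<Rightarrow> ('m, 'e::euclidean_space) manifold \<Rightarrow> 'm vfield set" where
  "left_invariant_fields G M = {X \<in> vector_fields M. \<forall>\<sigma>\<in>carrier G. left_push G M \<sigma> X = X}"

definition left_field ::
  "('m, 'r) monoid_scheme \<Rightarrow> ('m, 'e::euclidean_space) manifold \<Rightarrow> 'm tangent \<Rightarrow> 'm vfield" where
  "left_field G M a = (\<lambda>\<sigma>. if \<sigma> \<in> carrier G then left_diff G M \<sigma> \<one>\<^bsub>G\<^esub> a else 0)"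

definition left_invariant_connection ::
  "('m, 'r) monoid_scheme \<Rightarrow> ('m, 'e::euclidean_space) manifold
    \<Rightarrow> ('m vfield \<Rightarrow> 'm vfield \<Rightarrow> 'm vfield) \<Rightarrow> bool" where
  "left_invariant_connection G M D \<longleftrightarrow>
     (\<forall>\<sigma>\<in>carrier G. \<forall>X\<in>vector_fields M. \<forall>Y\<in>vector_fields M.
        D (left_push G M \<sigma> X) (left_push G M \<sigma> Y) = left_push G M \<sigma> (D X Y))"

definition left_invariant_bilinear ::
  "('m, 'r) monoid_scheme \<Rightarrow> ('m, 'e::euclidean_space) manifold
    \<Rightarrow> ('m \<Rightarrow> 'm tangent \<Rightarrow> 'm tangent \<Rightarrow> real) \<Rightarrow> bool" where
  "left_invariant_bilinear G M b \<longleftrightarrow>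
     (\<forall>\<sigma>\<in>carrier G. \<forall>\<tau>\<in>carrier G. \<forall>u\<in>tangent_space M \<tau>. \<forall>v\<in>tangent_space M \<tau>.
        b (\<sigma> \<otimes>\<^bsub>G\<^esub> \<tau>) (left_diff G M \<sigma> \<tau> u) (left_diff G M \<sigma> \<tau> v) = b \<tau> u v)"

definition left_invariant_endo ::
  "('m, 'r) monoid_scheme \<Rightarrow> ('m, 'e::euclidean_space) manifold
    \<Rightarrow> ('m \<Rightarrow> 'm tangent \<Rightarrow> 'm tangent) \<Rightarrow> bool" where
  "left_invariant_endo G M j \<longleftrightarrow>
     (\<forall>\<sigma>\<in>carrier G. \<forall>\<tau>\<in>carrier G. \<forall>u\<in>tangent_space M \<tau>.
        j (\<sigma> \<otimes>\<^bsub>G\<^esub> \<tau>) (left_diff G M \<sigma> \<tau> u) = left_diff G M \<sigma> \<tau> (j \<tau> u))"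

definition flat_affine_lie_group ::
  "('m, 'r) monoid_scheme \<Rightarrow> ('m, 'e::euclidean_space) manifold
    \<Rightarrow> ('m vfield \<Rightarrow> 'm vfield \<Rightarrow> 'm vfield) \<Rightarrow> bool" where
  "flat_affine_lie_group G M D \<longleftrightarrow>
     lie_group G M \<and> linear_connection M D \<and> left_invariant_connection G M D \<and>
     flat M D \<and> torsion_free M D"

text \<open>The product \<open>a \<cdot> b = L\<^sub>a(b)\<close>: the connection applied to the left invariant fields
  extending \<open>a\<close> and \<open>b\<close> is left invariant, hence given by its value at the unit.\<close>

definition left_symmetric_product ::
  "('m, 'r) monoid_scheme \<Rightarrow> ('m, 'e::euclidean_space) manifold
    \<Rightarrow> ('m vfield \<Rightarrow> 'm vfield \<Rightarrow> 'm vfield) \<Rightarrow> 'm tangent \<Rightarrow> 'm tangent \<Rightarrow> 'm tangent" where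
  "left_symmetric_product G M D a b = D (left_field G M a) (left_field G M b) \<one>\<^bsub>G\<^esub>"

definition pseudo_hessian_lie_group ::
  "('m, 'r) monoid_scheme \<Rightarrow> ('m, 'e::euclidean_space) manifold
    \<Rightarrow> ('m vfield \<Rightarrow> 'm vfield \<Rightarrow> 'm vfield) \<Rightarrow> ('m \<Rightarrow> 'm tangent \<Rightarrow> 'm tangent \<Rightarrow> real) \<Rightarrow> bool" where
  "pseudo_hessian_lie_group G M D g \<longleftrightarrow>
     flat_affine_lie_group G M D \<and> pseudo_riemannian_metric M g \<and> left_invariant_bilinear G M g \<and>
     (\<forall>X\<in>left_invariant_fields G M. \<forall>Y\<in>left_invariant_fields G M.
      \<forall>Z\<in>left_invariant_fields G M. \<forall>p\<in>carrier G.
        g p (D X Y p) (Z p) - g p (X p) (D Y Z p) = g p (D Y X p) (Z p) - g p (Y p) (D X Z p))"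

definition symplectic_lie_group ::
  "('m, 'r) monoid_scheme \<Rightarrow> ('m, 'e::euclidean_space) manifold
    \<Rightarrow> ('m \<Rightarrow> 'm tangent \<Rightarrow> 'm tangent \<Rightarrow> real) \<Rightarrow> bool" where
  "symplectic_lie_group G M \<omega> \<longleftrightarrow>
     lie_group G M \<and> symplectic_form M \<omega> \<and> left_invariant_bilinear G M \<omega>"

definition pseudo_kaehler_lie_group ::
  "('m, 'r) monoid_scheme \<Rightarrow> ('m, 'e::euclidean_space) manifold
    \<Rightarrow> ('m \<Rightarrow> 'm tangent \<Rightarrow> 'm tangent \<Rightarrow> real) \<Rightarrow> ('m \<Rightarrow> 'm tangent \<Rightarrow> 'm tangent) \<Rightarrow> bool" where
  "pseudo_kaehler_lie_group G M \<omega> j \<longleftrightarrow>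
     symplectic_lie_group G M \<omega> \<and>
     complex_structure M j \<and> left_invariant_endo G M j \<and>
     pseudo_riemannian_metric M (\<lambda>p a b. \<omega> p a (j p b)) \<and>
     left_invariant_bilinear G M (\<lambda>p a b. \<omega> p a (j p b))"

definition dual_manifold ::
  "('m, 'r) monoid_scheme \<Rightarrow> ('m, 'e::euclidean_space) manifold
    \<Rightarrow> ('m tangent \<Rightarrow> real, 'e) manifold" where
  "dual_manifold G M = vector_space_manifold (dual_space (lie_algebra G M))"

definition dual_representation ::
  "('m, 'r) monoid_scheme \<Rightarrow> ('m, 'e::euclidean_space) manifold
    \<Rightarrow> ('m \<Rightarrow> ('m tangent \<Rightarrow> real) \<Rightarrow> ('m tangent \<Rightarrow> real)) \<Rightarrow> bool" where
  "dual_representation G M \<rho> \<longleftrightarrow>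
     (let V = dual_space (lie_algebra G M) in
       (\<forall>\<sigma>\<in>carrier G. \<rho> \<sigma> \<in> V \<rightarrow> V \<and> lin_on V (\<rho> \<sigma>)) \<and>
       (\<forall>\<beta>\<in>V. \<rho> \<one>\<^bsub>G\<^esub> \<beta> = \<beta>) \<and>
       (\<forall>\<sigma>\<in>carrier G. \<forall>\<tau>\<in>carrier G. \<forall>\<beta>\<in>V. \<rho> (\<sigma> \<otimes>\<^bsub>G\<^esub> \<tau>) \<beta> = \<rho> \<sigma> (\<rho> \<tau> \<beta>)) \<and>
       smooth_map (product_manifold M (dual_manifold G M)) (dual_manifold G M)
         (\<lambda>(\<sigma>, \<beta>). \<rho> \<sigma> \<beta>))"

text \<open>The differential at the unit of \<open>\<sigma> \<mapsto> \<rho> \<sigma> \<beta>\<close> in direction \<open>a\<close>. As \<open>\<rho> \<sigma> \<beta>\<close> is a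
  functional on the Lie algebra, it is computed by evaluating at each \<open>b\<close>; recall that
  the tangent vector \<open>a\<close> acts on functions by differentiation.\<close>

definition representation_differential ::
  "('m \<Rightarrow> ('m tangent \<Rightarrow> real) \<Rightarrow> ('m tangent \<Rightarrow> real)) \<Rightarrow> 'm tangent
    \<Rightarrow> ('m tangent \<Rightarrow> real) \<Rightarrow> ('m tangent \<Rightarrow> real)" where
  "representation_differential \<rho> a \<beta> = (\<lambda>b. a (\<lambda>\<sigma>. \<rho> \<sigma> \<beta> b))"

text \<open>The cotangent bundle is trivialised by left translations, so its underlying manifold is
  the product of the dual of the Lie algebra with the group.\<close>

definition cotangent_manifold ::
  "('m, 'r) monoid_scheme \<Rightarrow> ('m, 'e::euclidean_space) manifold
    \<Rightarrow> (('m tangent \<Rightarrow> real) \<times> 'm, 'e \<times> 'e) manifold" where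
  "cotangent_manifold G M = product_manifold (dual_manifold G M) M"

definition cotangent_group ::
  "('m, 'r) monoid_scheme \<Rightarrow> ('m, 'e::euclidean_space) manifold
    \<Rightarrow> ('m \<Rightarrow> ('m tangent \<Rightarrow> real) \<Rightarrow> ('m tangent \<Rightarrow> real))
    \<Rightarrow> (('m tangent \<Rightarrow> real) \<times> 'm) monoid" where
  "cotangent_group G M \<rho> =
     \<lparr>carrier = dual_space (lie_algebra G M) \<times> carrier G,
      mult = (\<lambda>(\<alpha>, \<sigma>) (\<beta>, \<tau>). (\<alpha> + \<rho> \<sigma> \<beta>, \<sigma> \<otimes>\<^bsub>G\<^esub> \<tau>)),
      one = (0, \<one>\<^bsub>G\<^esub>)\<rparr>"

end

theory Submission
  imports Defs
begin

text \<open>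
  A left invariant structure on a Lie group is its value at the unit, so the theorem is a statement
  about the Lie algebra of the cotangent group. This Lie algebra is \<open>\<gg>\<^sup>* \<oplus> \<gg>\<close>, where \<open>\<gg>\<^sup>*\<close> is an
  abelian ideal on which \<open>a \<in> \<gg>\<close> acts by \<open>\<beta> \<mapsto> - \<beta> \<circ> L\<^sub>a\<close>, and where \<open>[a, b] = a \<cdot> b - b \<cdot> a\<close>
  because the connection is torsion free. Let \<open>a\<^sup>\<flat>\<close> be the covector dual to \<open>a\<close> under the metric.
  The structure is
  \<open>\<Omega> (\<alpha> + a, \<beta> + b) = \<alpha> b - \<beta> a\<close> and \<open>J (a\<^sup>\<flat>) = a\<close>, \<open>J a = - a\<^sup>\<flat>\<close>. Three facts make it
  pseudo-Kaehler.

  \<^item> \<open>\<Omega>\<close> is closed: the terms of the cocycle condition cancel in pairs as soon as the bracket of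
    \<open>\<gg>\<close> is the commutator of the product (\<open>\<Omega>_cocycle\<close>).
  \<^item> \<open>J\<close> is integrable: paired with a vector \<open>c\<close>, the Nijenhuis tensor becomes
    \<open>\<langle>[a, b], c\<rangle> = \<langle>a, b \<cdot> c\<rangle> - \<langle>b, a \<cdot> c\<rangle>\<close>, which is the Hessian condition (\<open>J_nijenhuis\<close>).
  \<^item> \<open>\<Omega> (x, J y)\<close> is the orthogonal sum of the metric on \<open>\<gg>\<close> and its dual on \<open>\<gg>\<^sup>*\<close>; it is symmetric
    and nondegenerate since the metric is.

  The rest of the text leads from the group to this linear algebra and back. The way back is
  \<open>pseudo_kaehler_from_lie_algebra\<close>. Closedness and integrability speak of arbitrary vector
  fields, not only of left invariant ones; a vector field is expanded in a left invariant frame with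
  smooth coefficients, and the structure equation (\<open>structure_equation\<close>) expresses the coefficients
  of a Lie bracket by derivatives of coefficients and the structure constants. In the exterior
  derivative of \<open>\<Omega>\<close> and in the Nijenhuis tensor of \<open>J\<close> all derivatives then cancel, and only the two
  algebraic identities are left.

  The way to the Lie algebra is the computation of the structure constants of the cotangent group
  (\<open>\<kappa>_fst_br\<close> and \<open>\<kappa>_snd_br\<close>). The bracket of two left invariant fields at the unit is a tangent
  vector (\<open>lie_bracket_tangent\<close>, by the symmetry of second derivatives). A tangent vector of the
  product \<open>\<gg>\<^sup>* \<times> G\<close> is known once it is known on functions of the group variable and on linear functions of
  the covector variable, and on these the left invariant fields are explicit: on the former they
  act as left invariant fields of \<open>G\<close>, and on the latter they are orbit maps of the representation,
  whose derivative at the unit is prescribed.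

  Tangent vectors act on functions that are smooth near a point. Coordinate functions are among them,
  so bases of tangent spaces are obtained without cut-off functions.
\<close>

section \<open>Calculus of smooth functions between Euclidean spaces\<close>

abbreviation derivative_at (\<open>\<D>\<close>) where "\<D> f x \<equiv> frechet_derivative f (at x)"

lemma has_derivative_cong_open:
  assumes "open S" "x \<in> S" "\<And>y. y \<in> S \<Longrightarrow> f y = g y"
  shows "(f has_derivative f') (at x) \<longleftrightarrow> (g has_derivative f') (at x)"
  using assms by (metis has_derivative_transform_within_open)

lemma differentiable_cong_open:
  assumes "open S" "x \<in> S" "\<And>y. y \<in> S \<Longrightarrow> f y = g y"
  shows "f differentiable (at x) \<longleftrightarrow> g differentiable (at x)"
  unfolding differentiable_def using has_derivative_cong_open[OF assms] by simp

lemma frechet_derivative_cong_open: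
  assumes "open S" "x \<in> S" "\<And>y. y \<in> S \<Longrightarrow> f y = g y"
  shows "\<D> f x = \<D> g x"
  unfolding frechet_derivative_def using has_derivative_cong_open[OF assms] by simp

lemma frechet_derivative_eqI:
  "(f has_derivative f') (at x) \<Longrightarrow> \<D> f x v = f' v"
  using frechet_derivative_at by metis

lemma Ck_on_cong:
  assumes "open S" "\<And>x. x \<in> S \<Longrightarrow> f x = g x"
  shows "Ck_on k S f \<longleftrightarrow> Ck_on k S g"
  using assms(2)
proof (induction k arbitrary: f g)
  case 0
  then show ?case by (simp cong: continuous_on_cong)
next
  case (Suc k)
  have "Ck_on k S (\<lambda>x. \<D> f x v) \<longleftrightarrow> Ck_on k S (\<lambda>x. \<D> g x v)" for v
    by (rule Suc.IH) (simp add: frechet_derivative_cong_open[OF assms(1) _ Suc.prems])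
  then show ?case
    using differentiable_cong_open[OF assms(1) _ Suc.prems] by simp
qed

lemma Ck_on_subset: "Ck_on k S f \<Longrightarrow> T \<subseteq> S \<Longrightarrow> Ck_on k T f"
  by (induction k arbitrary: f) (auto intro: continuous_on_subset)

lemma Ck_on_lower: "Ck_on (Suc k) S f \<Longrightarrow> Ck_on k S f"
proof (induction k arbitrary: f)
  case 0
  then have "\<forall>x\<in>S. f differentiable (at x)" by simp
  then have "continuous_on S f"
    by (intro continuous_at_imp_continuous_on ballI differentiable_imp_continuous_within) blast
  then show ?case by simp
next
  case (Suc k)
  have "\<forall>x\<in>S. f differentiable (at x)" "\<And>v. Ck_on (Suc k) S (\<lambda>x. \<D> f x v)"
    using Suc.prems unfolding Ck_on.simps(2)[of "Suc k"] by blast+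
  with Suc.IH show ?case unfolding Ck_on.simps(2)[of k] by blast
qed

lemma Ck_on_locally:
  assumes "\<And>x. x \<in> S \<Longrightarrow> \<exists>T. open T \<and> x \<in> T \<and> Ck_on k T f"
  shows "Ck_on k S f"
  using assms
proof (induction k arbitrary: f)
  case 0
  show ?case unfolding Ck_on.simps
  proof (rule continuous_at_imp_continuous_on, safe)
    fix x assume "x \<in> S"
    from 0[OF this] show "isCont f x" by (auto simp: continuous_on_eq_continuous_at)
  qed
next
  case (Suc k)
  have "f differentiable (at x)" if "x \<in> S" for x
    using Suc.prems[OF that] by auto
  moreover have "Ck_on k S (\<lambda>x. \<D> f x v)" for v
    by (rule Suc.IH) (use Suc.prems in fastforce)
  ultimately show ?case by simp
qed

lemma Ck_on_const: "Ck_on k S (\<lambda>x. c)"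
  by (induction k arbitrary: c) auto

lemma Ck_on_bounded_linear:
  assumes "bounded_linear f" shows "Ck_on k S f"
proof (cases k)
  case 0
  then show ?thesis using assms by (simp add: linear_continuous_on)
next
  case (Suc n)
  have "\<D> f x = f" for x
    using bounded_linear_imp_has_derivative[OF assms] frechet_derivative_at by metis
  with Suc show ?thesis
    using bounded_linear_imp_differentiable[OF assms] by (simp add: Ck_on_const)
qed

lemma Ck_on_linear_compose:
  assumes "open S" "bounded_linear L" "Ck_on k S f"
  shows "Ck_on k S (\<lambda>x. L (f x))"
  using assms(3)
proof (induction k arbitrary: f)
  case 0
  then show ?case using bounded_linear.continuous_on[OF assms(2)] by simp
next
  case (Suc k)
  have der: "((\<lambda>x. L (f x)) has_derivative (\<lambda>v. L (\<D> f x v))) (at x)"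
    if "x \<in> S" for x
    using Suc.prems that by (intro bounded_linear.has_derivative[OF assms(2)])
      (auto simp: frechet_derivative_works)
  have "Ck_on k S (\<lambda>x. \<D> (\<lambda>x. L (f x)) x v)" for v
    using Suc.IH[of "\<lambda>x. \<D> f x v"] Suc.prems
    by (subst Ck_on_cong[OF assms(1) frechet_derivative_eqI[OF der]]) auto
  then show ?case using der by (auto simp: differentiable_def)
qed

lemma Ck_on_add:
  assumes "open S" "Ck_on k S f" "Ck_on k S g"
  shows "Ck_on k S (\<lambda>x. f x + g x)"
  using assms(2,3)
proof (induction k arbitrary: f g)
  case 0
  then show ?case by (auto intro: continuous_intros)
next
  case (Suc k)
  have der: "((\<lambda>x. f x + g x) has_derivative
      (\<lambda>v. \<D> f x v + \<D> g x v)) (at x)"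
    if "x \<in> S" for x
    using Suc.prems that by (intro derivative_intros) (auto simp: frechet_derivative_works)
  have "Ck_on k S (\<lambda>x. \<D> (\<lambda>x. f x + g x) x v)" for v
    using Suc.prems Suc.IH[of "\<lambda>x. \<D> f x v" "\<lambda>x. \<D> g x v"]
    by (subst Ck_on_cong[OF assms(1) frechet_derivative_eqI[OF der]]) simp_all
  then show ?case using der by (auto simp: differentiable_def)
qed

lemma Ck_on_sum:
  assumes "open S" "\<And>i. i \<in> I \<Longrightarrow> Ck_on k S (f i)"
  shows "Ck_on k S (\<lambda>x. \<Sum>i\<in>I. f i x)"
  using assms(2)
  by (induction I rule: infinite_finite_induct) (auto intro: Ck_on_const Ck_on_add[OF assms(1)])

lemma Ck_on_scaleR:
  assumes "open S" "Ck_on k S c" "Ck_on k S f"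
  shows "Ck_on k S (\<lambda>x. c x *\<^sub>R f x)"
  using assms(2,3)
proof (induction k arbitrary: c f)
  case 0
  then show ?case by (auto intro: continuous_intros)
next
  case (Suc k)
  have der: "((\<lambda>x. c x *\<^sub>R f x) has_derivative
      (\<lambda>v. c x *\<^sub>R \<D> f x v + \<D> c x v *\<^sub>R f x)) (at x)"
    if "x \<in> S" for x
    using Suc.prems that by (intro derivative_intros) (auto simp: frechet_derivative_works)
  have "Ck_on k S (\<lambda>x. \<D> (\<lambda>x. c x *\<^sub>R f x) x v)" for v
  proof (subst Ck_on_cong[OF assms(1) frechet_derivative_eqI[OF der]])
    show "Ck_on k S (\<lambda>x. c x *\<^sub>R \<D> f x v + \<D> c x v *\<^sub>R f x)"
      using Suc.prems
      by (intro Ck_on_add[OF assms(1)] Suc.IH Ck_on_lower[OF Suc.prems(1)] Ck_on_lower[OF Suc.prems(2)]) simp_all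
  qed
  then show ?case using der by (auto simp: differentiable_def)
qed

text \<open>A derivative is a linear combination of the partial derivatives, with the components of the
  direction as coefficients. This is what reduces a derivative in a variable direction, and hence
  the chain rule at every order, to products and sums.\<close>

lemma frechet_derivative_partials:
  fixes f :: "'e::euclidean_space \<Rightarrow> 'f::real_normed_vector"
  assumes "f differentiable (at x)"
  shows "\<D> f x v = (\<Sum>b\<in>Basis. (v \<bullet> b) *\<^sub>R \<D> f x b)"
proof -
  interpret linear "\<D> f x" by (rule linear_frechet_derivative[OF assms])
  have "\<D> f x v = \<D> f x (\<Sum>b\<in>Basis. (v \<bullet> b) *\<^sub>R b)"
    by (simp add: euclidean_representation)
  also have "\<dots> = (\<Sum>b\<in>Basis. (v \<bullet> b) *\<^sub>R \<D> f x b)"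
    by (simp add: sum scaleR)
  finally show ?thesis .
qed

lemma Ck_on_compose:
  fixes f :: "'e::euclidean_space \<Rightarrow> 'f::euclidean_space" and g :: "'f \<Rightarrow> 'h::real_normed_vector"
  assumes "open S" "open T" "f ` S \<subseteq> T" "Ck_on k S f" "Ck_on k T g"
  shows "Ck_on k S (\<lambda>x. g (f x))"
  using assms(4,5)
proof (induction k arbitrary: g)
  case 0
  then show ?case using assms(3) by (auto intro: continuous_on_compose2)
next
  case (Suc k)
  have dg: "g differentiable (at (f x))" if "x \<in> S" for x
    using Suc.prems that assms(3) by auto
  have der: "((\<lambda>x. g (f x)) has_derivative
      (\<lambda>v. \<D> g (f x) (\<D> f x v))) (at x)"
    if "x \<in> S" for x
    using Suc.prems dg that by (intro has_derivative_compose[of f _ x UNIV g, simplified])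
      (auto simp: frechet_derivative_works)
  have "\<D> (\<lambda>x. g (f x)) x v =
      (\<Sum>b\<in>Basis. (\<D> f x v \<bullet> b) *\<^sub>R \<D> g (f x) b)"
    if "x \<in> S" for x v
    unfolding frechet_derivative_eqI[OF der[OF that]] by (rule frechet_derivative_partials[OF dg[OF that]])
  moreover have "Ck_on k S (\<lambda>x. \<Sum>b\<in>Basis. (\<D> f x v \<bullet> b) *\<^sub>R
      \<D> g (f x) b)" for v
  proof (intro Ck_on_sum Ck_on_scaleR assms(1))
    fix b :: 'f
    show "Ck_on k S (\<lambda>x. \<D> f x v \<bullet> b)"
      using Suc.prems(1) by (intro Ck_on_linear_compose[OF assms(1) bounded_linear_inner_left]) simp
    show "Ck_on k S (\<lambda>x. \<D> g (f x) b)"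
      using Suc.prems(2) by (intro Suc.IH[OF Ck_on_lower[OF Suc.prems(1)]]) simp
  qed
  ultimately have "Ck_on k S (\<lambda>x. \<D> (\<lambda>x. g (f x)) x v)" for v
    by (subst Ck_on_cong[OF assms(1)]) auto
  then show ?case using der by (auto simp: differentiable_def)
qed

lemma smooth_on_eqI:
  "smooth_on S g \<Longrightarrow> open S \<Longrightarrow> (\<And>x. x \<in> S \<Longrightarrow> f x = g x) \<Longrightarrow> smooth_on S f"
  unfolding smooth_on_def using Ck_on_cong by blast

lemma smooth_on_subset: "smooth_on S f \<Longrightarrow> T \<subseteq> S \<Longrightarrow> smooth_on T f"
  unfolding smooth_on_def using Ck_on_subset by blast

lemma smooth_on_locally:
  "(\<And>x. x \<in> S \<Longrightarrow> \<exists>T. open T \<and> x \<in> T \<and> smooth_on T f) \<Longrightarrow> smooth_on S f"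
  unfolding smooth_on_def by (metis Ck_on_locally)

lemma smooth_on_const: "smooth_on S (\<lambda>x. c)"
  by (simp add: smooth_on_def Ck_on_const)

lemma smooth_on_bounded_linear: "bounded_linear f \<Longrightarrow> smooth_on S f"
  by (simp add: smooth_on_def Ck_on_bounded_linear)

lemma smooth_on_linear_compose:
  "open S \<Longrightarrow> bounded_linear L \<Longrightarrow> smooth_on S f \<Longrightarrow> smooth_on S (\<lambda>x. L (f x))"
  by (simp add: smooth_on_def Ck_on_linear_compose)

lemma smooth_on_add:
  "open S \<Longrightarrow> smooth_on S f \<Longrightarrow> smooth_on S g \<Longrightarrow> smooth_on S (\<lambda>x. f x + g x)"
  by (simp add: smooth_on_def Ck_on_add)

lemma smooth_on_sum:
  "open S \<Longrightarrow> (\<And>i. i \<in> I \<Longrightarrow> smooth_on S (f i)) \<Longrightarrow> smooth_on S (\<lambda>x. \<Sum>i\<in>I. f i x)"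
  by (simp add: smooth_on_def Ck_on_sum)

lemma smooth_on_scaleR:
  "open S \<Longrightarrow> smooth_on S c \<Longrightarrow> smooth_on S f \<Longrightarrow> smooth_on S (\<lambda>x. c x *\<^sub>R f x)"
  by (simp add: smooth_on_def Ck_on_scaleR)

lemma smooth_on_mult:
  fixes f g :: "'e::euclidean_space \<Rightarrow> real"
  shows "open S \<Longrightarrow> smooth_on S f \<Longrightarrow> smooth_on S g \<Longrightarrow> smooth_on S (\<lambda>x. f x * g x)"
  using smooth_on_scaleR[of S f g] by simp

lemma smooth_on_Pair:
  assumes "open S" "smooth_on S f" "smooth_on S g"
  shows "smooth_on S (\<lambda>x. (f x, g x))"
proof -
  have "smooth_on S (\<lambda>x. (f x, 0))"
    by (rule smooth_on_linear_compose[OF assms(1) _ assms(2)])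
       (rule bounded_linear_Pair[OF bounded_linear_ident bounded_linear_zero])
  moreover have "smooth_on S (\<lambda>x. (0, g x))"
    by (rule smooth_on_linear_compose[OF assms(1) _ assms(3)])
       (rule bounded_linear_Pair[OF bounded_linear_zero bounded_linear_ident])
  ultimately have "smooth_on S (\<lambda>x. (f x, 0) + (0, g x))"
    by (rule smooth_on_add[OF assms(1)])
  then show ?thesis by simp
qed

lemma smooth_on_compose:
  fixes f :: "'e::euclidean_space \<Rightarrow> 'f::euclidean_space" and g :: "'f \<Rightarrow> 'h::real_normed_vector"
  assumes "open S" "open T" "f ` S \<subseteq> T" "smooth_on S f" "smooth_on T g"
  shows "smooth_on S (\<lambda>x. g (f x))"
  using assms Ck_on_compose unfolding smooth_on_def by blast

lemma smooth_on_imp_differentiable: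
  assumes "smooth_on S f" "x \<in> S" shows "f differentiable (at x)"
  using assms unfolding smooth_on_def by (metis Ck_on.simps(2))

lemma smooth_on_imp_has_derivative:
  assumes "smooth_on S f" "x \<in> S"
  shows "(f has_derivative \<D> f x) (at x)"
  using smooth_on_imp_differentiable[OF assms] frechet_derivative_works by blast

lemma smooth_on_imp_continuous_on: "smooth_on S f \<Longrightarrow> continuous_on S f"
  unfolding smooth_on_def by (metis Ck_on.simps(1))

lemma smooth_on_directional_derivative:
  "smooth_on S f \<Longrightarrow> smooth_on S (\<lambda>x. \<D> f x v)"
  unfolding smooth_on_def by (metis Ck_on.simps(2))

lemma smooth_on_components:
  fixes f :: "'e::euclidean_space \<Rightarrow> 'f::euclidean_space"
  assumes "open S" "\<And>b. b \<in> Basis \<Longrightarrow> smooth_on S (\<lambda>x. f x \<bullet> b)"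
  shows "smooth_on S f"
proof -
  have "smooth_on S (\<lambda>x. \<Sum>b\<in>Basis. (f x \<bullet> b) *\<^sub>R b)"
    using assms by (intro smooth_on_sum smooth_on_scaleR smooth_on_const) auto
  then show ?thesis by (simp add: euclidean_representation)
qed

lemma smooth_on_derivative_along:
  fixes f :: "'e::euclidean_space \<Rightarrow> 'h::real_normed_vector" and y w :: "'d::euclidean_space \<Rightarrow> 'e"
  assumes "open S" "open T" "y ` T \<subseteq> S" "smooth_on S f" "smooth_on T y" "smooth_on T w"
  shows "smooth_on T (\<lambda>x. \<D> f (y x) (w x))"
proof -
  have "smooth_on T (\<lambda>x. \<Sum>b\<in>Basis. (w x \<bullet> b) *\<^sub>R \<D> f (y x) b)"
    by (intro smooth_on_sum smooth_on_scaleR assms(2)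
        smooth_on_compose[OF assms(2,1,3,5) smooth_on_directional_derivative[OF assms(4)]]
        smooth_on_linear_compose[OF assms(2) bounded_linear_inner_left assms(6)])
  moreover have "\<D> f (y x) (w x) =
      (\<Sum>b\<in>Basis. (w x \<bullet> b) *\<^sub>R \<D> f (y x) b)" if "x \<in> T" for x
    using that assms(3) smooth_on_imp_differentiable[OF assms(4)] by (intro frechet_derivative_partials) auto
  ultimately show ?thesis by (rule smooth_on_eqI[OF _ assms(2)])
qed

text \<open>The mixed second difference of \<open>f\<close> is symmetric in the two directions; two applications of the
  mean value theorem express it by a mixed second derivative at a nearby point.\<close>

lemma second_difference_mean_value:
  fixes f :: "'e::euclidean_space \<Rightarrow> real"
  assumes "smooth_on S f" "t > 0"
    and seg: "\<And>r s. 0 \<le> r \<Longrightarrow> r \<le> t \<Longrightarrow> 0 \<le> s \<Longrightarrow> s \<le> t \<Longrightarrow> x + r *\<^sub>R u + s *\<^sub>R v \<in> S"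
  shows "\<exists>r s. 0 \<le> r \<and> r \<le> t \<and> 0 \<le> s \<and> s \<le> t \<and>
     f (x + t *\<^sub>R u + t *\<^sub>R v) - f (x + t *\<^sub>R u) - f (x + t *\<^sub>R v) + f x =
     t * t * \<D> (\<lambda>y. \<D> f y u) (x + r *\<^sub>R u + s *\<^sub>R v) v"
proof -
  let ?D = "\<lambda>y. \<D> f y u"
  have line: "((\<lambda>r. h (p + r *\<^sub>R d)) has_real_derivative \<D> h (p + r *\<^sub>R d) d) (at r)"
    if "smooth_on S h" "p + r *\<^sub>R d \<in> S" for h :: "'e \<Rightarrow> real" and p d r
  proof -
    have h: "(h has_derivative \<D> h (p + r *\<^sub>R d)) (at (p + r *\<^sub>R d))"
      by (rule smooth_on_imp_has_derivative[OF that])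
    have "((\<lambda>r. p + r *\<^sub>R d) has_derivative (\<lambda>e. e *\<^sub>R d)) (at r)"
      by (auto intro!: derivative_eq_intros)
    from diff_chain_at[OF this h] show ?thesis
      using linear_scale[OF linear_frechet_derivative[OF smooth_on_imp_differentiable[OF that]]]
      unfolding has_field_derivative_def by (simp add: o_def mult.commute[of _ "frechet_derivative h _ d"])
  qed
  define \<phi> where "\<phi> r = f ((x + t *\<^sub>R v) + r *\<^sub>R u) - f (x + r *\<^sub>R u)" for r
  have "\<exists>r. 0 < r \<and> r < t \<and> \<phi> t - \<phi> 0 = (t - 0) * (?D ((x + t *\<^sub>R v) + r *\<^sub>R u) - ?D (x + r *\<^sub>R u))"
  proof (rule MVT2[OF assms(2)])
    fix r assume r: "0 \<le> r" "r \<le> t"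
    have s: "(x + t *\<^sub>R v) + r *\<^sub>R u \<in> S" "x + r *\<^sub>R u \<in> S"
      using seg[of r t] seg[of r 0] r assms(2) by (auto simp: algebra_simps)
    show "(\<phi> has_real_derivative ?D ((x + t *\<^sub>R v) + r *\<^sub>R u) - ?D (x + r *\<^sub>R u)) (at r)"
      unfolding \<phi>_def by (rule DERIV_diff[OF line[OF assms(1) s(1)] line[OF assms(1) s(2)]])
  qed
  then obtain r where r: "0 < r" "r < t"
    and \<phi>: "\<phi> t - \<phi> 0 = t * (?D ((x + t *\<^sub>R v) + r *\<^sub>R u) - ?D (x + r *\<^sub>R u))" by auto
  define \<psi> where "\<psi> s = ?D ((x + r *\<^sub>R u) + s *\<^sub>R v)" for s
  have "\<exists>s. 0 < s \<and> s < t \<and> \<psi> t - \<psi> 0 = (t - 0) * \<D> ?D ((x + r *\<^sub>R u) + s *\<^sub>R v) v"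
  proof (rule MVT2[OF assms(2)])
    fix s assume s: "0 \<le> s" "s \<le> t"
    then have "(x + r *\<^sub>R u) + s *\<^sub>R v \<in> S" using seg[of r s] r by simp
    from line[OF smooth_on_directional_derivative[OF assms(1)] this]
    show "(\<psi> has_real_derivative \<D> ?D ((x + r *\<^sub>R u) + s *\<^sub>R v) v) (at s)"
      unfolding \<psi>_def .
  qed
  then obtain s where s: "0 < s" "s < t"
    and \<psi>: "\<psi> t - \<psi> 0 = t * \<D> ?D ((x + r *\<^sub>R u) + s *\<^sub>R v) v" by auto
  have swap: "(x + t *\<^sub>R v) + r *\<^sub>R u = (x + r *\<^sub>R u) + t *\<^sub>R v" by simp
  have "\<phi> t - \<phi> 0 = t * (\<psi> t - \<psi> 0)" using \<phi> unfolding \<psi>_def swap by simp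
  moreover have "\<phi> t - \<phi> 0 = f (x + t *\<^sub>R u + t *\<^sub>R v) - f (x + t *\<^sub>R u) - f (x + t *\<^sub>R v) + f x"
    by (simp add: \<phi>_def algebra_simps)
  ultimately show ?thesis using r s \<psi> by (intro exI[of _ r] exI[of _ s]) (simp add: mult.assoc)
qed

text \<open>The second difference, divided by the square of the step, is a mixed derivative in either order at
  points that tend to \<open>x\<close>; both mixed derivatives are continuous.\<close>

lemma symmetric_second_derivative:
  fixes f :: "'e::euclidean_space \<Rightarrow> real"
  assumes "open S" "smooth_on S f" "x \<in> S"
  shows "\<D> (\<lambda>y. \<D> f y u) x v =
         \<D> (\<lambda>y. \<D> f y v) x u"
proof -
  define A where "A y = \<D> (\<lambda>y. \<D> f y u) y v" for y
  define B where "B y = \<D> (\<lambda>y. \<D> f y v) y u" for y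
  have contA: "isCont A x" and contB: "isCont B x"
    unfolding A_def B_def using assms
    by (auto intro!: continuous_on_interior[of S] smooth_on_imp_continuous_on
        smooth_on_directional_derivative simp: interior_open)
  have "\<bar>A x - B x\<bar> \<le> e" if "e > 0" for e
  proof -
    obtain d1 where d1: "d1 > 0" "\<And>y. dist y x < d1 \<Longrightarrow> dist (A y) (A x) < e/2"
      using contA \<open>e > 0\<close> unfolding continuous_at_eps_delta by (meson half_gt_zero)
    obtain d2 where d2: "d2 > 0" "\<And>y. dist y x < d2 \<Longrightarrow> dist (B y) (B x) < e/2"
      using contB \<open>e > 0\<close> unfolding continuous_at_eps_delta by (meson half_gt_zero)
    obtain d3 where d3: "d3 > 0" "ball x d3 \<subseteq> S" using assms openE by blast
    define d where "d = min d1 (min d2 d3)"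
    \<comment> \<open>With this step the whole parallelogram spanned by the increments stays within distance \<open>d\<close> of \<open>x\<close>.\<close>
    define t where "t = d / (norm u + norm v + 1)"
    have d: "d > 0" using d1 d2 d3 by (simp add: d_def)
    have nz: "norm u + norm v + 1 > 0" using norm_ge_zero[of u] norm_ge_zero[of v] by linarith
    have t: "t > 0" unfolding t_def using d nz by (rule divide_pos_pos)
    have near: "dist (x + r *\<^sub>R a + s *\<^sub>R b) x < d"
      if "0 \<le> r" "r \<le> t" "0 \<le> s" "s \<le> t" "norm a + norm b = norm u + norm v" for r s and a b :: 'e
    proof -
      have "dist (x + r *\<^sub>R a + s *\<^sub>R b) x = norm (r *\<^sub>R a + s *\<^sub>R b)"
        by (simp add: dist_norm algebra_simps)
      also have "\<dots> \<le> r * norm a + s * norm b"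
        using norm_triangle_ineq[of "r *\<^sub>R a" "s *\<^sub>R b"] that by simp
      also have "\<dots> \<le> t * norm a + t * norm b"
        using that by (intro add_mono mult_right_mono) auto
      also have "\<dots> = t * (norm u + norm v)" using that by (metis distrib_left)
      also have "\<dots> < t * (norm u + norm v + 1)" using t by simp
      also have "\<dots> = d" using nz by (simp add: t_def)
      finally show ?thesis .
    qed
    have inS: "x + r *\<^sub>R a + s *\<^sub>R b \<in> S"
      if "0 \<le> r" "r \<le> t" "0 \<le> s" "s \<le> t" "norm a + norm b = norm u + norm v" for r s and a b :: 'e
      using near[OF that] d3(2) by (auto simp: d_def dist_commute subset_iff)
    obtain r s where rs: "0 \<le> r" "r \<le> t" "0 \<le> s" "s \<le> t"
      and eqA: "f (x + t *\<^sub>R u + t *\<^sub>R v) - f (x + t *\<^sub>R u) - f (x + t *\<^sub>R v) + f x = t * t * A (x + r *\<^sub>R u + s *\<^sub>R v)"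
      using second_difference_mean_value[OF assms(2) t, of x u v] inS unfolding A_def by auto
    obtain r' s' where rs': "0 \<le> r'" "r' \<le> t" "0 \<le> s'" "s' \<le> t"
      and eqB: "f (x + t *\<^sub>R v + t *\<^sub>R u) - f (x + t *\<^sub>R v) - f (x + t *\<^sub>R u) + f x = t * t * B (x + r' *\<^sub>R v + s' *\<^sub>R u)"
      using second_difference_mean_value[OF assms(2) t, of x v u] inS[of _ _ v u] unfolding B_def
      by (auto simp: add.commute)
    have "x + t *\<^sub>R v + t *\<^sub>R u = x + t *\<^sub>R u + t *\<^sub>R v" by simp
    with eqA eqB have "t * t * A (x + r *\<^sub>R u + s *\<^sub>R v) = t * t * B (x + r' *\<^sub>R v + s' *\<^sub>R u)"
      by (smt (verit))
    then have "A (x + r *\<^sub>R u + s *\<^sub>R v) = B (x + r' *\<^sub>R v + s' *\<^sub>R u)" using t by simp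
    moreover have "dist (A (x + r *\<^sub>R u + s *\<^sub>R v)) (A x) < e/2"
      using near[OF rs] by (intro d1) (simp add: d_def)
    moreover have "dist (B (x + r' *\<^sub>R v + s' *\<^sub>R u)) (B x) < e/2"
      using near[OF rs', of v u] by (intro d2) (simp add: d_def)
    ultimately show ?thesis unfolding dist_real_def by linarith
  qed
  from this[of "\<bar>A x - B x\<bar> / 2"] have "A x = B x" by (cases "A x = B x") auto
  then show ?thesis by (simp add: A_def B_def)
qed

text \<open>The product rule. The second order term is symmetric in \<open>w\<close> and \<open>y x\<close>, and for this reason it
  drops out of a commutator of fields.\<close>

lemma frechet_derivative_of_directional_derivative:
  fixes f :: "'e::euclidean_space \<Rightarrow> real"
  assumes "open S" "smooth_on S f" "smooth_on S y" "x \<in> S"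
  shows "\<D> (\<lambda>z. \<D> f z (y z)) x w =
     \<D> f x (\<D> y x w) +
     \<D> (\<lambda>z. \<D> f z w) x (y x)"
proof -
  define H where "H u = \<D> (\<lambda>z. \<D> f z u) x" for u
  have Hder: "((\<lambda>z. \<D> f z u) has_derivative H u) (at x)" for u
    unfolding H_def by (rule smooth_on_imp_has_derivative[OF smooth_on_directional_derivative[OF assms(2)] assms(4)])
  have yder: "((\<lambda>z. y z \<bullet> b) has_derivative (\<lambda>w. \<D> y x w \<bullet> b)) (at x)" for b
    by (rule has_derivative_inner_left[OF smooth_on_imp_has_derivative[OF assms(3,4)]])
  have "((\<lambda>z. \<Sum>b\<in>Basis. (y z \<bullet> b) *\<^sub>R \<D> f z b) has_derivative
     (\<lambda>w. \<Sum>b\<in>Basis. (y x \<bullet> b) *\<^sub>R H b w + (\<D> y x w \<bullet> b) *\<^sub>R \<D> f x b)) (at x)"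
    by (rule has_derivative_sum[OF has_derivative_scaleR[OF yder Hder]])
  from frechet_derivative_eqI[OF this]
  have "\<D> (\<lambda>z. \<D> f z (y z)) x w =
      (\<Sum>b\<in>Basis. (y x \<bullet> b) *\<^sub>R H b w + (\<D> y x w \<bullet> b) *\<^sub>R \<D> f x b)"
    by (subst frechet_derivative_cong_open[OF assms(1,4) frechet_derivative_partials[OF smooth_on_imp_differentiable[OF assms(2)]]])
  also have "\<dots> = (\<Sum>b\<in>Basis. (y x \<bullet> b) *\<^sub>R H b w) + \<D> f x (\<D> y x w)"
    unfolding sum.distrib
    unfolding frechet_derivative_partials[OF smooth_on_imp_differentiable[OF assms(2,4)], of "\<D> y x w"] ..
  also have "(\<Sum>b\<in>Basis. (y x \<bullet> b) *\<^sub>R H b w) = (\<Sum>b\<in>Basis. (y x \<bullet> b) *\<^sub>R H w b)"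
    unfolding H_def symmetric_second_derivative[OF assms(1,2,4), of _ w] ..
  also have "\<dots> = H w (y x)"
    unfolding H_def
    by (rule frechet_derivative_partials[symmetric, OF smooth_on_imp_differentiable[OF
          smooth_on_directional_derivative[OF assms(2)] assms(4)]])
  finally show ?thesis by (simp add: H_def)
qed

section \<open>Smooth functions and tangent vectors on a manifold\<close>

definition chart_tangent ::
  "('m, 'e::euclidean_space) manifold \<Rightarrow> 'm set \<Rightarrow> ('m \<Rightarrow> 'e) \<Rightarrow> 'm \<Rightarrow> 'e \<Rightarrow> 'm tangent" where
  "chart_tangent M U \<phi> p w =
     (\<lambda>f. if smooth_near M p f then \<D> (f \<circ> inv_into U \<phi>) (\<phi> p) w else 0)"

context smooth_manifold
begin

lemma chart_subset: "(U, \<phi>) \<in> atlas M \<Longrightarrow> U \<subseteq> points M"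
  using chart_domain openin_subset by blast

lemma chart_inj_on: "(U, \<phi>) \<in> atlas M \<Longrightarrow> inj_on \<phi> U"
  using chart_homeo chart_subset
  by (metis homeomorphic_imp_injective_map topspace_subtopology_subset)

lemma chart_inverse [simp]: "(U, \<phi>) \<in> atlas M \<Longrightarrow> p \<in> U \<Longrightarrow> inv_into U \<phi> (\<phi> p) = p"
  using chart_inj_on inv_into_f_f by metis

lemma chart_open_image:
  assumes "(U, \<phi>) \<in> atlas M" "openin (mtop M) W"
  shows "open (\<phi> ` (U \<inter> W))"
proof -
  have "openin (subtopology (mtop M) U) (U \<inter> W)"
    using assms(2) by (simp add: openin_subtopology_Int2)
  moreover have "U \<inter> W \<subseteq> topspace (subtopology (mtop M) U)"
    using chart_subset[OF assms(1)] by auto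
  ultimately have "openin (top_of_set (\<phi> ` U)) (\<phi> ` (U \<inter> W))"
    using homeomorphic_map_openness[OF chart_homeo[OF assms(1)]] by blast
  then show ?thesis using chart_image[OF assms(1)] openin_open_eq by blast
qed

lemma chart_open_preimage:
  assumes "(U, \<phi>) \<in> atlas M" "open T"
  shows "openin (mtop M) {p \<in> U. \<phi> p \<in> T}"
proof -
  have "continuous_map (subtopology (mtop M) U) (top_of_set (\<phi> ` U)) \<phi>"
    using chart_homeo[OF assms(1)] homeomorphic_imp_continuous_map by blast
  then have "openin (subtopology (mtop M) U) {p \<in> topspace (subtopology (mtop M) U). \<phi> p \<in> \<phi> ` U \<inter> T}"
    using assms(2) by (intro openin_continuous_map_preimage) (auto simp: openin_open)
  moreover have "{p \<in> topspace (subtopology (mtop M) U). \<phi> p \<in> \<phi> ` U \<inter> T} = {p \<in> U. \<phi> p \<in> T}"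
    using chart_subset[OF assms(1)] by auto
  ultimately show ?thesis
    using chart_domain[OF assms(1)] by (simp add: openin_open_subtopology)
qed

lemma obtain_chart:
  assumes "p \<in> points M"
  obtains U \<phi> where "(U, \<phi>) \<in> atlas M" "p \<in> U"
  using assms charts_cover by blast

lemma smooth_fun_chart:
  "smooth_fun M W f \<Longrightarrow> (U, \<phi>) \<in> atlas M \<Longrightarrow> smooth_on (\<phi> ` (U \<inter> W)) (f \<circ> inv_into U \<phi>)"
  unfolding smooth_fun_def by blast

lemma smooth_fun_openin: "smooth_fun M W f \<Longrightarrow> openin (mtop M) W"
  unfolding smooth_fun_def by blast

lemma smooth_fun_subset_points: "smooth_fun M W f \<Longrightarrow> W \<subseteq> points M"
  using smooth_fun_openin openin_subset by blast

text \<open>As the transition maps are smooth, smoothness near a point may be tested in a single chart.\<close>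

lemma smooth_funI:
  assumes W: "openin (mtop M) W"
    and loc: "\<And>p. p \<in> W \<Longrightarrow> \<exists>U \<phi> T. (U, \<phi>) \<in> atlas M \<and> p \<in> U \<and> open T \<and> \<phi> p \<in> T \<and> smooth_on T (f \<circ> inv_into U \<phi>)"
  shows "smooth_fun M W f"
proof -
  have "smooth_on (\<psi> ` (V \<inter> W)) (f \<circ> inv_into V \<psi>)" if V: "(V, \<psi>) \<in> atlas M" for V \<psi>
  proof (rule smooth_on_locally)
    fix x assume "x \<in> \<psi> ` (V \<inter> W)"
    then obtain p where p: "p \<in> V" "p \<in> W" "x = \<psi> p" by blast
    obtain U \<phi> T where U: "(U, \<phi>) \<in> atlas M" "p \<in> U" and T: "open T" "\<phi> p \<in> T" "smooth_on T (f \<circ> inv_into U \<phi>)"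
      using loc[OF p(2)] by blast
    define O' where "O' = {q \<in> U. \<phi> q \<in> T}"
    define S where "S = \<psi> ` (V \<inter> O')"
    have S: "open S" unfolding S_def O'_def
      by (rule chart_open_image[OF V chart_open_preimage[OF U(1) T(1)]])
    have trans: "smooth_on S (\<phi> \<circ> inv_into V \<psi>)"
      by (rule smooth_on_subset[OF charts_compatible[OF V U(1)]]) (auto simp: S_def O'_def)
    have "smooth_on S (\<lambda>y. (f \<circ> inv_into U \<phi>) ((\<phi> \<circ> inv_into V \<psi>) y))"
      using V by (intro smooth_on_compose[OF S T(1) _ trans T(3)]) (auto simp: S_def O'_def)
    then have "smooth_on S (f \<circ> inv_into V \<psi>)"
      by (rule smooth_on_eqI[OF _ S]) (use V U(1) in \<open>auto simp: S_def O'_def\<close>)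
    moreover have "x \<in> S" using p U T by (auto simp: S_def O'_def)
    ultimately show "\<exists>T. open T \<and> x \<in> T \<and> smooth_on T (f \<circ> inv_into V \<psi>)" using S by blast
  qed
  then show ?thesis using W unfolding smooth_fun_def by blast
qed

lemma smooth_fun_subset:
  assumes "smooth_fun M W f" "openin (mtop M) W'" "W' \<subseteq> W"
  shows "smooth_fun M W' f"
  unfolding smooth_fun_def
proof safe
  fix U \<phi> assume "(U, \<phi>) \<in> atlas M"
  from smooth_fun_chart[OF assms(1) this]
  show "smooth_on (\<phi> ` (U \<inter> W')) (f \<circ> inv_into U \<phi>)"
    by (rule smooth_on_subset) (use assms(3) in blast)
qed (use assms in auto)

lemma smooth_fun_cong:
  assumes "smooth_fun M W g" "\<And>p. p \<in> W \<Longrightarrow> f p = g p"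
  shows "smooth_fun M W f"
  unfolding smooth_fun_def
proof safe
  show "openin (mtop M) W" using smooth_fun_openin[OF assms(1)] .
  fix U \<phi> assume U: "(U, \<phi>) \<in> atlas M"
  show "smooth_on (\<phi> ` (U \<inter> W)) (f \<circ> inv_into U \<phi>)"
    using smooth_fun_chart[OF assms(1) U] chart_open_image[OF U smooth_fun_openin[OF assms(1)]]
    by (rule smooth_on_eqI) (use U assms(2) in auto)
qed

lemma smooth_fun_const: "openin (mtop M) W \<Longrightarrow> smooth_fun M W (\<lambda>p. c)"
  unfolding smooth_fun_def by (auto simp: o_def smooth_on_const)

lemma smooth_fun_add:
  assumes "smooth_fun M W f" "smooth_fun M W g"
  shows "smooth_fun M W (\<lambda>p. f p + g p)"
  unfolding smooth_fun_def
proof safe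
  show W: "openin (mtop M) W" using smooth_fun_openin[OF assms(1)] .
  fix U \<phi> assume U: "(U, \<phi>) \<in> atlas M"
  show "smooth_on (\<phi> ` (U \<inter> W)) ((\<lambda>p. f p + g p) \<circ> inv_into U \<phi>)"
    using smooth_on_add[OF chart_open_image[OF U W] smooth_fun_chart[OF assms(1) U] smooth_fun_chart[OF assms(2) U]]
    by (simp add: o_def)
qed

lemma smooth_fun_mult:
  assumes "smooth_fun M W f" "smooth_fun M W g"
  shows "smooth_fun M W (\<lambda>p. f p * g p)"
  unfolding smooth_fun_def
proof safe
  show W: "openin (mtop M) W" using smooth_fun_openin[OF assms(1)] .
  fix U \<phi> assume U: "(U, \<phi>) \<in> atlas M"
  show "smooth_on (\<phi> ` (U \<inter> W)) ((\<lambda>p. f p * g p) \<circ> inv_into U \<phi>)"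
    using smooth_on_mult[OF chart_open_image[OF U W] smooth_fun_chart[OF assms(1) U] smooth_fun_chart[OF assms(2) U]]
    by (simp add: o_def)
qed

lemma smooth_fun_scale: "smooth_fun M W f \<Longrightarrow> smooth_fun M W (\<lambda>p. c * f p)"
  using smooth_fun_mult[OF smooth_fun_const] smooth_fun_openin by blast

lemma smooth_fun_sum:
  assumes "openin (mtop M) W" "\<And>i. i \<in> I \<Longrightarrow> smooth_fun M W (f i)"
  shows "smooth_fun M W (\<lambda>p. \<Sum>i\<in>I. f i p)"
  using assms(2)
  by (induction I rule: infinite_finite_induct)
     (simp_all add: smooth_fun_const[OF assms(1)] smooth_fun_add)

lemma smooth_fun_chartI:
  assumes U: "(U, \<phi>) \<in> atlas M" and W: "openin (mtop M) W" "W \<subseteq> U"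
    and g: "smooth_on (\<phi> ` W) g" and eq: "\<And>p. p \<in> W \<Longrightarrow> f p = g (\<phi> p)"
  shows "smooth_fun M W f"
proof (rule smooth_funI[OF W(1)])
  fix p assume p: "p \<in> W"
  have "U \<inter> W = W" using W(2) by blast
  then have op: "open (\<phi> ` W)" using chart_open_image[OF U W(1)] by simp
  have "smooth_on (\<phi> ` W) (f \<circ> inv_into U \<phi>)"
    using g op by (rule smooth_on_eqI) (use U W(2) eq in \<open>auto simp: subset_iff\<close>)
  then show "\<exists>U \<phi> T. (U, \<phi>) \<in> atlas M \<and> p \<in> U \<and> open T \<and> \<phi> p \<in> T \<and> smooth_on T (f \<circ> inv_into U \<phi>)"
    using U W(2) p op by blast
qed

lemma smooth_fun_coordinate: "(U, \<phi>) \<in> atlas M \<Longrightarrow> smooth_fun M U (\<lambda>p. \<phi> p \<bullet> b)"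
  by (rule smooth_fun_chartI[where g = "\<lambda>x. x \<bullet> b"])
     (auto simp: chart_domain smooth_on_bounded_linear bounded_linear_inner_left)

lemma smooth_nearI: "smooth_fun M W f \<Longrightarrow> p \<in> W \<Longrightarrow> smooth_near M p f"
  unfolding smooth_near_def by blast

lemma smooth_near_imp_point: "smooth_near M p f \<Longrightarrow> p \<in> points M"
  unfolding smooth_near_def using smooth_fun_subset_points by blast

lemma smooth_near_cong:
  assumes "openin (mtop M) W" "p \<in> W" "\<And>q. q \<in> W \<Longrightarrow> f q = g q"
  shows "smooth_near M p f \<longleftrightarrow> smooth_near M p g"
proof -
  have *: "smooth_near M p f" if g: "smooth_near M p g" and eq: "\<And>q. q \<in> W \<Longrightarrow> f q = g q" for f g
  proof -
    obtain W' where W': "p \<in> W'" "smooth_fun M W' g" using g unfolding smooth_near_def by blast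
    have op: "openin (mtop M) (W \<inter> W')" using assms(1) smooth_fun_openin[OF W'(2)] by blast
    have "smooth_fun M (W \<inter> W') f"
      by (rule smooth_fun_cong[OF smooth_fun_subset[OF W'(2) op]]) (auto simp: eq)
    then show ?thesis using smooth_nearI W'(1) assms(2) by blast
  qed
  show ?thesis using *[of f g] *[of g f] assms(3) by auto
qed

lemma smooth_near2:
  assumes "smooth_near M p f" "smooth_near M p g"
  obtains W where "p \<in> W" "smooth_fun M W f" "smooth_fun M W g"
proof -
  obtain W W' where W: "p \<in> W" "smooth_fun M W f" "p \<in> W'" "smooth_fun M W' g"
    using assms unfolding smooth_near_def by blast
  have op: "openin (mtop M) (W \<inter> W')" using smooth_fun_openin W by blast
  show ?thesis
    by (rule that[of "W \<inter> W'"]) (use W smooth_fun_subset[OF W(2) op] smooth_fun_subset[OF W(4) op] in auto)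
qed

lemma smooth_near_add: "smooth_near M p f \<Longrightarrow> smooth_near M p g \<Longrightarrow> smooth_near M p (\<lambda>q. f q + g q)"
  by (erule (1) smooth_near2) (rule smooth_nearI[OF smooth_fun_add])

lemma smooth_near_mult: "smooth_near M p f \<Longrightarrow> smooth_near M p g \<Longrightarrow> smooth_near M p (\<lambda>q. f q * g q)"
  by (erule (1) smooth_near2) (rule smooth_nearI[OF smooth_fun_mult])

lemma smooth_near_const: "p \<in> points M \<Longrightarrow> smooth_near M p (\<lambda>q. c)"
  using smooth_fun_const[OF openin_topspace] smooth_nearI by blast

lemma smooth_near_sum:
  assumes "p \<in> points M" "\<And>i. i \<in> I \<Longrightarrow> smooth_near M p (f i)"
  shows "smooth_near M p (\<lambda>q. \<Sum>i\<in>I. f i q)"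
  using assms(2)
  by (induction I rule: infinite_finite_induct)
     (simp_all add: smooth_near_const[OF assms(1)] smooth_near_add)

lemma smooth_near_coordinate: "(U, \<phi>) \<in> atlas M \<Longrightarrow> p \<in> U \<Longrightarrow> smooth_near M p (\<lambda>q. \<phi> q \<bullet> b)"
  using smooth_fun_coordinate smooth_nearI by blast

lemma smooth_near_chart:
  assumes "(U, \<phi>) \<in> atlas M" "p \<in> U" "smooth_near M p f"
  obtains T where "open T" "\<phi> p \<in> T" "T \<subseteq> \<phi> ` U" "smooth_on T (f \<circ> inv_into U \<phi>)"
proof -
  obtain W where W: "p \<in> W" "smooth_fun M W f" using assms(3) unfolding smooth_near_def by blast
  show ?thesis
    by (rule that[of "\<phi> ` (U \<inter> W)"])
      (use W assms chart_open_image smooth_fun_chart smooth_fun_openin in auto)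
qed

lemma smooth_near_chart_differentiable:
  assumes "(U, \<phi>) \<in> atlas M" "p \<in> U" "smooth_near M p f"
  shows "(f \<circ> inv_into U \<phi>) differentiable (at (\<phi> p))"
  using smooth_near_chart[OF assms] smooth_on_imp_differentiable by metis

lemma chart_tangent_change:
  assumes U: "(U, \<phi>) \<in> atlas M" "p \<in> U" and V: "(V, \<psi>) \<in> atlas M" "p \<in> V"
  shows "chart_tangent M U \<phi> p w = chart_tangent M V \<psi> p (\<D> (\<psi> \<circ> inv_into U \<phi>) (\<phi> p) w)"
proof (rule ext)
  fix f
  show "chart_tangent M U \<phi> p w f = chart_tangent M V \<psi> p (\<D> (\<psi> \<circ> inv_into U \<phi>) (\<phi> p) w) f"
  proof (cases "smooth_near M p f")
    case True
    let ?S = "\<phi> ` (U \<inter> V)"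
    have S: "open ?S" using chart_open_image[OF U(1) chart_domain[OF V(1)]] .
    have x: "\<phi> p \<in> ?S" using U V by blast
    have d1: "(\<psi> \<circ> inv_into U \<phi>) differentiable (at (\<phi> p))"
      using smooth_on_imp_differentiable[OF charts_compatible[OF U(1) V(1)] x] .
    have "(f \<circ> inv_into V \<psi>) differentiable (at (\<psi> p))"
      using smooth_near_chart_differentiable[OF V True] .
    then have d2: "(f \<circ> inv_into V \<psi>) differentiable (at ((\<psi> \<circ> inv_into U \<phi>) (\<phi> p)))"
      using U by simp
    have "\<D> (f \<circ> inv_into U \<phi>) (\<phi> p) =
        \<D> ((f \<circ> inv_into V \<psi>) \<circ> (\<psi> \<circ> inv_into U \<phi>)) (\<phi> p)"
      by (rule frechet_derivative_cong_open[OF S x]) (use U V in auto)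
    also have "\<dots> = \<D> (f \<circ> inv_into V \<psi>) (\<psi> p) \<circ> \<D> (\<psi> \<circ> inv_into U \<phi>) (\<phi> p)"
      using frechet_derivative_compose[OF d1 d2] unfolding comp_apply[of \<psi>] chart_inverse[OF U] .
    finally show ?thesis using True by (simp add: chart_tangent_def)
  qed (simp add: chart_tangent_def)
qed

text \<open>By the chain rule, a single chart around \<open>p\<close> already yields every tangent vector at \<open>p\<close>.\<close>

lemma tangent_space_chart:
  assumes "(U, \<phi>) \<in> atlas M" "p \<in> U"
  shows "tangent_space M p = range (chart_tangent M U \<phi> p)"
proof
  show "tangent_space M p \<subseteq> range (chart_tangent M U \<phi> p)"
  proof
    fix v assume "v \<in> tangent_space M p"
    then obtain V \<psi> w where V: "(V, \<psi>) \<in> atlas M" "p \<in> V" and "v = chart_tangent M V \<psi> p w"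
      unfolding tangent_space_def chart_tangent_def by blast
    with chart_tangent_change[OF V assms] show "v \<in> range (chart_tangent M U \<phi> p)" by simp
  qed
next
  show "range (chart_tangent M U \<phi> p) \<subseteq> tangent_space M p"
    unfolding tangent_space_def chart_tangent_def using assms by blast
qed

lemma tangent_vectorE:
  assumes "v \<in> tangent_space M p"
  obtains U \<phi> w where "(U, \<phi>) \<in> atlas M" "p \<in> U" "v = chart_tangent M U \<phi> p w"
  using assms unfolding tangent_space_def chart_tangent_def by blast

lemma tangent_space_imp_point: "v \<in> tangent_space M p \<Longrightarrow> p \<in> points M"
  by (erule tangent_vectorE) (use chart_subset in blast)

lemma chart_tangent_add:
  assumes "(U, \<phi>) \<in> atlas M" "p \<in> U"
  shows "chart_tangent M U \<phi> p (w + w') = chart_tangent M U \<phi> p w + chart_tangent M U \<phi> p w'"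
  using linear_add[OF linear_frechet_derivative[OF smooth_near_chart_differentiable[OF assms]]]
  by (auto simp: chart_tangent_def fun_eq_iff)

lemma chart_tangent_scaleR:
  assumes "(U, \<phi>) \<in> atlas M" "p \<in> U"
  shows "chart_tangent M U \<phi> p (c *\<^sub>R w) = c *\<^sub>R chart_tangent M U \<phi> p w"
  using linear_scale[OF linear_frechet_derivative[OF smooth_near_chart_differentiable[OF assms]]]
  by (auto simp: chart_tangent_def fun_eq_iff scaleR_fun_def)

lemma chart_tangent_coordinate:
  assumes "(U, \<phi>) \<in> atlas M" "p \<in> U"
  shows "chart_tangent M U \<phi> p w (\<lambda>q. \<phi> q \<bullet> b) = w \<bullet> b"
proof -
  have "\<D> ((\<lambda>q. \<phi> q \<bullet> b) \<circ> inv_into U \<phi>) (\<phi> p) = \<D> (\<lambda>x. x \<bullet> b) (\<phi> p)"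
    by (rule frechet_derivative_cong_open[OF chart_image[OF assms(1)]]) (use assms in auto)
  moreover have "((\<lambda>x. x \<bullet> b) has_derivative (\<lambda>w. w \<bullet> b)) (at (\<phi> p))"
    by (auto intro!: derivative_eq_intros)
  ultimately show ?thesis
    using smooth_near_coordinate[OF assms] by (simp add: chart_tangent_def frechet_derivative_eqI)
qed

text \<open>Tangent vectors only see germs, so the coordinate functions, although defined on the chart domain
  only, may be inserted into them. They separate the tangent vectors.\<close>

lemma inj_chart_tangent:
  assumes "(U, \<phi>) \<in> atlas M" "p \<in> U"
  shows "inj (chart_tangent M U \<phi> p)"
proof (rule injI)
  fix w w' assume "chart_tangent M U \<phi> p w = chart_tangent M U \<phi> p w'"
  then have "w \<bullet> b = w' \<bullet> b" for b using chart_tangent_coordinate[OF assms] by metis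
  then show "w = w'" by (rule euclidean_eqI)
qed

lemma tangent_vector_coordinates:
  assumes "(U, \<phi>) \<in> atlas M" "p \<in> U" "v \<in> tangent_space M p"
  shows "v = chart_tangent M U \<phi> p (\<Sum>b\<in>Basis. v (\<lambda>q. \<phi> q \<bullet> b) *\<^sub>R b)"
proof -
  obtain w where w: "v = chart_tangent M U \<phi> p w" using assms tangent_space_chart by blast
  then show ?thesis by (simp add: chart_tangent_coordinate[OF assms(1,2)] euclidean_representation)
qed

lemma tangent_space_add:
  assumes "v \<in> tangent_space M p" "v' \<in> tangent_space M p"
  shows "v + v' \<in> tangent_space M p"
proof -
  obtain U \<phi> where U: "(U, \<phi>) \<in> atlas M" "p \<in> U"
    using obtain_chart[OF tangent_space_imp_point[OF assms(1)]] .
  then show ?thesis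
    using assms unfolding tangent_space_chart[OF U] by (auto simp: chart_tangent_add[OF U, symmetric])
qed

lemma tangent_space_scaleR:
  assumes "v \<in> tangent_space M p"
  shows "c *\<^sub>R v \<in> tangent_space M p"
proof -
  obtain U \<phi> where U: "(U, \<phi>) \<in> atlas M" "p \<in> U"
    using obtain_chart[OF tangent_space_imp_point[OF assms]] .
  then show ?thesis
    using assms unfolding tangent_space_chart[OF U] by (auto simp: chart_tangent_scaleR[OF U, symmetric])
qed

lemma tangent_space_zero:
  assumes "p \<in> points M" shows "0 \<in> tangent_space M p"
proof -
  obtain U \<phi> where U: "(U, \<phi>) \<in> atlas M" "p \<in> U" using obtain_chart[OF assms] .
  then have "chart_tangent M U \<phi> p 0 \<in> tangent_space M p" using tangent_space_chart by blast
  from tangent_space_scaleR[OF this, of 0] show ?thesis by simp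
qed

lemma tangent_space_diff: "v \<in> tangent_space M p \<Longrightarrow> v' \<in> tangent_space M p \<Longrightarrow> v - v' \<in> tangent_space M p"
  using tangent_space_add[of v p "(-1) *\<^sub>R v'"] tangent_space_scaleR[of v' p "-1"] by simp

lemma tangent_vector_not_smooth: "v \<in> tangent_space M p \<Longrightarrow> \<not> smooth_near M p f \<Longrightarrow> v f = 0"
  by (erule tangent_vectorE) (simp add: chart_tangent_def)

lemma tangent_vector_cong:
  assumes "v \<in> tangent_space M p" "openin (mtop M) W" "p \<in> W" "\<And>q. q \<in> W \<Longrightarrow> f q = g q"
  shows "v f = v g"
proof -
  obtain U \<phi> w where U: "(U, \<phi>) \<in> atlas M" "p \<in> U" "v = chart_tangent M U \<phi> p w"
    using assms(1) tangent_vectorE by blast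
  have "\<D> (f \<circ> inv_into U \<phi>) (\<phi> p) = \<D> (g \<circ> inv_into U \<phi>) (\<phi> p)"
    by (rule frechet_derivative_cong_open[OF chart_open_image[OF U(1) assms(2)]]) (use U assms(3,4) in auto)
  then show ?thesis
    using smooth_near_cong[OF assms(2,3,4)] by (simp add: U(3) chart_tangent_def)
qed

lemma tangent_vector_const:
  assumes "v \<in> tangent_space M p" shows "v (\<lambda>q. c) = 0"
  using assms by (auto elim!: tangent_vectorE simp: chart_tangent_def o_def)

lemma tangent_vector_add:
  assumes "v \<in> tangent_space M p" "smooth_near M p f" "smooth_near M p g"
  shows "v (\<lambda>q. f q + g q) = v f + v g"
proof -
  obtain U \<phi> w where U: "(U, \<phi>) \<in> atlas M" "p \<in> U" "v = chart_tangent M U \<phi> p w"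
    using assms(1) tangent_vectorE by blast
  have "((\<lambda>x. (f \<circ> inv_into U \<phi>) x + (g \<circ> inv_into U \<phi>) x) has_derivative
      (\<lambda>w. \<D> (f \<circ> inv_into U \<phi>) (\<phi> p) w + \<D> (g \<circ> inv_into U \<phi>) (\<phi> p) w)) (at (\<phi> p))"
    by (intro has_derivative_add frechet_derivative_works[THEN iffD1] smooth_near_chart_differentiable[OF U(1,2)] assms)
  from frechet_derivative_eqI[OF this, of w] show ?thesis
    using assms smooth_near_add by (simp add: U(3) chart_tangent_def o_def)
qed

lemma tangent_vector_mult:
  assumes "v \<in> tangent_space M p" "smooth_near M p f" "smooth_near M p g"
  shows "v (\<lambda>q. f q * g q) = f p * v g + v f * g p"
proof -
  obtain U \<phi> w where U: "(U, \<phi>) \<in> atlas M" "p \<in> U" "v = chart_tangent M U \<phi> p w"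
    using assms(1) tangent_vectorE by blast
  have "((\<lambda>x. (f \<circ> inv_into U \<phi>) x * (g \<circ> inv_into U \<phi>) x) has_derivative
      (\<lambda>w. (f \<circ> inv_into U \<phi>) (\<phi> p) * \<D> (g \<circ> inv_into U \<phi>) (\<phi> p) w +
           \<D> (f \<circ> inv_into U \<phi>) (\<phi> p) w * (g \<circ> inv_into U \<phi>) (\<phi> p))) (at (\<phi> p))"
    by (intro has_derivative_mult frechet_derivative_works[THEN iffD1] smooth_near_chart_differentiable[OF U(1,2)] assms)
  from frechet_derivative_eqI[OF this, of w] show ?thesis
    using assms smooth_near_mult U by (simp add: chart_tangent_def o_def)
qed

lemma tangent_vector_scale:
  assumes "v \<in> tangent_space M p" "smooth_near M p f"
  shows "v (\<lambda>q. c * f q) = c * v f"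
  using tangent_vector_mult[OF assms(1) smooth_near_const assms(2)] tangent_vector_const[OF assms(1)]
    tangent_space_imp_point[OF assms(1)] by simp

lemma tangent_vector_sum:
  assumes "v \<in> tangent_space M p" "\<And>i. i \<in> I \<Longrightarrow> smooth_near M p (f i)"
  shows "v (\<lambda>q. \<Sum>i\<in>I. f i q) = (\<Sum>i\<in>I. v (f i))"
  using assms(2)
proof (induction I rule: infinite_finite_induct)
  case (insert i I)
  then show ?case
    using tangent_vector_add[OF assms(1), of "f i" "\<lambda>q. \<Sum>i\<in>I. f i q"]
      smooth_near_sum[OF tangent_space_imp_point[OF assms(1)], of I f] by simp
qed (simp_all add: tangent_vector_const[OF assms(1)])

lemma vector_field_tangent: "X \<in> vector_fields M \<Longrightarrow> p \<in> points M \<Longrightarrow> X p \<in> tangent_space M p"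
  unfolding vector_fields_def by blast

lemma vector_field_smooth: "X \<in> vector_fields M \<Longrightarrow> smooth_fun M W f \<Longrightarrow> smooth_fun M W (\<lambda>p. X p f)"
  unfolding vector_fields_def by blast

lemma vector_field_smooth_near: "X \<in> vector_fields M \<Longrightarrow> smooth_near M p f \<Longrightarrow> smooth_near M p (\<lambda>q. X q f)"
  unfolding smooth_near_def using vector_field_smooth by blast

text \<open>The components are the values of the field on the coordinate functions.\<close>

lemma vector_field_components_smooth:
  assumes "X \<in> vector_fields M" "(U, \<phi>) \<in> atlas M"
  shows "smooth_on (\<phi> ` U) (\<lambda>x. \<Sum>b\<in>Basis. X (inv_into U \<phi> x) (\<lambda>q. \<phi> q \<bullet> b) *\<^sub>R b)"
proof -
  have op: "open (\<phi> ` U)" by (rule chart_image[OF assms(2)])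
  have "smooth_on (\<phi> ` U) (\<lambda>x. X (inv_into U \<phi> x) (\<lambda>q. \<phi> q \<bullet> b))" for b
    using smooth_fun_chart[OF vector_field_smooth[OF assms(1) smooth_fun_coordinate[OF assms(2)]] assms(2)]
    by (simp add: o_def)
  then show ?thesis by (intro smooth_on_sum smooth_on_scaleR smooth_on_const op)
qed

text \<open>In a chart the second derivatives of \<open>f\<close> in \<open>X (Y f) - Y (X f)\<close> cancel by symmetry; what
  remains is a derivative of \<open>f\<close> in one direction.\<close>

lemma lie_bracket_tangent:
  assumes X: "X \<in> vector_fields M" and Y: "Y \<in> vector_fields M" and p: "p \<in> points M"
  shows "lie_bracket M X Y p \<in> tangent_space M p"
proof -
  obtain U \<phi> where U: "(U, \<phi>) \<in> atlas M" "p \<in> U" using obtain_chart[OF p] .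
  define comp where "comp Z x = (\<Sum>b\<in>Basis. Z (inv_into U \<phi> x) (\<lambda>q. \<phi> q \<bullet> b) *\<^sub>R b)"
    for Z :: "'m vfield" and x
  define d where "d Z Z' = \<D> (comp Z') (\<phi> p) (comp Z (\<phi> p))" for Z Z'
  have second: "Z p (\<lambda>q. Z' q f) = \<D> (f \<circ> inv_into U \<phi>) (\<phi> p) (d Z Z') +
      \<D> (\<lambda>z. \<D> (f \<circ> inv_into U \<phi>) z (comp Z (\<phi> p))) (\<phi> p) (comp Z' (\<phi> p))"
    if Z: "Z \<in> vector_fields M" and Z': "Z' \<in> vector_fields M" and W: "p \<in> W" "smooth_fun M W f" for Z Z' f W
  proof -
    let ?S = "\<phi> ` (U \<inter> W)" and ?f = "f \<circ> inv_into U \<phi>"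
    have S: "open ?S" using chart_open_image[OF U(1) smooth_fun_openin[OF W(2)]] .
    have x: "\<phi> p \<in> ?S" using U W by blast
    have sf: "smooth_on ?S ?f" using smooth_fun_chart[OF W(2) U(1)] .
    have sZ': "smooth_on ?S (comp Z')"
      unfolding comp_def by (rule smooth_on_subset[OF vector_field_components_smooth[OF Z' U(1)]]) blast
    have val: "Q q h = \<D> (h \<circ> inv_into U \<phi>) (\<phi> q) (comp Q (\<phi> q))"
      if "Q \<in> vector_fields M" "q \<in> U" "smooth_near M q h" for Q q h
    proof -
      have "Q q \<in> tangent_space M q" using vector_field_tangent chart_subset U that by blast
      from tangent_vector_coordinates[OF U(1) that(2) this]
      have "Q q h = chart_tangent M U \<phi> q (comp Q (\<phi> q)) h"
        using U that by (simp add: comp_def)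
      then show ?thesis using that(3) by (simp add: chart_tangent_def)
    qed
    have "Z p (\<lambda>q. Z' q f) = \<D> ((\<lambda>q. Z' q f) \<circ> inv_into U \<phi>) (\<phi> p) (comp Z (\<phi> p))"
      by (rule val[OF Z U(2) vector_field_smooth_near[OF Z' smooth_nearI[OF W(2,1)]]])
    also have "\<D> ((\<lambda>q. Z' q f) \<circ> inv_into U \<phi>) (\<phi> p) =
        \<D> (\<lambda>z. \<D> ?f z (comp Z' z)) (\<phi> p)"
    proof (rule frechet_derivative_cong_open[OF S x])
      fix y assume "y \<in> ?S"
      then obtain q where q: "q \<in> U" "q \<in> W" "y = \<phi> q" by blast
      show "((\<lambda>q. Z' q f) \<circ> inv_into U \<phi>) y = \<D> ?f y (comp Z' y)"
        using val[OF Z' q(1) smooth_nearI[OF W(2) q(2)]] U q by simp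
    qed
    also have "\<dots> (comp Z (\<phi> p)) = \<D> ?f (\<phi> p) (d Z Z') +
       \<D> (\<lambda>z. \<D> ?f z (comp Z (\<phi> p))) (\<phi> p) (comp Z' (\<phi> p))"
      unfolding d_def by (rule frechet_derivative_of_directional_derivative[OF S sf sZ' x])
    finally show ?thesis .
  qed
  have "lie_bracket M X Y p = chart_tangent M U \<phi> p (d X Y - d Y X)"
  proof (rule ext)
    fix f
    show "lie_bracket M X Y p f = chart_tangent M U \<phi> p (d X Y - d Y X) f"
    proof (cases "smooth_near M p f")
      case True
      then obtain W where W: "p \<in> W" "smooth_fun M W f" unfolding smooth_near_def by blast
      have S: "open (\<phi> ` (U \<inter> W))" using chart_open_image[OF U(1) smooth_fun_openin[OF W(2)]] .
      have x: "\<phi> p \<in> \<phi> ` (U \<inter> W)" using U W by blast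
      have "lie_bracket M X Y p f = X p (\<lambda>q. Y q f) - Y p (\<lambda>q. X q f)"
        using True by (simp add: lie_bracket_def)
      also have "\<dots> = \<D> (f \<circ> inv_into U \<phi>) (\<phi> p) (d X Y) -
          \<D> (f \<circ> inv_into U \<phi>) (\<phi> p) (d Y X)"
        unfolding second[OF X Y W] second[OF Y X W]
          symmetric_second_derivative[OF S smooth_fun_chart[OF W(2) U(1)] x, of "comp X (\<phi> p)"]
        by simp
      also have "\<dots> = \<D> (f \<circ> inv_into U \<phi>) (\<phi> p) (d X Y - d Y X)"
        by (rule linear_diff[symmetric, OF linear_frechet_derivative[OF smooth_near_chart_differentiable[OF U True]]])
      finally show ?thesis using True by (simp add: chart_tangent_def)
    qed (simp add: lie_bracket_def chart_tangent_def)
  qed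
  then show ?thesis using tangent_space_chart[OF U] by blast
qed

end

section \<open>Smooth maps, products and vector spaces\<close>

lemma chart_witnessI:
  assumes "(U, \<phi>) \<in> A" "p \<in> U" "open T" "\<phi> p \<in> T" "smooth_on T (f \<circ> inv_into U \<phi>)"
  shows "\<exists>U \<phi> T. (U, \<phi>) \<in> A \<and> p \<in> U \<and> open T \<and> \<phi> p \<in> T \<and> smooth_on T (f \<circ> inv_into U \<phi>)"
  using assms by blast

text \<open>For a continuous map, one pair of charts around each point suffices, as the smoothness of the
  pulled back function is a local matter.\<close>

lemma smooth_fun_pullback_charts:
  assumes M: "smooth_manifold M" and N: "smooth_manifold N"
    and cont: "continuous_map (mtop M) (mtop N) F"
    and charts: "\<And>p. p \<in> points M \<Longrightarrow> \<exists>U \<phi> V \<psi>. (U, \<phi>) \<in> atlas M \<and> p \<in> U \<and> (V, \<psi>) \<in> atlas N \<and> F p \<in> V \<and>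
        smooth_on (\<phi> ` (U \<inter> F -` V)) (\<psi> \<circ> F \<circ> inv_into U \<phi>)"
    and f: "smooth_fun N W f"
  shows "smooth_fun M {p \<in> points M. F p \<in> W} (\<lambda>p. f (F p))"
proof -
  interpret M: smooth_manifold M by (rule M)
  interpret N: smooth_manifold N by (rule N)
  have op: "openin (mtop M) {p \<in> points M. F p \<in> Z}" if "openin (mtop N) Z" for Z
    by (rule openin_continuous_map_preimage[OF cont that])
  show ?thesis
  proof (rule M.smooth_funI[OF op[OF N.smooth_fun_openin[OF f]]])
    fix p assume p: "p \<in> {p \<in> points M. F p \<in> W}"
    then obtain U \<phi> V \<psi> where U: "(U, \<phi>) \<in> atlas M" "p \<in> U" and V: "(V, \<psi>) \<in> atlas N" "F p \<in> V"
      and sF: "smooth_on (\<phi> ` (U \<inter> F -` V)) (\<psi> \<circ> F \<circ> inv_into U \<phi>)"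
      using charts[of p] by auto
    define S where "S = \<phi> ` (U \<inter> {p \<in> points M. F p \<in> V \<inter> W})"
    have opVW: "openin (mtop N) (V \<inter> W)"
      using N.chart_domain[OF V(1)] N.smooth_fun_openin[OF f] by blast
    have S: "open S" unfolding S_def by (rule M.chart_open_image[OF U(1) op[OF opVW]])
    have T: "open (\<psi> ` (V \<inter> W))" by (rule N.chart_open_image[OF V(1) N.smooth_fun_openin[OF f]])
    have s: "smooth_on S (\<psi> \<circ> F \<circ> inv_into U \<phi>)"
      by (rule smooth_on_subset[OF sF]) (auto simp: S_def)
    have "smooth_on S (\<lambda>x. (f \<circ> inv_into V \<psi>) ((\<psi> \<circ> F \<circ> inv_into U \<phi>) x))"
      by (rule smooth_on_compose[OF S T _ s N.smooth_fun_chart[OF f V(1)]])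
         (use U(1) in \<open>auto simp: S_def\<close>)
    then have sm: "smooth_on S ((\<lambda>p. f (F p)) \<circ> inv_into U \<phi>)"
      by (rule smooth_on_eqI[OF _ S]) (use U(1) V(1) in \<open>auto simp: S_def\<close>)
    have "\<phi> p \<in> S" using p U V unfolding S_def by blast
    from chart_witnessI[OF U S this sm]
    show "\<exists>U \<phi> T. (U, \<phi>) \<in> atlas M \<and> p \<in> U \<and> open T \<and> \<phi> p \<in> T \<and>
        smooth_on T ((\<lambda>p. f (F p)) \<circ> inv_into U \<phi>)" .
  qed
qed

text \<open>Smooth maps are exactly the maps that pull smooth functions back to smooth functions. In this
  form they compose without any mention of charts.\<close>

lemma smooth_fun_pullback:
  assumes M: "smooth_manifold M" and N: "smooth_manifold N"
    and F: "smooth_map M N F" and f: "smooth_fun N W f"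
  shows "smooth_fun M {p \<in> points M. F p \<in> W} (\<lambda>p. f (F p))"
proof (rule smooth_fun_pullback_charts[OF M N _ _ f])
  show cont: "continuous_map (mtop M) (mtop N) F" using F unfolding smooth_map_def by blast
  fix p assume p: "p \<in> points M"
  obtain U \<phi> where U: "(U, \<phi>) \<in> atlas M" "p \<in> U" using smooth_manifold.obtain_chart[OF M p] .
  have "F p \<in> points N" using cont p unfolding continuous_map_def by blast
  then obtain V \<psi> where V: "(V, \<psi>) \<in> atlas N" "F p \<in> V" using smooth_manifold.obtain_chart[OF N] by blast
  have "smooth_on (\<phi> ` (U \<inter> F -` V)) (\<psi> \<circ> F \<circ> inv_into U \<phi>)"
    using F U(1) V(1) unfolding smooth_map_def by blast
  with U V show "\<exists>U \<phi> V \<psi>. (U, \<phi>) \<in> atlas M \<and> p \<in> U \<and> (V, \<psi>) \<in> atlas N \<and> F p \<in> V \<and>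
      smooth_on (\<phi> ` (U \<inter> F -` V)) (\<psi> \<circ> F \<circ> inv_into U \<phi>)"
    by (intro exI[of _ U] exI[of _ \<phi>] exI[of _ V] exI[of _ \<psi>]) simp
qed

lemma smooth_mapI:
  fixes M :: "('m, 'e::euclidean_space) manifold" and N :: "('n, 'f::euclidean_space) manifold"
  assumes M: "smooth_manifold M" and N: "smooth_manifold N"
    and maps: "\<And>p. p \<in> points M \<Longrightarrow> F p \<in> points N"
    and pull: "\<And>W f. smooth_fun N W f \<Longrightarrow> smooth_fun M {p \<in> points M. F p \<in> W} (\<lambda>p. f (F p))"
  shows "smooth_map M N F"
proof -
  interpret M: smooth_manifold M by (rule M)
  interpret N: smooth_manifold N by (rule N)
  have "continuous_map (mtop M) (mtop N) F"
    unfolding continuous_map_def using maps M.smooth_fun_openin[OF pull[OF N.smooth_fun_const]] by blast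
  moreover have "smooth_on (\<phi> ` (U \<inter> F -` V)) (\<psi> \<circ> F \<circ> inv_into U \<phi>)"
    if U: "(U, \<phi>) \<in> atlas M" and V: "(V, \<psi>) \<in> atlas N" for U \<phi> V \<psi>
  proof -
    have eq: "U \<inter> {p \<in> points M. F p \<in> V} = U \<inter> F -` V" using M.chart_subset[OF U] by blast
    have sm: "smooth_fun M {p \<in> points M. F p \<in> V} (\<lambda>p. \<psi> (F p) \<bullet> b)" for b
      by (rule pull[OF N.smooth_fun_coordinate[OF V]])
    have op: "open (\<phi> ` (U \<inter> F -` V))"
      using M.chart_open_image[OF U M.smooth_fun_openin[OF sm]] unfolding eq .
    show ?thesis
    proof (rule smooth_on_components[OF op])
      fix b :: 'f
      show "smooth_on (\<phi> ` (U \<inter> F -` V)) (\<lambda>x. (\<psi> \<circ> F \<circ> inv_into U \<phi>) x \<bullet> b)"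
        using M.smooth_fun_chart[OF sm[of b] U] unfolding eq by (simp add: o_def)
    qed
  qed
  ultimately show ?thesis unfolding smooth_map_def by blast
qed

lemma smooth_map_points: "smooth_map M N F \<Longrightarrow> p \<in> points M \<Longrightarrow> F p \<in> points N"
  unfolding smooth_map_def continuous_map_def by blast

lemma smooth_map_chartI:
  assumes "smooth_manifold M" "smooth_manifold N" "continuous_map (mtop M) (mtop N) F"
    and "\<And>p. p \<in> points M \<Longrightarrow> \<exists>U \<phi> V \<psi>. (U, \<phi>) \<in> atlas M \<and> p \<in> U \<and> (V, \<psi>) \<in> atlas N \<and> F p \<in> V \<and>
        smooth_on (\<phi> ` (U \<inter> F -` V)) (\<psi> \<circ> F \<circ> inv_into U \<phi>)"
  shows "smooth_map M N F"
proof (rule smooth_mapI[OF assms(1,2)])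
  show "F p \<in> points N" if "p \<in> points M" for p
    using assms(3) that unfolding continuous_map_def by blast
qed (rule smooth_fun_pullback_charts[OF assms])

lemma smooth_map_compose:
  assumes L: "smooth_manifold L" and M: "smooth_manifold M" and N: "smooth_manifold N"
    and F: "smooth_map L M F" and G: "smooth_map M N G"
  shows "smooth_map L N (\<lambda>p. G (F p))"
proof (rule smooth_mapI[OF L N])
  fix W f assume f: "smooth_fun N W f"
  have "{p \<in> points L. F p \<in> {q \<in> points M. G q \<in> W}} = {p \<in> points L. G (F p) \<in> W}"
    using smooth_map_points[OF F] by blast
  with smooth_fun_pullback[OF L M F smooth_fun_pullback[OF M N G f]]
  show "smooth_fun L {p \<in> points L. G (F p) \<in> W} (\<lambda>p. f (G (F p)))" by simp
qed (rule smooth_map_points[OF G smooth_map_points[OF F]])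

lemma smooth_near_pullback:
  assumes M: "smooth_manifold M" and N: "smooth_manifold N"
    and F: "smooth_map M N F" and p: "p \<in> points M" and f: "smooth_near N (F p) f"
  shows "smooth_near M p (\<lambda>q. f (F q))"
proof -
  obtain W where "F p \<in> W" "smooth_fun N W f" using f unfolding smooth_near_def by blast
  then show ?thesis
    using smooth_manifold.smooth_nearI[OF M smooth_fun_pullback[OF M N F]] p by blast
qed

lemma inv_into_map_prod:
  assumes "inj_on f A" "inj_on g B" "x \<in> f ` A" "y \<in> g ` B"
  shows "inv_into (A \<times> B) (map_prod f g) (x, y) = (inv_into A f x, inv_into B g y)"
proof -
  obtain a b where ab: "a \<in> A" "b \<in> B" "x = f a" "y = g b" using assms by blast
  have "inj_on (map_prod f g) (A \<times> B)" using assms by (rule_tac map_prod_inj_on) auto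
  then have "inv_into (A \<times> B) (map_prod f g) (map_prod f g (a, b)) = (a, b)"
    using ab by (intro inv_into_f_f) auto
  then show ?thesis using ab assms by (simp add: inv_into_f_f)
qed

lemma second_countable_prod_topology:
  assumes "second_countable X" "second_countable Y"
  shows "second_countable (prod_topology X Y)"
proof -
  obtain A where A: "countable A" "\<forall>V\<in>A. openin X V"
    "\<forall>U x. openin X U \<and> x \<in> U \<longrightarrow> (\<exists>V\<in>A. x \<in> V \<and> V \<subseteq> U)"
    using assms(1) unfolding second_countable_def by (elim exE conjE)
  obtain B where B: "countable B" "\<forall>V\<in>B. openin Y V"
    "\<forall>U x. openin Y U \<and> x \<in> U \<longrightarrow> (\<exists>V\<in>B. x \<in> V \<and> V \<subseteq> U)"
    using assms(2) unfolding second_countable_def by (elim exE conjE)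
  let ?C = "(\<lambda>(V, W). V \<times> W) ` (A \<times> B)"
  show ?thesis unfolding second_countable_def
  proof (intro exI[of _ ?C] conjI allI impI ballI)
    show "countable ?C" using A B by blast
    show "openin (prod_topology X Y) V" if "V \<in> ?C" for V
      using that A B by (auto simp: openin_prod_Times_iff)
    show "\<exists>V\<in>?C. z \<in> V \<and> V \<subseteq> U" if U: "openin (prod_topology X Y) U \<and> z \<in> U" for U z
    proof -
      obtain x y where z: "z = (x, y)" by fastforce
      obtain V W where VW: "openin X V" "openin Y W" "x \<in> V" "y \<in> W" "V \<times> W \<subseteq> U"
        using U unfolding z openin_prod_topology_alt by blast
      obtain V' where V': "V' \<in> A" "x \<in> V'" "V' \<subseteq> V" using A(3) VW(1,3) by blast
      obtain W' where W': "W' \<in> B" "y \<in> W'" "W' \<subseteq> W" using B(3) VW(2,4) by blast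
      show ?thesis
        by (rule bexI[of _ "V' \<times> W'"]) (use V' W' VW z in auto)
    qed
  qed
qed

lemma homeomorphic_map_map_prod:
  assumes "homeomorphic_map X X' f" "homeomorphic_map Y Y' g"
  shows "homeomorphic_map (prod_topology X Y) (prod_topology X' Y') (map_prod f g)"
proof -
  obtain f' g' where "homeomorphic_maps X X' f f'" "homeomorphic_maps Y Y' g g'"
    using assms unfolding homeomorphic_map_maps by blast
  then have "homeomorphic_maps (prod_topology X Y) (prod_topology X' Y')
      (\<lambda>(x, y). (f x, g y)) (\<lambda>(x, y). (f' x, g' y))"
    unfolding homeomorphic_maps_prod by blast
  moreover have "(\<lambda>(x, y). (f x, g y)) = map_prod f g" by auto
  ultimately show ?thesis unfolding homeomorphic_map_maps by metis
qed

lemma points_product_manifold [simp]: "points (product_manifold M N) = points M \<times> points N"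
  by (simp add: product_manifold_def)

lemma atlas_product_manifoldI:
  "(U, \<phi>) \<in> atlas M \<Longrightarrow> (V, \<psi>) \<in> atlas N \<Longrightarrow> (U \<times> V, map_prod \<phi> \<psi>) \<in> atlas (product_manifold M N)"
  unfolding product_manifold_def by auto

lemma atlas_product_manifoldE:
  assumes "(D, \<theta>) \<in> atlas (product_manifold M N)"
  obtains U \<phi> V \<psi> where "(U, \<phi>) \<in> atlas M" "(V, \<psi>) \<in> atlas N" "D = U \<times> V" "\<theta> = map_prod \<phi> \<psi>"
  using assms unfolding product_manifold_def by auto

lemma smooth_manifold_product:
  assumes M: "smooth_manifold M" and N: "smooth_manifold N"
  shows "smooth_manifold (product_manifold M N)"
proof -
  interpret M: smooth_manifold M by (rule M)
  interpret N: smooth_manifold N by (rule N)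
  have top: "mtop (product_manifold M N) = prod_topology (mtop M) (mtop N)"
    by (simp add: product_manifold_def)
  show ?thesis
  proof
    show "Hausdorff_space (mtop (product_manifold M N))"
      using M.Hausdorff N.Hausdorff by (simp add: top Hausdorff_space_prod_topology)
    show "second_countable (mtop (product_manifold M N))"
      using M.second_countable N.second_countable by (simp add: top second_countable_prod_topology)
    show "(\<Union>(U, \<phi>)\<in>atlas (product_manifold M N). U) = points (product_manifold M N)"
    proof
      show "(\<Union>(U, \<phi>)\<in>atlas (product_manifold M N). U) \<subseteq> points (product_manifold M N)"
        using M.chart_subset N.chart_subset by (fastforce elim!: atlas_product_manifoldE)
      show "points (product_manifold M N) \<subseteq> (\<Union>(U, \<phi>)\<in>atlas (product_manifold M N). U)"
      proof
        fix z assume "z \<in> points (product_manifold M N)"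
        then obtain p q where z: "z = (p, q)" "p \<in> points M" "q \<in> points N" by auto
        obtain U \<phi> where U: "(U, \<phi>) \<in> atlas M" "p \<in> U" using M.obtain_chart z by blast
        obtain V \<psi> where V: "(V, \<psi>) \<in> atlas N" "q \<in> V" using N.obtain_chart z by blast
        show "z \<in> (\<Union>(U, \<phi>)\<in>atlas (product_manifold M N). U)"
          using atlas_product_manifoldI[OF U(1) V(1)] z U V by blast
      qed
    qed
  next
    fix D \<theta> assume "(D, \<theta>) \<in> atlas (product_manifold M N)"
    then obtain U \<phi> V \<psi> where U: "(U, \<phi>) \<in> atlas M" and V: "(V, \<psi>) \<in> atlas N"
      and D: "D = U \<times> V" "\<theta> = map_prod \<phi> \<psi>" by (rule atlas_product_manifoldE)
    have im: "\<theta> ` D = \<phi> ` U \<times> \<psi> ` V" unfolding D by force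
    show "openin (mtop (product_manifold M N)) D"
      using M.chart_domain[OF U] N.chart_domain[OF V] by (simp add: top D openin_prod_Times_iff)
    show "open (\<theta> ` D)"
      using M.chart_image[OF U] N.chart_image[OF V] by (simp add: im open_Times)
    show "homeomorphic_map (subtopology (mtop (product_manifold M N)) D) (top_of_set (\<theta> ` D)) \<theta>"
      using homeomorphic_map_map_prod[OF M.chart_homeo[OF U] N.chart_homeo[OF V]]
      unfolding im unfolding top D by (simp add: subtopology_Times)
  next
    fix D \<theta> D' \<theta>'
    assume "(D, \<theta>) \<in> atlas (product_manifold M N)"
    then obtain U \<phi> V \<psi> where U: "(U, \<phi>) \<in> atlas M" and V: "(V, \<psi>) \<in> atlas N"
      and D: "D = U \<times> V" "\<theta> = map_prod \<phi> \<psi>" by (rule atlas_product_manifoldE)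
    assume "(D', \<theta>') \<in> atlas (product_manifold M N)"
    then obtain U' \<phi>' V' \<psi>' where U': "(U', \<phi>') \<in> atlas M" and V': "(V', \<psi>') \<in> atlas N"
      and D': "D' = U' \<times> V'" "\<theta>' = map_prod \<phi>' \<psi>'" by (rule atlas_product_manifoldE)
    let ?A = "\<phi> ` (U \<inter> U')" and ?B = "\<psi> ` (V \<inter> V')"
    have im: "\<theta> ` (D \<inter> D') = ?A \<times> ?B" unfolding D D' by force
    have op: "open ?A" "open ?B"
      using M.chart_open_image[OF U M.chart_domain[OF U']] N.chart_open_image[OF V N.chart_domain[OF V']] by auto
    have opAB: "open (?A \<times> ?B)" using op by (rule open_Times)
    have "smooth_on (?A \<times> ?B) (\<lambda>z. ((\<phi>' \<circ> inv_into U \<phi>) (fst z), (\<psi>' \<circ> inv_into V \<psi>) (snd z)))"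
    proof (rule smooth_on_Pair[OF opAB])
      show "smooth_on (?A \<times> ?B) (\<lambda>z. (\<phi>' \<circ> inv_into U \<phi>) (fst z))"
        by (rule smooth_on_compose[OF opAB op(1) _ smooth_on_bounded_linear[OF bounded_linear_fst]
              M.charts_compatible[OF U U']]) force
      show "smooth_on (?A \<times> ?B) (\<lambda>z. (\<psi>' \<circ> inv_into V \<psi>) (snd z))"
        by (rule smooth_on_compose[OF opAB op(2) _ smooth_on_bounded_linear[OF bounded_linear_snd]
              N.charts_compatible[OF V V']]) force
    qed
    then show "smooth_on (\<theta> ` (D \<inter> D')) (\<theta>' \<circ> inv_into D \<theta>)"
      unfolding im
    proof (rule smooth_on_eqI[OF _ opAB])
      fix z assume "z \<in> ?A \<times> ?B"
      then have z: "fst z \<in> \<phi> ` U" "snd z \<in> \<psi> ` V" by auto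
      show "(\<theta>' \<circ> inv_into D \<theta>) z = ((\<phi>' \<circ> inv_into U \<phi>) (fst z), (\<psi>' \<circ> inv_into V \<psi>) (snd z))"
        using inv_into_map_prod[OF M.chart_inj_on[OF U] N.chart_inj_on[OF V] z] by (simp add: D D')
    qed
  qed
qed

lemma smooth_map_fst:
  assumes M: "smooth_manifold M" and N: "smooth_manifold N"
  shows "smooth_map (product_manifold M N) M fst"
proof (rule smooth_map_chartI[OF smooth_manifold_product[OF M N] M])
  show "continuous_map (mtop (product_manifold M N)) (mtop M) fst"
    by (simp add: product_manifold_def continuous_map_fst)
  fix z assume "z \<in> points (product_manifold M N)"
  then obtain p q where z: "z = (p, q)" "p \<in> points M" "q \<in> points N" by auto
  obtain U \<phi> where U: "(U, \<phi>) \<in> atlas M" "p \<in> U" using smooth_manifold.obtain_chart[OF M z(2)] .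
  obtain V \<psi> where V: "(V, \<psi>) \<in> atlas N" "q \<in> V" using smooth_manifold.obtain_chart[OF N z(3)] .
  have T: "open (\<phi> ` U \<times> \<psi> ` V)"
    using smooth_manifold.chart_image[OF M U(1)] smooth_manifold.chart_image[OF N V(1)] by (rule open_Times)
  have "smooth_on (\<phi> ` U \<times> \<psi> ` V) (\<phi> \<circ> fst \<circ> inv_into (U \<times> V) (map_prod \<phi> \<psi>))"
  proof (rule smooth_on_eqI[OF smooth_on_bounded_linear[OF bounded_linear_fst] T])
    fix x assume "x \<in> \<phi> ` U \<times> \<psi> ` V"
    then have x: "fst x \<in> \<phi> ` U" "snd x \<in> \<psi> ` V" by auto
    show "(\<phi> \<circ> fst \<circ> inv_into (U \<times> V) (map_prod \<phi> \<psi>)) x = fst x"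
      using inv_into_map_prod[OF smooth_manifold.chart_inj_on[OF M U(1)] smooth_manifold.chart_inj_on[OF N V(1)] x]
        f_inv_into_f[OF x(1)] by simp
  qed
  moreover have "map_prod \<phi> \<psi> ` (U \<times> V \<inter> fst -` U) = \<phi> ` U \<times> \<psi> ` V" by force
  ultimately show "\<exists>D \<theta> W \<psi>. (D, \<theta>) \<in> atlas (product_manifold M N) \<and> z \<in> D \<and> (W, \<psi>) \<in> atlas M \<and>
      fst z \<in> W \<and> smooth_on (\<theta> ` (D \<inter> fst -` W)) (\<psi> \<circ> fst \<circ> inv_into D \<theta>)"
    using atlas_product_manifoldI[OF U(1) V(1)] U V z
    by (intro exI[of _ "U \<times> V"] exI[of _ "map_prod \<phi> \<psi>"] exI[of _ U] exI[of _ "\<phi>"]) simp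
qed

lemma smooth_map_snd:
  assumes M: "smooth_manifold M" and N: "smooth_manifold N"
  shows "smooth_map (product_manifold M N) N snd"
proof (rule smooth_map_chartI[OF smooth_manifold_product[OF M N] N])
  show "continuous_map (mtop (product_manifold M N)) (mtop N) snd"
    by (simp add: product_manifold_def continuous_map_snd)
  fix z assume "z \<in> points (product_manifold M N)"
  then obtain p q where z: "z = (p, q)" "p \<in> points M" "q \<in> points N" by auto
  obtain U \<phi> where U: "(U, \<phi>) \<in> atlas M" "p \<in> U" using smooth_manifold.obtain_chart[OF M z(2)] .
  obtain V \<psi> where V: "(V, \<psi>) \<in> atlas N" "q \<in> V" using smooth_manifold.obtain_chart[OF N z(3)] .
  have T: "open (\<phi> ` U \<times> \<psi> ` V)"
    using smooth_manifold.chart_image[OF M U(1)] smooth_manifold.chart_image[OF N V(1)] by (rule open_Times)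
  have "smooth_on (\<phi> ` U \<times> \<psi> ` V) (\<psi> \<circ> snd \<circ> inv_into (U \<times> V) (map_prod \<phi> \<psi>))"
  proof (rule smooth_on_eqI[OF smooth_on_bounded_linear[OF bounded_linear_snd] T])
    fix x assume "x \<in> \<phi> ` U \<times> \<psi> ` V"
    then have x: "fst x \<in> \<phi> ` U" "snd x \<in> \<psi> ` V" by auto
    show "(\<psi> \<circ> snd \<circ> inv_into (U \<times> V) (map_prod \<phi> \<psi>)) x = snd x"
      using inv_into_map_prod[OF smooth_manifold.chart_inj_on[OF M U(1)] smooth_manifold.chart_inj_on[OF N V(1)] x]
        f_inv_into_f[OF x(2)] by simp
  qed
  moreover have "map_prod \<phi> \<psi> ` (U \<times> V \<inter> snd -` V) = \<phi> ` U \<times> \<psi> ` V" by force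
  ultimately show "\<exists>D \<theta> W \<psi>. (D, \<theta>) \<in> atlas (product_manifold M N) \<and> z \<in> D \<and> (W, \<psi>) \<in> atlas N \<and>
      snd z \<in> W \<and> smooth_on (\<theta> ` (D \<inter> snd -` W)) (\<psi> \<circ> snd \<circ> inv_into D \<theta>)"
    using atlas_product_manifoldI[OF U(1) V(1)] U V z
    by (intro exI[of _ "U \<times> V"] exI[of _ "map_prod \<phi> \<psi>"] exI[of _ V] exI[of _ "\<psi>"]) simp
qed

lemma smooth_map_Pair:
  assumes L: "smooth_manifold L" and M: "smooth_manifold M" and N: "smooth_manifold N"
    and F: "smooth_map L M F" and G: "smooth_map L N G"
  shows "smooth_map L (product_manifold M N) (\<lambda>p. (F p, G p))"
proof (rule smooth_map_chartI[OF L smooth_manifold_product[OF M N]])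
  show cont: "continuous_map (mtop L) (mtop (product_manifold M N)) (\<lambda>p. (F p, G p))"
    using F G unfolding smooth_map_def product_manifold_def by (simp add: continuous_map_pairedI)
  fix p assume p: "p \<in> points L"
  obtain D \<theta> where D: "(D, \<theta>) \<in> atlas L" "p \<in> D" using smooth_manifold.obtain_chart[OF L p] .
  obtain U \<phi> where U: "(U, \<phi>) \<in> atlas M" "F p \<in> U"
    using smooth_manifold.obtain_chart[OF M smooth_map_points[OF F p]] .
  obtain V \<psi> where V: "(V, \<psi>) \<in> atlas N" "G p \<in> V"
    using smooth_manifold.obtain_chart[OF N smooth_map_points[OF G p]] .
  have A: "(U \<times> V, map_prod \<phi> \<psi>) \<in> atlas (product_manifold M N)"
    by (rule atlas_product_manifoldI[OF U(1) V(1)])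
  let ?S = "\<theta> ` (D \<inter> (\<lambda>p. (F p, G p)) -` (U \<times> V))"
  have "?S = \<theta> ` (D \<inter> {p \<in> points L. (F p, G p) \<in> U \<times> V})"
    using smooth_manifold.chart_subset[OF L D(1)] by blast
  then have S: "open ?S"
    using smooth_manifold.chart_open_image[OF L D(1) openin_continuous_map_preimage[OF cont
          smooth_manifold.chart_domain[OF smooth_manifold_product[OF M N] A]]] by simp
  have "smooth_on (\<theta> ` (D \<inter> F -` U)) (\<phi> \<circ> F \<circ> inv_into D \<theta>)"
    using F D(1) U(1) unfolding smooth_map_def by blast
  then have s1: "smooth_on ?S (\<phi> \<circ> F \<circ> inv_into D \<theta>)" by (rule smooth_on_subset) auto
  have "smooth_on (\<theta> ` (D \<inter> G -` V)) (\<psi> \<circ> G \<circ> inv_into D \<theta>)"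
    using G D(1) V(1) unfolding smooth_map_def by blast
  then have s2: "smooth_on ?S (\<psi> \<circ> G \<circ> inv_into D \<theta>)" by (rule smooth_on_subset) auto
  have "smooth_on ?S (map_prod \<phi> \<psi> \<circ> (\<lambda>p. (F p, G p)) \<circ> inv_into D \<theta>)"
    using smooth_on_Pair[OF S s1 s2] by (simp add: o_def)
  with A D U V
  show "\<exists>D \<theta> W \<psi>. (D, \<theta>) \<in> atlas L \<and> p \<in> D \<and> (W, \<psi>) \<in> atlas (product_manifold M N) \<and> (F p, G p) \<in> W \<and>
      smooth_on (\<theta> ` (D \<inter> (\<lambda>p. (F p, G p)) -` W)) (\<psi> \<circ> (\<lambda>p. (F p, G p)) \<circ> inv_into D \<theta>)"
    by (intro exI[of _ D] exI[of _ \<theta>] exI[of _ "U \<times> V"] exI[of _ "map_prod \<phi> \<psi>"]) simp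
qed

lemma smooth_map_const:
  assumes M: "smooth_manifold M" and N: "smooth_manifold N" and "c \<in> points N"
  shows "smooth_map M N (\<lambda>p. c)"
proof (rule smooth_mapI[OF M N])
  fix W f
  show "smooth_fun M {p \<in> points M. c \<in> W} (\<lambda>p. f c)"
    by (rule smooth_manifold.smooth_fun_const[OF M]) (cases "c \<in> W"; simp)
qed (rule assms(3))

lemma smooth_map_ident:
  assumes M: "smooth_manifold M"
  shows "smooth_map M M (\<lambda>p. p)"
proof (rule smooth_mapI[OF M M])
  fix W f assume f: "smooth_fun M W f"
  then have "{p \<in> points M. p \<in> W} = W"
    using smooth_manifold.smooth_fun_subset_points[OF M f] by blast
  with f show "smooth_fun M {p \<in> points M. p \<in> W} (\<lambda>p. f p)" by simp
qed

text \<open>This provides the continuity of maps into a vector space.\<close>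

lemma (in smooth_manifold) openin_preimage_components:
  fixes h :: "'m \<Rightarrow> 'f::euclidean_space"
  assumes h: "\<And>b. b \<in> Basis \<Longrightarrow> smooth_fun M W (\<lambda>p. h p \<bullet> b)" and T: "open T"
  shows "openin (mtop M) {p \<in> W. h p \<in> T}"
proof (subst openin_subopen, intro ballI)
  fix p assume p: "p \<in> {p \<in> W. h p \<in> T}"
  obtain b :: 'f where "b \<in> Basis" using nonempty_Basis by blast
  then have W: "openin (mtop M) W" using smooth_fun_openin[OF h] by blast
  then obtain U \<phi> where U: "(U, \<phi>) \<in> atlas M" "p \<in> U"
    using obtain_chart p openin_subset by blast
  let ?S = "\<phi> ` (U \<inter> W)"
  have S: "open ?S" by (rule chart_open_image[OF U(1) W])
  have "smooth_on ?S (h \<circ> inv_into U \<phi>)"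
    by (rule smooth_on_components[OF S]) (use smooth_fun_chart[OF h U(1)] in \<open>simp add: o_def\<close>)
  then have "open (?S \<inter> (h \<circ> inv_into U \<phi>) -` T)"
    using S T continuous_open_preimage smooth_on_imp_continuous_on by metis
  from chart_open_preimage[OF U(1) this]
  have "openin (mtop M) {q \<in> U. \<phi> q \<in> ?S \<inter> (h \<circ> inv_into U \<phi>) -` T}" .
  moreover have "p \<in> {q \<in> U. \<phi> q \<in> ?S \<inter> (h \<circ> inv_into U \<phi>) -` T}" using p U by auto
  moreover have "{q \<in> U. \<phi> q \<in> ?S \<inter> (h \<circ> inv_into U \<phi>) -` T} \<subseteq> {p \<in> W. h p \<in> T}"
  proof
    fix q assume q: "q \<in> {q \<in> U. \<phi> q \<in> ?S \<inter> (h \<circ> inv_into U \<phi>) -` T}"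
    then obtain q' where "q' \<in> U \<inter> W" "\<phi> q = \<phi> q'" by blast
    then have "q = q'" using inj_onD[OF chart_inj_on[OF U(1)]] q by blast
    moreover have "h (inv_into U \<phi> (\<phi> q)) \<in> T" "q \<in> U" using q by simp_all
    ultimately show "q \<in> {p \<in> W. h p \<in> T}" using \<open>q' \<in> U \<inter> W\<close> chart_inverse[OF U(1), of q] by simp
  qed
  ultimately show "\<exists>T'. openin (mtop M) T' \<and> p \<in> T' \<and> T' \<subseteq> {p \<in> W. h p \<in> T}" by blast
qed

text \<open>The canonical manifold of a vector space has all linear isomorphisms to the model space as charts.
  One of them, \<open>\<phi>\<close>, is singled out to compute with.\<close>

locale finite_dim_subspace =
  fixes V :: "'v::real_vector set" and \<phi> :: "'v \<Rightarrow> 'e::euclidean_space"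
  assumes subspace: "subspace V" and iso: "\<phi> \<in> lin_isos V"
begin

abbreviation "VM \<equiv> vector_space_manifold V :: ('v, 'e) manifold"

lemma lin_iso_inverse:
  assumes "\<psi> \<in> lin_isos V"
  shows "inv_into V \<psi> x \<in> V" "\<psi> (inv_into V \<psi> x) = x" "v \<in> V \<Longrightarrow> inv_into V \<psi> (\<psi> v) = v"
  using assms unfolding lin_isos_def bij_betw_def
  by (auto intro: inv_into_into f_inv_into_f inv_into_f_f)

lemma linear_lin_iso_inverse:
  fixes \<psi> :: "'v \<Rightarrow> 'f::euclidean_space"
  assumes "\<psi> \<in> lin_isos V" "lin_on V l"
  shows "linear (\<lambda>x. l (inv_into V \<psi> x))"
proof -
  have inj: "inj_on \<psi> V" and lin: "lin_on V \<psi>"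
    using assms unfolding lin_isos_def bij_betw_def by auto
  let ?i = "inv_into V \<psi>"
  have i: "?i x \<in> V" "\<psi> (?i x) = x" for x
    using assms(1) unfolding lin_isos_def bij_betw_def by (auto intro: inv_into_into f_inv_into_f)
  have "?i (x + y) = ?i x + ?i y" for x y
    using lin i subspace_add[OF subspace i(1) i(1)] unfolding lin_on_def
    by (intro inj_onD[OF inj]) auto
  moreover have "?i (c *\<^sub>R x) = c *\<^sub>R ?i x" for c x
    using lin i subspace_scale[OF subspace i(1)] unfolding lin_on_def
    by (intro inj_onD[OF inj]) auto
  ultimately show ?thesis
    using assms(2) i(1) unfolding lin_on_def by (intro linearI) auto
qed

lemma openin_VM_all:
  "openin (mtop VM) W \<longleftrightarrow> W \<subseteq> V \<and> (\<forall>\<psi>\<in>(lin_isos V :: ('v \<Rightarrow> 'e) set). open (\<psi> ` W))"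
proof -
  have "istopology (\<lambda>W. W \<subseteq> V \<and> (\<forall>\<psi>\<in>(lin_isos V :: ('v \<Rightarrow> 'e) set). open (\<psi> ` W)))"
    unfolding istopology_def
  proof (intro conjI allI impI ballI)
    fix S T and \<psi> :: "'v \<Rightarrow> 'e"
    assume S: "S \<subseteq> V \<and> (\<forall>\<psi>\<in>(lin_isos V :: ('v \<Rightarrow> 'e) set). open (\<psi> ` S))"
      and T: "T \<subseteq> V \<and> (\<forall>\<psi>\<in>(lin_isos V :: ('v \<Rightarrow> 'e) set). open (\<psi> ` T))" and \<psi>: "\<psi> \<in> lin_isos V"
    have "inj_on \<psi> V" using \<psi> unfolding lin_isos_def bij_betw_def by auto
    then have "\<psi> ` (S \<inter> T) = \<psi> ` S \<inter> \<psi> ` T" using S T by (intro inj_on_image_Int[of \<psi> V]) auto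
    then show "open (\<psi> ` (S \<inter> T))" using S T \<psi> by auto
  next
    fix K and \<psi> :: "'v \<Rightarrow> 'e"
    assume "\<forall>S\<in>K. S \<subseteq> V \<and> (\<forall>\<psi>\<in>(lin_isos V :: ('v \<Rightarrow> 'e) set). open (\<psi> ` S))" "\<psi> \<in> lin_isos V"
    then show "open (\<psi> ` \<Union> K)" by (auto simp: image_Union)
  qed auto
  then show ?thesis unfolding vector_space_manifold_def by (simp add: topology_inverse')
qed

text \<open>Two linear isomorphisms differ by a linear homeomorphism of the model space.\<close>

lemma openin_VM:
  assumes "\<psi> \<in> (lin_isos V :: ('v \<Rightarrow> 'e) set)"
  shows "openin (mtop VM) W \<longleftrightarrow> W \<subseteq> V \<and> open (\<psi> ` W)"
proof -
  have "open (\<theta> ` W)" if W: "W \<subseteq> V" "open (\<psi> ` W)" and \<theta>: "\<theta> \<in> (lin_isos V :: ('v \<Rightarrow> 'e) set)" for \<theta>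
  proof -
    have "lin_on V \<psi>" using assms unfolding lin_isos_def by blast
    from linear_lin_iso_inverse[OF \<theta> this] have lin: "linear (\<lambda>x. \<psi> (inv_into V \<theta> x))" .
    have "\<theta> ` W = (\<lambda>x. \<psi> (inv_into V \<theta> x)) -` (\<psi> ` W)"
    proof (intro equalityI subsetI)
      fix x assume "x \<in> \<theta> ` W"
      then obtain v where v: "v \<in> W" "x = \<theta> v" by blast
      then have "inv_into V \<theta> x = v" using lin_iso_inverse(3)[OF \<theta>, of v] W by auto
      then show "x \<in> (\<lambda>x. \<psi> (inv_into V \<theta> x)) -` (\<psi> ` W)" using v by simp
    next
      fix x assume "x \<in> (\<lambda>x. \<psi> (inv_into V \<theta> x)) -` (\<psi> ` W)"
      then obtain v where v: "v \<in> W" "\<psi> (inv_into V \<theta> x) = \<psi> v" by auto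
      then have "inv_into V \<psi> (\<psi> (inv_into V \<theta> x)) = inv_into V \<psi> (\<psi> v)" by simp
      then have "inv_into V \<theta> x = v"
        using v(1) W lin_iso_inverse(3)[OF assms] lin_iso_inverse(1)[OF \<theta>] by (metis subsetD)
      then show "x \<in> \<theta> ` W" using lin_iso_inverse(2)[OF \<theta>] v(1) by (metis imageI)
    qed
    then show ?thesis
      using W(2) linear_continuous_on[of _ UNIV] lin by (metis open_vimage linear_linear)
  qed
  then show ?thesis unfolding openin_VM_all using assms by blast
qed

lemma points_VM [simp]: "points VM = V"
proof
  show "points VM \<subseteq> V" using openin_VM_all openin_topspace by blast
  have "open (\<phi> ` V)" using iso unfolding lin_isos_def bij_betw_def by simp
  then show "V \<subseteq> points VM" using openin_VM[OF iso, of V] openin_subset by blast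
qed

lemma homeomorphic_VM:
  assumes "\<psi> \<in> (lin_isos V :: ('v \<Rightarrow> 'e) set)"
  shows "homeomorphic_map (mtop VM) euclidean \<psi>"
proof -
  have bij: "inj_on \<psi> V" "\<psi> ` V = UNIV" using assms unfolding lin_isos_def bij_betw_def by auto
  have "{x \<in> V. \<psi> x \<in> S} \<subseteq> V \<and> \<psi> ` {x \<in> V. \<psi> x \<in> S} = S" for S
    using bij(2) by (auto simp: set_eq_iff image_iff) (metis UNIV_I image_iff)
  then have "continuous_map (mtop VM) euclidean \<psi>"
    unfolding continuous_map_def by (simp add: openin_VM[OF assms])
  moreover have "open_map (mtop VM) euclidean \<psi>"
    unfolding open_map_def by (simp add: openin_VM[OF assms])
  ultimately show ?thesis
    using bij by (intro bijective_open_imp_homeomorphic_map) auto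
qed

lemma smooth_manifold_VM: "smooth_manifold VM"
proof
  have hs: "mtop VM homeomorphic_space (euclidean :: 'e topology)"
    by (rule homeomorphic_map_imp_homeomorphic_space[OF homeomorphic_VM[OF iso]])
  show "Hausdorff_space (mtop VM)"
    using homeomorphic_Hausdorff_space[OF hs] by simp
  obtain B :: "'e set set" where B: "countable B" "topological_basis B"
    using ex_countable_basis by blast
  have "second_countable (euclidean :: 'e topology)"
    unfolding second_countable_def
  proof (intro exI[of _ B] conjI allI impI ballI B(1))
    show "openin euclidean S" if "S \<in> B" for S using topological_basis_open[OF B(2) that] by simp
    show "\<exists>S\<in>B. x \<in> S \<and> S \<subseteq> U" if "openin euclidean U \<and> x \<in> U" for U x
      using topological_basisE[OF B(2)] that by (metis open_openin)
  qed
  then show "second_countable (mtop VM)" using homeomorphic_space_second_countability[OF hs] by simp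
  have atlas: "atlas VM = {V} \<times> lin_isos V" by (simp add: vector_space_manifold_def)
  have bij: "\<psi> ` V = UNIV" if "\<psi> \<in> lin_isos V" for \<psi> :: "'v \<Rightarrow> 'e"
    using that unfolding lin_isos_def bij_betw_def by simp
  show "(\<Union>(U, \<psi>)\<in>atlas VM. U) = points VM" using iso unfolding atlas points_VM by auto
  fix U and \<psi> :: "'v \<Rightarrow> 'e" assume U: "(U, \<psi>) \<in> atlas VM"
  then have \<psi>: "U = V" "\<psi> \<in> lin_isos V" unfolding atlas by auto
  show "openin (mtop VM) U" using openin_topspace[of "mtop VM"] by (simp add: \<psi>(1))
  show "open (\<psi> ` U)" by (simp add: \<psi>(1) bij[OF \<psi>(2)])
  have "subtopology (mtop VM) V = mtop VM" using subtopology_topspace[of "mtop VM"] by simp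
  then show "homeomorphic_map (subtopology (mtop VM) U) (top_of_set (\<psi> ` U)) \<psi>"
    using homeomorphic_VM[OF \<psi>(2)] by (simp add: \<psi>(1) bij[OF \<psi>(2)])
  fix U' and \<theta> :: "'v \<Rightarrow> 'e" assume "(U', \<theta>) \<in> atlas VM"
  then have "lin_on V \<theta>" unfolding atlas lin_isos_def by auto
  from linear_lin_iso_inverse[OF \<psi>(2) this]
  show "smooth_on (\<psi> ` (U \<inter> U')) (\<theta> \<circ> inv_into U \<psi>)"
    unfolding \<psi>(1) o_def by (intro smooth_on_bounded_linear) (simp add: linear_linear)
qed

lemma atlas_VM: "(V, \<phi>) \<in> atlas VM"
  using iso by (simp add: vector_space_manifold_def)

lemma smooth_fun_linear:
  assumes "lin_on V l"
  shows "smooth_fun VM V l"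
proof (rule smooth_manifold.smooth_fun_chartI[OF smooth_manifold_VM atlas_VM])
  show "openin (mtop VM) V" using openin_topspace[of "mtop VM"] by simp
  show "smooth_on (\<phi> ` V) (\<lambda>x. l (inv_into V \<phi> x))"
    using linear_lin_iso_inverse[OF iso assms] by (intro smooth_on_bounded_linear) (simp add: linear_linear)
qed (simp_all add: lin_iso_inverse(3)[OF iso])

lemma smooth_fun_linear_compose:
  assumes "smooth_manifold M" "smooth_map M VM F" "lin_on V l"
  shows "smooth_fun M (points M) (\<lambda>p. l (F p))"
proof -
  have "{p \<in> points M. F p \<in> V} = points M" using smooth_map_points[OF assms(2)] by auto
  then show ?thesis
    using smooth_fun_pullback[OF assms(1) smooth_manifold_VM assms(2) smooth_fun_linear[OF assms(3)]] by simp
qed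

lemma smooth_map_linearI:
  assumes M: "smooth_manifold M" and F: "\<And>p. p \<in> points M \<Longrightarrow> F p \<in> V"
    and comp: "\<And>b. b \<in> Basis \<Longrightarrow> smooth_fun M (points M) (\<lambda>p. \<phi> (F p) \<bullet> b)"
  shows "smooth_map M VM F"
proof (rule smooth_map_chartI[OF M smooth_manifold_VM])
  interpret M: smooth_manifold M by (rule M)
  have "openin (mtop M) {p \<in> points M. F p \<in> W}" if "openin (mtop VM) W" for W
  proof -
    have W: "W \<subseteq> V" "open (\<phi> ` W)" using that openin_VM[OF iso] by auto
    have "F p \<in> W" if p: "p \<in> points M" and im: "\<phi> (F p) \<in> \<phi> ` W" for p
    proof -
      obtain w where w: "w \<in> W" "\<phi> (F p) = \<phi> w" using im by blast
      then have "F p = w" using lin_iso_inverse(3)[OF iso] F[OF p] W(1) by (metis subsetD)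
      then show ?thesis using w by simp
    qed
    then have "{p \<in> points M. F p \<in> W} = {p \<in> points M. \<phi> (F p) \<in> \<phi> ` W}" by blast
    then show ?thesis using M.openin_preimage_components[OF comp W(2)] by simp
  qed
  then show "continuous_map (mtop M) (mtop VM) F" unfolding continuous_map_def using F by simp
  fix p assume p: "p \<in> points M"
  obtain U \<theta> where U: "(U, \<theta>) \<in> atlas M" "p \<in> U" using M.obtain_chart[OF p] .
  have dom: "U \<inter> F -` V = U" using F M.chart_subset[OF U(1)] by blast
  have "smooth_on (\<theta> ` U) (\<lambda>x. \<phi> (F (inv_into U \<theta> x)) \<bullet> b)" if "b \<in> Basis" for b
    by (rule smooth_on_subset[OF M.smooth_fun_chart[OF comp[OF that] U(1), unfolded o_def]])
       (use M.chart_subset[OF U(1)] in blast)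
  then have "smooth_on (\<theta> ` (U \<inter> F -` V)) (\<phi> \<circ> F \<circ> inv_into U \<theta>)"
    unfolding dom o_def by (rule smooth_on_components[OF M.chart_image[OF U(1)]])
  with U atlas_VM F[OF p]
  show "\<exists>U \<theta> W \<psi>. (U, \<theta>) \<in> atlas M \<and> p \<in> U \<and> (W, \<psi>) \<in> atlas VM \<and> F p \<in> W \<and>
      smooth_on (\<theta> ` (U \<inter> F -` W)) (\<psi> \<circ> F \<circ> inv_into U \<theta>)"
    by (intro exI[of _ U] exI[of _ \<theta>] exI[of _ V] exI[of _ \<phi>]) simp
qed

lemma lin_on_component: "lin_on V (\<lambda>v. \<phi> v \<bullet> b)"
  using iso unfolding lin_isos_def lin_on_def by (auto simp: inner_add_left)

lemma smooth_map_add: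
  assumes M: "smooth_manifold M" and F: "smooth_map M VM F" and G: "smooth_map M VM G"
  shows "smooth_map M VM (\<lambda>p. F p + G p)"
proof (rule smooth_map_linearI[OF M])
  have V: "F p \<in> V" "G p \<in> V" if "p \<in> points M" for p
    using smooth_map_points[OF F that] smooth_map_points[OF G that] by auto
  then show "F p + G p \<in> V" if "p \<in> points M" for p using subspace_add[OF subspace] that by blast
  show "smooth_fun M (points M) (\<lambda>p. \<phi> (F p + G p) \<bullet> b)" for b
    by (rule smooth_manifold.smooth_fun_cong[OF M smooth_manifold.smooth_fun_add[OF M
          smooth_fun_linear_compose[OF M F lin_on_component] smooth_fun_linear_compose[OF M G lin_on_component]]])
      (use V iso in \<open>auto simp: lin_isos_def lin_on_def inner_add_left\<close>)
qed

lemma smooth_map_minus: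
  assumes M: "smooth_manifold M" and F: "smooth_map M VM F"
  shows "smooth_map M VM (\<lambda>p. - F p)"
proof (rule smooth_map_linearI[OF M])
  have V: "F p \<in> V" if "p \<in> points M" for p using smooth_map_points[OF F that] by auto
  then show "- F p \<in> V" if "p \<in> points M" for p using subspace_neg[OF subspace] that by blast
  show "smooth_fun M (points M) (\<lambda>p. \<phi> (- F p) \<bullet> b)" for b
  proof (rule smooth_manifold.smooth_fun_cong[OF M smooth_manifold.smooth_fun_scale[OF M
          smooth_fun_linear_compose[OF M F lin_on_component], of "-1"]])
    fix p assume "p \<in> points M"
    moreover have "\<forall>c. \<forall>u\<in>V. \<phi> (c *\<^sub>R u) = c *\<^sub>R \<phi> u" using iso by (simp add: lin_isos_def lin_on_def)
    ultimately have "\<phi> ((-1) *\<^sub>R F p) = (-1) *\<^sub>R \<phi> (F p)" using V by blast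
    then show "\<phi> (- F p) \<bullet> b = - 1 * (\<phi> (F p) \<bullet> b)" by simp
  qed
qed

end

section \<open>Tensors that are constant in a frame\<close>

lemma sum_fun_apply: "(\<Sum>i\<in>I. v i) f = (\<Sum>i\<in>I. v i f)"
  by (induction I rule: infinite_finite_induct) simp_all

lemma linear_inner_expand:
  fixes x :: "'e::euclidean_space" and J :: "'e \<Rightarrow> 'f::real_inner"
  assumes "linear J"
  shows "J x \<bullet> c = (\<Sum>a\<in>Basis. (x \<bullet> a) * (J a \<bullet> c))"
proof -
  have "J x = J (\<Sum>a\<in>Basis. (x \<bullet> a) *\<^sub>R a)" by (simp add: euclidean_representation)
  also have "\<dots> = (\<Sum>a\<in>Basis. (x \<bullet> a) *\<^sub>R J a)" by (simp add: linear_sum[OF assms] linear_scale[OF assms])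
  finally show ?thesis by (simp add: inner_sum_left)
qed

lemma linear_expand:
  fixes x :: "'e::euclidean_space"
  assumes "linear l"
  shows "l x = (\<Sum>a\<in>Basis. (x \<bullet> a) *\<^sub>R l a)"
proof -
  have "l x = l (\<Sum>a\<in>Basis. (x \<bullet> a) *\<^sub>R a)" by (simp add: euclidean_representation)
  also have "\<dots> = (\<Sum>a\<in>Basis. (x \<bullet> a) *\<^sub>R l a)" by (simp add: linear_sum[OF assms] linear_scale[OF assms])
  finally show ?thesis .
qed

lemma bilinear_expand:
  fixes x :: "'e::euclidean_space" and y :: "'f::euclidean_space"
  assumes "bilinear B"
  shows "B x y = (\<Sum>a\<in>Basis. \<Sum>b\<in>Basis. ((x \<bullet> a) * (y \<bullet> b)) *\<^sub>R B a b)"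
proof -
  have l: "linear (\<lambda>x. B x y)" and r: "linear (B a)" for a y using assms unfolding bilinear_def by blast+
  have "B x y = (\<Sum>a\<in>Basis. (x \<bullet> a) *\<^sub>R B a y)" by (rule linear_expand[OF l])
  also have "\<dots> = (\<Sum>a\<in>Basis. \<Sum>b\<in>Basis. ((x \<bullet> a) * (y \<bullet> b)) *\<^sub>R B a b)"
    unfolding linear_expand[OF r, of _ y] by (simp add: scaleR_sum_right)
  finally show ?thesis .
qed

text \<open>The derivative of a vector valued function along a tangent vector, taken componentwise because
  tangent vectors act on real functions.\<close>

definition vector_derivative_along :: "'m tangent \<Rightarrow> ('m \<Rightarrow> 'e::euclidean_space) \<Rightarrow> 'e" where
  "vector_derivative_along v h = (\<Sum>b\<in>Basis. v (\<lambda>q. h q \<bullet> b) *\<^sub>R b)"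

lemma vector_derivative_along_inner:
  "b \<in> Basis \<Longrightarrow> vector_derivative_along v h \<bullet> b = v (\<lambda>q. h q \<bullet> b)"
  by (simp add: vector_derivative_along_def)

text \<open>A frame is indexed linearly by the model space: \<open>E w\<close> is the field with constant coefficient
  vector \<open>w\<close>, and \<open>coef p\<close> reads off the coefficients of a tangent vector at \<open>p\<close>. The structure
  functions \<open>br\<close> of the frame are required to be constant.\<close>

locale framed_manifold = smooth_manifold M
  for M :: "('m, 'e::euclidean_space) manifold" +
  fixes E :: "'e \<Rightarrow> 'm vfield" and coef :: "'m \<Rightarrow> 'm tangent \<Rightarrow> 'e" and br :: "'e \<Rightarrow> 'e \<Rightarrow> 'e"
  assumes field: "E w \<in> vector_fields M"
    and linear_frame: "p \<in> points M \<Longrightarrow> linear (\<lambda>w. E w p)"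
    and frame_coef: "v \<in> tangent_space M p \<Longrightarrow> E (coef p v) p = v"
    and coef_frame: "p \<in> points M \<Longrightarrow> coef p (E w p) = w"
    and coef_smooth: "X \<in> vector_fields M \<Longrightarrow> smooth_fun M (points M) (\<lambda>p. coef p (X p) \<bullet> b)"
    and bracket_frame: "p \<in> points M \<Longrightarrow> lie_bracket M (E u) (E w) p = E (br u w) p"
    and nonempty: "points M \<noteq> {}"
begin

lemma frame_tangent: "p \<in> points M \<Longrightarrow> E w p \<in> tangent_space M p"
  by (rule vector_field_tangent[OF field])

lemma frame_apply: "p \<in> points M \<Longrightarrow> E w p f = (\<Sum>b\<in>Basis. (w \<bullet> b) * E b p f)"
  by (subst linear_expand[OF linear_frame]) (simp_all add: sum_fun_apply scaleR_fun_def)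

lemma frame_add: "p \<in> points M \<Longrightarrow> E (u + w) p = E u p + E w p"
  by (rule linear_add[OF linear_frame])

lemma frame_scaleR: "p \<in> points M \<Longrightarrow> E (c *\<^sub>R w) p = c *\<^sub>R E w p"
  by (rule linear_scale[OF linear_frame])

lemma coef_add: "u \<in> tangent_space M p \<Longrightarrow> v \<in> tangent_space M p \<Longrightarrow> coef p (u + v) = coef p u + coef p v"
  by (metis coef_frame frame_add frame_coef tangent_space_imp_point)

lemma coef_scaleR: "u \<in> tangent_space M p \<Longrightarrow> coef p (c *\<^sub>R u) = c *\<^sub>R coef p u"
  by (metis coef_frame frame_scaleR frame_coef tangent_space_imp_point)

lemma coef_smooth_near: "X \<in> vector_fields M \<Longrightarrow> p \<in> points M \<Longrightarrow> smooth_near M p (\<lambda>q. coef q (X q) \<bullet> b)"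
  by (rule smooth_nearI[OF coef_smooth])

lemma br_antisym: "br u w = - br w u"
proof -
  obtain p where p: "p \<in> points M" using nonempty by blast
  have br: "br u w = coef p (lie_bracket M (E u) (E w) p)" for u w
    by (simp add: bracket_frame coef_frame p)
  have "lie_bracket M (E u) (E w) p = (-1) *\<^sub>R lie_bracket M (E w) (E u) p"
    by (auto simp: lie_bracket_def fun_eq_iff scaleR_fun_def)
  then show ?thesis
    unfolding br using coef_scaleR[OF lie_bracket_tangent[OF field field p], of "-1" w u] by simp
qed

text \<open>Bilinearity is inherited from the Lie bracket of the frame fields at a single point.\<close>

lemma bilinear_br: "bilinear br"
proof -
  obtain p where p: "p \<in> points M" using nonempty by blast
  have br: "br u w = coef p (lie_bracket M (E u) (E w) p)" for u w
    by (simp add: bracket_frame coef_frame p)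
  have tb: "lie_bracket M (E u) (E w) p \<in> tangent_space M p" for u w
    by (rule lie_bracket_tangent[OF field field p])
  have Ef: "smooth_near M p (\<lambda>q. E w q f)" if "smooth_near M p f" for w f
    by (rule vector_field_smooth_near[OF field that])
  have on_points: "E w p g = E w p h" if "\<And>q. q \<in> points M \<Longrightarrow> g q = h q" for w g h
    by (rule tangent_vector_cong[OF frame_tangent[OF p] openin_topspace p that])
  have add: "br (u + u') w = br u w + br u' w" for u u' w
  proof -
    have "lie_bracket M (E (u + u')) (E w) p = lie_bracket M (E u) (E w) p + lie_bracket M (E u') (E w) p"
    proof (rule ext)
      fix f
      show "lie_bracket M (E (u + u')) (E w) p f = (lie_bracket M (E u) (E w) p + lie_bracket M (E u') (E w) p) f"
      proof (cases "smooth_near M p f")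
        case True
        have "E w p (\<lambda>q. E (u + u') q f) = E w p (\<lambda>q. E u q f + E u' q f)"
          by (rule on_points) (simp add: frame_add)
        also have "\<dots> = E w p (\<lambda>q. E u q f) + E w p (\<lambda>q. E u' q f)"
          by (rule tangent_vector_add[OF frame_tangent[OF p] Ef[OF True] Ef[OF True]])
        finally show ?thesis using True by (simp add: lie_bracket_def frame_add[OF p])
      qed (simp add: lie_bracket_def)
    qed
    then show ?thesis by (simp add: br coef_add[OF tb tb])
  qed
  have scale: "br (c *\<^sub>R u) w = c *\<^sub>R br u w" for c u w
  proof -
    have "lie_bracket M (E (c *\<^sub>R u)) (E w) p = c *\<^sub>R lie_bracket M (E u) (E w) p"
    proof (rule ext)
      fix f
      show "lie_bracket M (E (c *\<^sub>R u)) (E w) p f = (c *\<^sub>R lie_bracket M (E u) (E w) p) f"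
      proof (cases "smooth_near M p f")
        case True
        have "E w p (\<lambda>q. E (c *\<^sub>R u) q f) = E w p (\<lambda>q. c * E u q f)"
          by (rule on_points) (simp add: frame_scaleR scaleR_fun_def)
        also have "\<dots> = c * E w p (\<lambda>q. E u q f)"
          by (rule tangent_vector_scale[OF frame_tangent[OF p] Ef[OF True]])
        finally show ?thesis
          using True by (simp add: lie_bracket_def frame_scaleR[OF p] scaleR_fun_def right_diff_distrib)
      qed (simp add: lie_bracket_def scaleR_fun_def)
    qed
    then show ?thesis by (simp add: br coef_scaleR[OF tb])
  qed
  show ?thesis
    unfolding bilinear_def
  proof (intro conjI allI)
    show "linear (\<lambda>u. br u w)" for w by (rule linearI) (simp_all add: add scale)
    have "br u (w + w') = br u w + br u w'" for u w w'
      using br_antisym[of u "w + w'"] br_antisym[of u w] br_antisym[of u w'] add[of w w' u] by simp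
    moreover have "br u (c *\<^sub>R w) = c *\<^sub>R br u w" for c u w
      using br_antisym[of u "c *\<^sub>R w"] br_antisym[of u w] scale[of c w u] by simp
    ultimately show "linear (br u)" for u by (rule linearI)
  qed
qed

lemma field_of_coefficients:
  assumes "\<And>b. b \<in> Basis \<Longrightarrow> smooth_fun M (points M) (\<lambda>p. x p \<bullet> b)"
  shows "(\<lambda>p. if p \<in> points M then E (x p) p else 0) \<in> vector_fields M"
  unfolding vector_fields_def
proof (intro CollectI conjI ballI allI impI)
  fix W f assume f: "smooth_fun M W f"
  have W: "openin (mtop M) W" "W \<subseteq> points M"
    using smooth_fun_openin[OF f] smooth_fun_subset_points[OF f] by auto
  have "smooth_fun M W (\<lambda>p. \<Sum>b\<in>Basis. (x p \<bullet> b) * E b p f)"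
    by (intro smooth_fun_sum smooth_fun_mult W(1) vector_field_smooth[OF field f]
        smooth_fun_subset[OF assms W])
  then show "smooth_fun M W (\<lambda>p. (if p \<in> points M then E (x p) p else 0) f)"
    by (rule smooth_fun_cong) (use W(2) in \<open>auto simp: frame_apply[of _ "x _"]\<close>)
qed (simp_all add: frame_tangent)

lemma vector_derivative_along_linear:
  assumes "linear J" and v: "v \<in> tangent_space M p" and x: "\<And>b. smooth_near M p (\<lambda>q. x q \<bullet> b)"
  shows "vector_derivative_along v (\<lambda>q. J (x q)) = (J (vector_derivative_along v x) :: 'e)"
proof (rule euclidean_eqI)
  fix b :: 'e assume b: "b \<in> Basis"
  note p = tangent_space_imp_point[OF v]
  have "vector_derivative_along v (\<lambda>q. J (x q)) \<bullet> b = v (\<lambda>q. \<Sum>a\<in>Basis. (x q \<bullet> a) * (J a \<bullet> b))"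
    unfolding vector_derivative_along_inner[OF b] linear_inner_expand[OF assms(1), of "x _"] ..
  also have "\<dots> = (\<Sum>a\<in>Basis. v (\<lambda>q. (x q \<bullet> a) * (J a \<bullet> b)))"
    by (rule tangent_vector_sum[OF v smooth_near_mult[OF x smooth_near_const[OF p]]])
  also have "\<dots> = (\<Sum>a\<in>Basis. (vector_derivative_along v x \<bullet> a) * (J a \<bullet> b))"
    by (intro sum.cong refl)
       (simp add: tangent_vector_mult[OF v x smooth_near_const[OF p]] tangent_vector_const[OF v]
         vector_derivative_along_inner)
  also have "\<dots> = J (vector_derivative_along v x) \<bullet> b"
    by (rule linear_inner_expand[OF assms(1), symmetric])
  finally show "vector_derivative_along v (\<lambda>q. J (x q)) \<bullet> b = J (vector_derivative_along v x) \<bullet> b" .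
qed

lemma smooth_fun_bilinear:
  assumes "bilinear B" and x: "\<And>b. smooth_fun M W (\<lambda>q. x q \<bullet> b)" and y: "\<And>b. smooth_fun M W (\<lambda>q. y q \<bullet> b)"
  shows "smooth_fun M W (\<lambda>q. B (x q :: 'e) (y q :: 'e) :: real)"
proof -
  have "smooth_fun M W (\<lambda>q. \<Sum>a\<in>Basis. \<Sum>b\<in>Basis. ((x q \<bullet> a) * (y q \<bullet> b)) * B a b)"
    by (intro smooth_fun_sum smooth_fun_mult x y smooth_fun_const smooth_fun_openin[OF x])
  then show ?thesis by (rule smooth_fun_cong) (subst bilinear_expand[OF assms(1)], simp)
qed

lemma tangent_vector_bilinear:
  assumes "bilinear B" and v: "v \<in> tangent_space M p"
    and x: "\<And>b. smooth_near M p (\<lambda>q. x q \<bullet> b)" and y: "\<And>b. smooth_near M p (\<lambda>q. y q \<bullet> b)"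
  shows "v (\<lambda>q. B (x q :: 'e) (y q :: 'e) :: real) =
    B (vector_derivative_along v x) (y p) + B (x p) (vector_derivative_along v y)"
proof -
  note p = tangent_space_imp_point[OF v]
  have xy: "smooth_near M p (\<lambda>q. (x q \<bullet> a) * (y q \<bullet> b))" for a b by (rule smooth_near_mult[OF x y])
  have summand: "smooth_near M p (\<lambda>q. ((x q \<bullet> a) * (y q \<bullet> b)) * B a b)" for a b
    by (rule smooth_near_mult[OF xy smooth_near_const[OF p]])
  have "v (\<lambda>q. B (x q) (y q)) = v (\<lambda>q. \<Sum>a\<in>Basis. \<Sum>b\<in>Basis. ((x q \<bullet> a) * (y q \<bullet> b)) * B a b)"
    by (subst bilinear_expand[OF assms(1)]) simp
  also have "\<dots> = (\<Sum>a\<in>Basis. v (\<lambda>q. \<Sum>b\<in>Basis. ((x q \<bullet> a) * (y q \<bullet> b)) * B a b))"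
    by (rule tangent_vector_sum[OF v smooth_near_sum[OF p summand]])
  also have "\<dots> = (\<Sum>a\<in>Basis. \<Sum>b\<in>Basis. v (\<lambda>q. ((x q \<bullet> a) * (y q \<bullet> b)) * B a b))"
    by (intro sum.cong refl tangent_vector_sum[OF v summand])
  also have "\<dots> = (\<Sum>a\<in>Basis. \<Sum>b\<in>Basis. ((vector_derivative_along v x \<bullet> a) * (y p \<bullet> b)) *\<^sub>R B a b +
       ((x p \<bullet> a) * (vector_derivative_along v y \<bullet> b)) *\<^sub>R B a b)"
  proof (intro sum.cong refl)
    fix a b :: 'e assume "a \<in> Basis" "b \<in> Basis"
    then show "v (\<lambda>q. ((x q \<bullet> a) * (y q \<bullet> b)) * B a b) =
        ((vector_derivative_along v x \<bullet> a) * (y p \<bullet> b)) *\<^sub>R B a b +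
        ((x p \<bullet> a) * (vector_derivative_along v y \<bullet> b)) *\<^sub>R B a b"
      unfolding tangent_vector_mult[OF v xy smooth_near_const[OF p]] tangent_vector_mult[OF v x y]
        tangent_vector_const[OF v]
      by (simp add: vector_derivative_along_inner algebra_simps)
  qed
  also have "\<dots> = B (vector_derivative_along v x) (y p) + B (x p) (vector_derivative_along v y)"
    unfolding sum.distrib bilinear_expand[OF assms(1), of "vector_derivative_along v x" "y p"]
      bilinear_expand[OF assms(1), of "x p" "vector_derivative_along v y"] ..
  finally show ?thesis .
qed

text \<open>The structure equation: a Lie bracket differentiates the coefficients and adds the bracket of the
  frame. It turns identities between tensors that are constant in the frame into linear algebra in
  the model space, for arbitrary and not only for constant fields.\<close>

lemma structure_equation:
  assumes X: "X \<in> vector_fields M" and Y: "Y \<in> vector_fields M" and p: "p \<in> points M"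
  shows "coef p (lie_bracket M X Y p) =
    vector_derivative_along (X p) (\<lambda>q. coef q (Y q)) - vector_derivative_along (Y p) (\<lambda>q. coef q (X q))
    + br (coef p (X p)) (coef p (Y p))"
proof -
  define hat where "hat Z q = coef q (Z q)" for Z and q :: 'm
  have hat: "Z q f = (\<Sum>b\<in>Basis. (hat Z q \<bullet> b) * E b q f)"
    if "Z \<in> vector_fields M" "q \<in> points M" for Z q f
    using frame_apply[OF that(2), of "hat Z q" f] frame_coef[OF vector_field_tangent[OF that]]
    by (simp add: hat_def)
  have hat_near: "smooth_near M p (\<lambda>q. hat Z q \<bullet> b)" if "Z \<in> vector_fields M" for Z b
    unfolding hat_def by (rule coef_smooth_near[OF that p])
  have second: "Z p (\<lambda>q. Z' q f) = E (vector_derivative_along (Z p) (hat Z')) p f +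
      (\<Sum>b\<in>Basis. \<Sum>a\<in>Basis. ((hat Z p \<bullet> a) * (hat Z' p \<bullet> b)) * E a p (\<lambda>q. E b q f))"
    if Z: "Z \<in> vector_fields M" and Z': "Z' \<in> vector_fields M" and f: "smooth_near M p f" for Z Z' f
  proof -
    have Zp: "Z p \<in> tangent_space M p" by (rule vector_field_tangent[OF Z p])
    have Ef: "smooth_near M p (\<lambda>q. E b q f)" for b by (rule vector_field_smooth_near[OF field f])
    have "Z p (\<lambda>q. Z' q f) = Z p (\<lambda>q. \<Sum>b\<in>Basis. (hat Z' q \<bullet> b) * E b q f)"
      by (rule tangent_vector_cong[OF Zp openin_topspace p hat[OF Z']])
    also have "\<dots> = (\<Sum>b\<in>Basis. Z p (\<lambda>q. (hat Z' q \<bullet> b) * E b q f))"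
      by (rule tangent_vector_sum[OF Zp smooth_near_mult[OF hat_near[OF Z'] Ef]])
    also have "\<dots> = (\<Sum>b\<in>Basis. (hat Z' p \<bullet> b) * Z p (\<lambda>q. E b q f) + Z p (\<lambda>q. hat Z' q \<bullet> b) * E b p f)"
      by (intro sum.cong refl tangent_vector_mult[OF Zp hat_near[OF Z'] Ef])
    also have "\<dots> = (\<Sum>b\<in>Basis. (vector_derivative_along (Z p) (hat Z') \<bullet> b) * E b p f) +
        (\<Sum>b\<in>Basis. (hat Z' p \<bullet> b) * Z p (\<lambda>q. E b q f))"
      by (simp add: sum.distrib vector_derivative_along_inner)
    also have "(\<Sum>b\<in>Basis. (vector_derivative_along (Z p) (hat Z') \<bullet> b) * E b p f) =
        E (vector_derivative_along (Z p) (hat Z')) p f"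
      by (rule frame_apply[OF p, symmetric])
    also have "(\<Sum>b\<in>Basis. (hat Z' p \<bullet> b) * Z p (\<lambda>q. E b q f)) =
        (\<Sum>b\<in>Basis. \<Sum>a\<in>Basis. ((hat Z p \<bullet> a) * (hat Z' p \<bullet> b)) * E a p (\<lambda>q. E b q f))"
      unfolding hat[OF Z p] by (simp add: sum_distrib_left mult_ac)
    finally show ?thesis .
  qed
  let ?c = "vector_derivative_along (X p) (hat Y) - vector_derivative_along (Y p) (hat X) + br (hat X p) (hat Y p)"
  have "lie_bracket M X Y p = E ?c p"
  proof (rule ext)
    fix f
    show "lie_bracket M X Y p f = E ?c p f"
    proof (cases "smooth_near M p f")
      case True
      have "E (br (hat X p) (hat Y p)) p f =
          (\<Sum>a\<in>Basis. \<Sum>b\<in>Basis. ((hat X p \<bullet> a) * (hat Y p \<bullet> b)) * E (br a b) p f)"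
        unfolding bilinear_expand[OF bilinear_br, of "hat X p"]
        by (simp add: linear_sum[OF linear_frame[OF p]] frame_scaleR[OF p] sum_fun_apply scaleR_fun_def)
      also have "\<dots> = (\<Sum>a\<in>Basis. \<Sum>b\<in>Basis. ((hat X p \<bullet> a) * (hat Y p \<bullet> b)) * E a p (\<lambda>q. E b q f)) -
          (\<Sum>a\<in>Basis. \<Sum>b\<in>Basis. ((hat X p \<bullet> a) * (hat Y p \<bullet> b)) * E b p (\<lambda>q. E a q f))"
        unfolding bracket_frame[OF p, symmetric] lie_bracket_def
        using True by (simp add: right_diff_distrib sum_subtractf)
      also have "(\<Sum>a\<in>Basis. \<Sum>b\<in>Basis. ((hat X p \<bullet> a) * (hat Y p \<bullet> b)) * E a p (\<lambda>q. E b q f)) =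
          (\<Sum>b\<in>Basis. \<Sum>a\<in>Basis. ((hat X p \<bullet> a) * (hat Y p \<bullet> b)) * E a p (\<lambda>q. E b q f))"
        by (rule sum.swap)
      also have "(\<Sum>a\<in>Basis. \<Sum>b\<in>Basis. ((hat X p \<bullet> a) * (hat Y p \<bullet> b)) * E b p (\<lambda>q. E a q f)) =
          (\<Sum>a\<in>Basis. \<Sum>b\<in>Basis. ((hat Y p \<bullet> b) * (hat X p \<bullet> a)) * E b p (\<lambda>q. E a q f))"
        by (simp add: mult.commute)
      finally have "lie_bracket M X Y p f = E (vector_derivative_along (X p) (hat Y)) p f -
          E (vector_derivative_along (Y p) (hat X)) p f + E (br (hat X p) (hat Y p)) p f"
        using True second[OF X Y True] second[OF Y X True] by (simp add: lie_bracket_def)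
      then show ?thesis by (simp add: frame_add[OF p] linear_diff[OF linear_frame[OF p]])
    next
      case False
      then show ?thesis
        using tangent_vector_not_smooth[OF frame_tangent[OF p]] by (simp add: lie_bracket_def)
    qed
  qed
  then have "coef p (lie_bracket M X Y p) = ?c" using coef_frame[OF p] by simp
  moreover have "hat Y = (\<lambda>q. coef q (Y q))" "hat X = (\<lambda>q. coef q (X q))" by (auto simp: hat_def)
  ultimately show ?thesis by simp
qed

lemma smooth_bilinear_field_frame:
  assumes B: "bilinear B"
    and b: "\<And>p u v. u \<in> tangent_space M p \<Longrightarrow> v \<in> tangent_space M p \<Longrightarrow> b p u v = B (coef p u) (coef p v)"
  shows "smooth_bilinear_field M b"
  unfolding smooth_bilinear_field_def bilin_form_on_def lin_on_def
proof (intro conjI ballI allI)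
  fix X Y assume X: "X \<in> vector_fields M" and Y: "Y \<in> vector_fields M"
  show "smooth_fun M (points M) (\<lambda>p. b p (X p) (Y p))"
    by (rule smooth_fun_cong[OF smooth_fun_bilinear[OF B coef_smooth[OF X] coef_smooth[OF Y]]])
       (simp add: b vector_field_tangent X Y)
qed (simp_all add: b coef_add coef_scaleR tangent_space_add tangent_space_scaleR
      bilinear_ladd[OF B] bilinear_radd[OF B] bilinear_lmul[OF B] bilinear_rmul[OF B])

lemma nondegenerate_frame:
  assumes p: "p \<in> points M"
    and nd: "\<And>x. (\<And>y. B x y = 0) \<Longrightarrow> x = 0"
    and b: "\<And>p u v. u \<in> tangent_space M p \<Longrightarrow> v \<in> tangent_space M p \<Longrightarrow> b p u v = B (coef p u) (coef p v)"
  shows "nondegenerate_on (tangent_space M p) (b p)"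
  unfolding nondegenerate_on_def
proof (intro ballI impI)
  fix u assume u: "u \<in> tangent_space M p" and 0: "\<forall>v\<in>tangent_space M p. b p u v = 0"
  have "B (coef p u) y = 0" for y
    using 0 b[OF u frame_tangent[OF p]] frame_tangent[OF p] coef_frame[OF p] by metis
  then have "coef p u = 0" by (rule nd)
  then have "u = E 0 p" using frame_coef[OF u] by simp
  then show "u = 0" using linear_0[OF linear_frame[OF p]] by simp
qed

lemma pseudo_riemannian_metric_frame:
  assumes B: "bilinear B" and sym: "\<And>x y. B x y = B y x"
    and nd: "\<And>x. (\<And>y. B x y = 0) \<Longrightarrow> x = 0"
    and b: "\<And>p u v. u \<in> tangent_space M p \<Longrightarrow> v \<in> tangent_space M p \<Longrightarrow> b p u v = B (coef p u) (coef p v)"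
  shows "pseudo_riemannian_metric M b"
  unfolding pseudo_riemannian_metric_def
proof (intro conjI ballI)
  show "smooth_bilinear_field M b" by (rule smooth_bilinear_field_frame[where b = b, OF B b])
  show "nondegenerate_on (tangent_space M p) (b p)" if "p \<in> points M" for p
    by (rule nondegenerate_frame[where b = b and B = B, OF that nd b])
  show "b p u v = b p v u" if "u \<in> tangent_space M p" "v \<in> tangent_space M p" for p u v
    by (simp add: b that sym[of "coef p u"])
qed

text \<open>The derivatives of the coefficients cancel because the form is alternating; what remains of the
  exterior derivative is the cocycle condition on the structure constants.\<close>

lemma symplectic_form_frame:
  assumes B: "bilinear B" and alt: "\<And>x. B x x = 0"
    and nd: "\<And>x. (\<And>y. B x y = 0) \<Longrightarrow> x = 0"
    and cocycle: "\<And>x y z. B (br x y) z + B (br y z) x + B (br z x) y = 0"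
    and b: "\<And>p u v. u \<in> tangent_space M p \<Longrightarrow> v \<in> tangent_space M p \<Longrightarrow> b p u v = B (coef p u) (coef p v)"
  shows "symplectic_form M b"
  unfolding symplectic_form_def
proof (intro conjI ballI)
  show "smooth_bilinear_field M b" by (rule smooth_bilinear_field_frame[where b = b, OF B b])
  show "nondegenerate_on (tangent_space M p) (b p)" if "p \<in> points M" for p
    by (rule nondegenerate_frame[where b = b and B = B, OF that nd b])
  show "b p u u = 0" if "u \<in> tangent_space M p" for p u by (simp add: b that alt)
  \<comment> \<open>Polarisation of the alternating form.\<close>
  have anti: "B x y = - B y x" for x y
    using alt[of "x + y"] unfolding bilinear_ladd[OF B] bilinear_radd[OF B] by (simp add: alt)
  show "closed_two_form M b"
    unfolding closed_two_form_def
  proof (intro ballI)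
    fix X Y Z p
    assume X: "X \<in> vector_fields M" and Y: "Y \<in> vector_fields M" and Z: "Z \<in> vector_fields M" and p: "p \<in> points M"
    define d where "d P Q = vector_derivative_along (P p) (\<lambda>q. coef q (Q q))" for P Q :: "'m vfield"
    have deriv: "P p (\<lambda>q. b q (Q q) (R q)) = B (d P Q) (coef p (R p)) + B (coef p (Q p)) (d P R)"
      if P: "P \<in> vector_fields M" and Q: "Q \<in> vector_fields M" and R: "R \<in> vector_fields M" for P Q R
    proof -
      have "P p (\<lambda>q. b q (Q q) (R q)) = P p (\<lambda>q. B (coef q (Q q)) (coef q (R q)))"
        by (rule tangent_vector_cong[OF vector_field_tangent[OF P p] openin_topspace p])
           (simp add: b vector_field_tangent Q R)
      then show ?thesis unfolding d_def
        by (simp add: tangent_vector_bilinear[OF B vector_field_tangent[OF P p] coef_smooth_near[OF Q p] coef_smooth_near[OF R p]])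
    qed
    have brk: "b p (lie_bracket M P Q p) (R p) =
        B (d P Q) (coef p (R p)) - B (d Q P) (coef p (R p)) + B (br (coef p (P p)) (coef p (Q p))) (coef p (R p))"
      if P: "P \<in> vector_fields M" and Q: "Q \<in> vector_fields M" and R: "R \<in> vector_fields M" for P Q R
      unfolding d_def
      by (simp add: b lie_bracket_tangent vector_field_tangent P Q R p structure_equation
          bilinear_ladd[OF B] bilinear_lsub[OF B])
    let ?x = "coef p (X p)" and ?y = "coef p (Y p)" and ?z = "coef p (Z p)"
    show "X p (\<lambda>q. b q (Y q) (Z q)) - Y p (\<lambda>q. b q (X q) (Z q)) + Z p (\<lambda>q. b q (X q) (Y q))
        - b p (lie_bracket M X Y p) (Z p) + b p (lie_bracket M X Z p) (Y p)
        - b p (lie_bracket M Y Z p) (X p) = 0"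
      unfolding deriv[OF X Y Z] deriv[OF Y X Z] deriv[OF Z X Y] brk[OF X Y Z] brk[OF X Z Y] brk[OF Y Z X]
      using cocycle[of ?x ?y ?z] anti[of ?y "d X Z"] anti[of ?x "d Y Z"] anti[of ?x "d Z Y"]
      by (simp add: br_antisym[of ?z ?x] bilinear_lneg[OF B])
  qed
qed

text \<open>As \<open>J\<close> has constant coefficients it commutes with differentiating coefficients, and \<open>J\<^sup>2 = -1\<close>
  makes all such derivatives cancel in the Nijenhuis tensor.\<close>

lemma complex_structure_frame:
  assumes J: "linear J" and JJ: "\<And>x. J (J x) = - x"
    and nijenhuis: "\<And>x y. br (J x) (J y) - J (br (J x) y) - J (br x (J y)) - br x y = 0"
    and j: "\<And>p u. u \<in> tangent_space M p \<Longrightarrow> j p u = E (J (coef p u)) p"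
  shows "complex_structure M j"
proof -
  have jt: "j p u \<in> tangent_space M p" if "u \<in> tangent_space M p" for p u
    using frame_tangent tangent_space_imp_point[OF that] by (simp add: j that)
  have coef_j: "coef p (j p u) = J (coef p u)" if "u \<in> tangent_space M p" for p u
    using coef_frame tangent_space_imp_point[OF that] by (simp add: j that)
  have jX: "endo_apply M j X \<in> vector_fields M" if X: "X \<in> vector_fields M" for X
  proof -
    have "(\<lambda>p. if p \<in> points M then E (J (coef p (X p))) p else 0) \<in> vector_fields M"
    proof (rule field_of_coefficients)
      fix b :: 'e
      have "smooth_fun M (points M) (\<lambda>p. \<Sum>a\<in>Basis. (coef p (X p) \<bullet> a) * (J a \<bullet> b))"
        by (intro smooth_fun_sum smooth_fun_mult coef_smooth[OF X] smooth_fun_const openin_topspace)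
      then show "smooth_fun M (points M) (\<lambda>p. J (coef p (X p)) \<bullet> b)"
        by (rule smooth_fun_cong) (rule linear_inner_expand[OF J])
    qed
    moreover have "endo_apply M j X = (\<lambda>p. if p \<in> points M then E (J (coef p (X p))) p else 0)"
      using vector_field_tangent[OF X] by (auto simp: endo_apply_def j)
    ultimately show ?thesis by simp
  qed
  have "almost_complex_structure M j"
    unfolding almost_complex_structure_def lin_on_def
  proof (intro conjI ballI allI)
    fix p u assume p: "p \<in> points M" and u: "u \<in> tangent_space M p"
    show "j p (j p u) = - u"
      using j[OF jt[OF u]] coef_j[OF u] JJ frame_coef[OF u] linear_neg[OF linear_frame[OF p]] by simp
    show "j p (c *\<^sub>R u) = c *\<^sub>R j p u" for c
      by (simp add: j u tangent_space_scaleR coef_scaleR frame_scaleR[OF p] linear_scale[OF J])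
    show "j p (u + v) = j p u + j p v" if "v \<in> tangent_space M p" for v
      by (simp add: j u that tangent_space_add coef_add frame_add[OF p] linear_add[OF J])
  qed (simp_all add: jt jX)
  moreover have "lie_bracket M (endo_apply M j X) (endo_apply M j Y)
        - endo_apply M j (lie_bracket M (endo_apply M j X) Y)
        - endo_apply M j (lie_bracket M X (endo_apply M j Y)) - lie_bracket M X Y = 0"
    if X: "X \<in> vector_fields M" and Y: "Y \<in> vector_fields M" for X Y
  proof (rule ext)
    fix p
    let ?jX = "endo_apply M j X" and ?jY = "endo_apply M j Y"
    let ?N = "lie_bracket M ?jX ?jY p - j p (lie_bracket M ?jX Y p) - j p (lie_bracket M X ?jY p) - lie_bracket M X Y p"
    show "(lie_bracket M ?jX ?jY - endo_apply M j (lie_bracket M ?jX Y)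
        - endo_apply M j (lie_bracket M X ?jY) - lie_bracket M X Y) p = 0 p"
    proof (cases "p \<in> points M")
      case p: True
      define d where "d P Q = vector_derivative_along (P p) (\<lambda>q. coef q (Q q))" for P Q :: "'m vfield"
      have t: "lie_bracket M ?jX ?jY p \<in> tangent_space M p" "lie_bracket M ?jX Y p \<in> tangent_space M p"
        "lie_bracket M X ?jY p \<in> tangent_space M p" "lie_bracket M X Y p \<in> tangent_space M p"
        using lie_bracket_tangent X Y jX p by auto
      have dj: "d P (endo_apply M j Q) = J (d P Q)" if P: "P \<in> vector_fields M" and Q: "Q \<in> vector_fields M" for P Q
      proof -
        have "d P (endo_apply M j Q) = vector_derivative_along (P p) (\<lambda>q. J (coef q (Q q)))"
          unfolding d_def vector_derivative_along_def
        proof (intro sum.cong refl arg_cong2[where f = scaleR]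
            tangent_vector_cong[OF vector_field_tangent[OF P p] openin_topspace p])
          fix q and b :: 'e assume "q \<in> points M"
          then show "coef q (endo_apply M j Q q) \<bullet> b = J (coef q (Q q)) \<bullet> b"
            by (simp add: endo_apply_def coef_j vector_field_tangent[OF Q])
        qed
        then show ?thesis unfolding d_def
          by (simp add: vector_derivative_along_linear[OF J vector_field_tangent[OF P p] coef_smooth_near[OF Q p]])
      qed
      have cj: "coef p (endo_apply M j Q p) = J (coef p (Q p))" if "Q \<in> vector_fields M" for Q
        using p by (simp add: endo_apply_def coef_j vector_field_tangent that)
      have brk: "coef p (lie_bracket M P Q p) = d P Q - d Q P + br (coef p (P p)) (coef p (Q p))"
        if "P \<in> vector_fields M" "Q \<in> vector_fields M" for P Q
        unfolding d_def by (rule structure_equation[OF that p])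
      have coef_diff: "coef p (u - v) = coef p u - coef p v"
        if "u \<in> tangent_space M p" "v \<in> tangent_space M p" for u v
        using coef_add[of "u - v" p v] that tangent_space_diff by simp
      have Nt: "?N \<in> tangent_space M p" by (intro tangent_space_diff jt t)
      have "coef p ?N = br (J (coef p (X p))) (J (coef p (Y p))) - J (br (J (coef p (X p))) (coef p (Y p)))
          - J (br (coef p (X p)) (J (coef p (Y p)))) - br (coef p (X p)) (coef p (Y p))"
        by (simp add: coef_diff tangent_space_diff jt t coef_j brk X Y jX dj cj JJ
            linear_add[OF J] linear_diff[OF J] linear_neg[OF J])
      also have "\<dots> = 0" by (rule nijenhuis)
      finally have "?N = E 0 p" using frame_coef[OF Nt] by simp
      then show ?thesis using p linear_0[OF linear_frame[OF p]] by (simp add: endo_apply_def)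
    next
      case False
      then have "\<not> smooth_near M p f" for f using smooth_near_imp_point by blast
      then show ?thesis using False by (auto simp: endo_apply_def lie_bracket_def fun_eq_iff)
    qed
  qed
  ultimately show ?thesis unfolding complex_structure_def by blast
qed

end

section \<open>Left invariant objects on a Lie group\<close>

lemma differential_tangent:
  fixes M :: "('m, 'e::euclidean_space) manifold" and N :: "('n, 'f::euclidean_space) manifold"
  assumes M: "smooth_manifold M" and N: "smooth_manifold N" and F: "smooth_map M N F"
    and v: "v \<in> tangent_space M p"
  shows "differential N F p v \<in> tangent_space N (F p)"
proof -
  interpret M: smooth_manifold M by (rule M)
  interpret N: smooth_manifold N by (rule N)
  have p: "p \<in> points M" by (rule M.tangent_space_imp_point[OF v])
  obtain U \<phi> w where U: "(U, \<phi>) \<in> atlas M" "p \<in> U" "v = chart_tangent M U \<phi> p w"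
    using M.tangent_vectorE[OF v] by blast
  obtain V \<psi> where V: "(V, \<psi>) \<in> atlas N" "F p \<in> V" using N.obtain_chart[OF smooth_map_points[OF F p]] .
  let ?T = "\<psi> \<circ> F \<circ> inv_into U \<phi>"
  let ?S = "\<phi> ` (U \<inter> {p \<in> points M. F p \<in> V})"
  have S: "open ?S"
    using F N.chart_domain[OF V(1)] unfolding smooth_map_def
    by (intro M.chart_open_image[OF U(1)] openin_continuous_map_preimage) auto
  have "smooth_on (\<phi> ` (U \<inter> F -` V)) ?T" using F U(1) V(1) unfolding smooth_map_def by blast
  then have T: "smooth_on ?S ?T" by (rule smooth_on_subset) blast
  have x: "\<phi> p \<in> ?S" using p U V by blast
  have "differential N F p v = chart_tangent N V \<psi> (F p) (\<D> ?T (\<phi> p) w)"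
  proof (rule ext)
    fix f
    show "differential N F p v f = chart_tangent N V \<psi> (F p) (\<D> ?T (\<phi> p) w) f"
    proof (cases "smooth_near N (F p) f")
      case True
      have near: "smooth_near M p (f \<circ> F)"
        using smooth_near_pullback[OF M N F p True] by (simp add: o_def)
      have Tp: "?T (\<phi> p) = \<psi> (F p)" using U by simp
      have d: "(f \<circ> inv_into V \<psi>) differentiable (at (?T (\<phi> p)))"
        using N.smooth_near_chart_differentiable[OF V True] unfolding Tp .
      have "\<D> ((f \<circ> F) \<circ> inv_into U \<phi>) (\<phi> p) =
          \<D> ((f \<circ> inv_into V \<psi>) \<circ> ?T) (\<phi> p)"
        by (rule frechet_derivative_cong_open[OF S x]) (use U(1) V(1) in auto)
      also have "\<dots> = \<D> (f \<circ> inv_into V \<psi>) (\<psi> (F p)) \<circ> \<D> ?T (\<phi> p)"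
        using frechet_derivative_compose[OF smooth_on_imp_differentiable[OF T x] d] unfolding Tp .
      finally show ?thesis using True near by (simp add: differential_def chart_tangent_def U(3))
    qed (simp add: differential_def chart_tangent_def)
  qed
  then show ?thesis using N.tangent_space_chart[OF V] by blast
qed

text \<open>Differentiating a smooth function of two variables in the second variable, along tangent
  vectors that depend smoothly on the first. Applied to the multiplication of a Lie group at the unit, this
  gives smoothness of left invariant fields; applied to division on the diagonal, it gives smoothness
  of the left trivialisation.\<close>

lemma smooth_fun_partial:
  fixes M :: "('m, 'e::euclidean_space) manifold" and N :: "('n, 'f::euclidean_space) manifold"
  assumes M: "smooth_manifold M" and N: "smooth_manifold N"
    and F: "smooth_fun (product_manifold M N) W F" and c: "smooth_map M N c"
    and Yt: "\<And>p. p \<in> points M \<Longrightarrow> Y p \<in> tangent_space N (c p)"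
    and Ys: "\<And>V \<psi> b. (V, \<psi>) \<in> atlas N \<Longrightarrow> smooth_fun M {p \<in> points M. c p \<in> V} (\<lambda>p. Y p (\<lambda>q. \<psi> q \<bullet> b))"
  shows "smooth_fun M {p \<in> points M. (p, c p) \<in> W} (\<lambda>p. Y p (\<lambda>q. F (p, q)))"
proof -
  interpret M: smooth_manifold M by (rule M)
  interpret N: smooth_manifold N by (rule N)
  interpret P: smooth_manifold "product_manifold M N" by (rule smooth_manifold_product[OF M N])
  let ?W = "{p \<in> points M. (p, c p) \<in> W}"
  have W: "openin (mtop M) ?W"
    by (rule M.smooth_fun_openin[OF smooth_fun_pullback[OF M P.smooth_manifold_axioms
            smooth_map_Pair[OF M M N smooth_map_ident[OF M] c] F]])
  show ?thesis
  proof (rule M.smooth_funI[OF W])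
    fix p0 assume p0: "p0 \<in> ?W"
    obtain U \<phi> where U: "(U, \<phi>) \<in> atlas M" "p0 \<in> U" using M.obtain_chart p0 by blast
    obtain V \<psi> where V: "(V, \<psi>) \<in> atlas N" "c p0 \<in> V"
      using N.obtain_chart smooth_map_points[OF c] p0 by blast
    have A: "(U \<times> V, map_prod \<phi> \<psi>) \<in> atlas (product_manifold M N)"
      by (rule atlas_product_manifoldI[OF U(1) V(1)])
    let ?F = "F \<circ> inv_into (U \<times> V) (map_prod \<phi> \<psi>)"
    let ?R = "map_prod \<phi> \<psi> ` (U \<times> V \<inter> W)"
    have R: "open ?R" by (rule P.chart_open_image[OF A P.smooth_fun_openin[OF F]])
    have sF: "smooth_on ?R ?F" by (rule P.smooth_fun_chart[OF F A])
    let ?cV = "{p \<in> points M. c p \<in> V}"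
    have cV: "openin (mtop M) ?cV" by (rule M.smooth_fun_openin[OF Ys[OF V(1)]])
    let ?S = "\<phi> ` (U \<inter> (?W \<inter> ?cV))"
    have S: "open ?S" by (rule M.chart_open_image[OF U(1) openin_Int[OF W cV]])
    define y where "y = \<psi> \<circ> c \<circ> inv_into U \<phi>"
    define w where "w x = (\<Sum>b\<in>Basis. Y (inv_into U \<phi> x) (\<lambda>q. \<psi> q \<bullet> b) *\<^sub>R b)" for x
    have "smooth_on (\<phi> ` (U \<inter> c -` V)) y" using c U(1) V(1) unfolding smooth_map_def y_def by blast
    then have sy: "smooth_on ?S y" by (rule smooth_on_subset) auto
    have "smooth_on ?S (\<lambda>x. Y (inv_into U \<phi> x) (\<lambda>q. \<psi> q \<bullet> b))" for b
      by (rule smooth_on_subset[OF M.smooth_fun_chart[OF Ys[OF V(1), of b] U(1), unfolded o_def]]) blast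
    then have sw: "smooth_on ?S w"
      unfolding w_def by (intro smooth_on_sum smooth_on_scaleR smooth_on_const S)
    have sm: "smooth_on ?S (\<lambda>x. \<D> ?F (x, y x) (0, w x))"
    proof (rule smooth_on_derivative_along[OF R S _ sF])
      show "(\<lambda>x. (x, y x)) ` ?S \<subseteq> ?R"
      proof
        fix z assume "z \<in> (\<lambda>x. (x, y x)) ` ?S"
        then obtain p where p: "p \<in> U" "(p, c p) \<in> W" "c p \<in> V" "z = (\<phi> p, y (\<phi> p))" by blast
        then have "z = map_prod \<phi> \<psi> (p, c p)" using U(1) by (simp add: y_def)
        then show "z \<in> ?R" using p by blast
      qed
      show "smooth_on ?S (\<lambda>x. (x, y x))"
        by (rule smooth_on_Pair[OF S smooth_on_bounded_linear[OF bounded_linear_ident] sy])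
      show "smooth_on ?S (\<lambda>x. (0, w x))" by (rule smooth_on_Pair[OF S smooth_on_const sw])
    qed
    have eq: "((\<lambda>p. Y p (\<lambda>q. F (p, q))) \<circ> inv_into U \<phi>) x = \<D> ?F (x, y x) (0, w x)"
      if "x \<in> ?S" for x
    proof -
      obtain p where p: "p \<in> U" "p \<in> points M" "(p, c p) \<in> W" "c p \<in> V" "x = \<phi> p" using \<open>x \<in> ?S\<close> by blast
      have inv: "inv_into U \<phi> x = p" "y x = \<psi> (c p)" using p U(1) by (simp_all add: y_def)
      have "(p, c p) \<in> points (product_manifold M N)" using p smooth_map_points[OF c] by simp
      have near: "smooth_near N (c p) (\<lambda>q. F (p, q))"
        by (rule smooth_near_pullback[OF N P.smooth_manifold_axioms
              smooth_map_Pair[OF N M N smooth_map_const[OF N M p(2)] smooth_map_ident[OF N]]])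
           (use p smooth_map_points[OF c] P.smooth_nearI[OF F] in auto)
      have "Y p (\<lambda>q. F (p, q)) = chart_tangent N V \<psi> (c p) (w x) (\<lambda>q. F (p, q))"
        using N.tangent_vector_coordinates[OF V(1) p(4) Yt[OF p(2)]] unfolding w_def inv by metis
      also have "\<dots> = \<D> ((\<lambda>q. F (p, q)) \<circ> inv_into V \<psi>) (\<psi> (c p)) (w x)"
        using near by (simp add: chart_tangent_def)
      also have "\<D> ((\<lambda>q. F (p, q)) \<circ> inv_into V \<psi>) (\<psi> (c p)) =
          \<D> (\<lambda>z. ?F (x, z)) (\<psi> (c p))"
      proof (rule frechet_derivative_cong_open[OF N.chart_image[OF V(1)]])
        fix z assume z: "z \<in> \<psi> ` V"
        have x: "x \<in> \<phi> ` U" using p by blast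
        show "((\<lambda>q. F (p, q)) \<circ> inv_into V \<psi>) z = ?F (x, z)"
          using inv_into_map_prod[OF M.chart_inj_on[OF U(1)] N.chart_inj_on[OF V(1)] x z] inv by simp
      qed (use p in blast)
      also have "\<dots> (w x) = \<D> ?F (x, y x) (0, w x)"
      proof (rule frechet_derivative_eqI)
        have "map_prod \<phi> \<psi> (p, c p) \<in> ?R" using p by blast
        then have "(x, y x) \<in> ?R" using p inv by simp
        then have F': "(?F has_derivative \<D> ?F (x, y x)) (at (x, \<psi> (c p)))"
          using smooth_on_imp_has_derivative[OF sF] inv by simp
        have "((\<lambda>z. (x, z)) has_derivative (\<lambda>d. (0, d))) (at (\<psi> (c p)))"
          by (auto intro!: derivative_eq_intros)
        from diff_chain_at[OF this F']
        show "((\<lambda>z. ?F (x, z)) has_derivative (\<lambda>d. \<D> ?F (x, y x) (0, d))) (at (\<psi> (c p)))"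
          by (simp add: o_def)
      qed
      finally show ?thesis by (simp add: inv)
    qed
    have x0: "\<phi> p0 \<in> ?S" using p0 U V by blast
    show "\<exists>U \<phi> T. (U, \<phi>) \<in> atlas M \<and> p0 \<in> U \<and> open T \<and> \<phi> p0 \<in> T \<and>
        smooth_on T ((\<lambda>p. Y p (\<lambda>q. F (p, q))) \<circ> inv_into U \<phi>)"
      by (rule chart_witnessI[OF U S x0 smooth_on_eqI[OF sm S eq]])
  qed
qed

lemma differential_add: "differential N F p (u + v) = differential N F p u + differential N F p v"
  by (auto simp: differential_def)

lemma differential_scaleR: "differential N F p (c *\<^sub>R u) = c *\<^sub>R differential N F p u"
  by (auto simp: differential_def scaleR_fun_def)

context lie_group
begin

lemmas manifold_M = smooth_manifold_axioms

lemma smooth_left_translation: "\<sigma> \<in> carrier G \<Longrightarrow> smooth_map M M (\<lambda>x. \<sigma> \<otimes> x)"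
  using smooth_map_compose[OF manifold_M
      smooth_manifold_product[OF manifold_M manifold_M] manifold_M
      smooth_map_Pair[OF manifold_M manifold_M manifold_M
        smooth_map_const[OF manifold_M manifold_M, of \<sigma>]
        smooth_map_ident[OF manifold_M]] smooth_mult]
  by (simp add: points_eq_carrier)

lemma tangent_space_imp_carrier: "u \<in> tangent_space M \<tau> \<Longrightarrow> \<tau> \<in> carrier G"
  using tangent_space_imp_point points_eq_carrier by simp

lemma left_diff_tangent:
  "\<sigma> \<in> carrier G \<Longrightarrow> u \<in> tangent_space M \<tau> \<Longrightarrow> left_diff G M \<sigma> \<tau> u \<in> tangent_space M (\<sigma> \<otimes> \<tau>)"
  unfolding left_diff_def
  by (rule differential_tangent[OF manifold_M manifold_M smooth_left_translation])

lemma left_diff_apply: "smooth_near M (\<sigma> \<otimes> \<tau>) f \<Longrightarrow> left_diff G M \<sigma> \<tau> u f = u (\<lambda>x. f (\<sigma> \<otimes> x))"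
  by (simp add: left_diff_def differential_def o_def)

lemma smooth_near_left_translate:
  "\<sigma> \<in> carrier G \<Longrightarrow> \<tau> \<in> carrier G \<Longrightarrow> smooth_near M (\<sigma> \<otimes> \<tau>) f \<Longrightarrow> smooth_near M \<tau> (\<lambda>x. f (\<sigma> \<otimes> x))"
  by (rule smooth_near_pullback[OF manifold_M manifold_M smooth_left_translation])
     (simp_all add: points_eq_carrier)

lemma tangent_vector_cong_carrier:
  assumes "u \<in> tangent_space M \<tau>" "\<And>x. x \<in> carrier G \<Longrightarrow> f x = g x"
  shows "u f = u g"
  by (rule tangent_vector_cong[OF assms(1) openin_topspace tangent_space_imp_point[OF assms(1)]])
     (simp add: assms(2) points_eq_carrier)

lemma left_diff_compose:
  assumes s: "\<sigma> \<in> carrier G" "\<sigma>' \<in> carrier G" and u: "u \<in> tangent_space M \<tau>"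
  shows "left_diff G M \<sigma> (\<sigma>' \<otimes> \<tau>) (left_diff G M \<sigma>' \<tau> u) = left_diff G M (\<sigma> \<otimes> \<sigma>') \<tau> u"
proof (rule ext)
  fix f
  have t: "\<tau> \<in> carrier G" by (rule tangent_space_imp_carrier[OF u])
  show "left_diff G M \<sigma> (\<sigma>' \<otimes> \<tau>) (left_diff G M \<sigma>' \<tau> u) f = left_diff G M (\<sigma> \<otimes> \<sigma>') \<tau> u f"
  proof (cases "smooth_near M (\<sigma> \<otimes> (\<sigma>' \<otimes> \<tau>)) f")
    case True
    then have "smooth_near M (\<sigma>' \<otimes> \<tau>) (\<lambda>x. f (\<sigma> \<otimes> x))"
      using smooth_near_left_translate s t by simp
    then have "left_diff G M \<sigma> (\<sigma>' \<otimes> \<tau>) (left_diff G M \<sigma>' \<tau> u) f = u (\<lambda>x. f (\<sigma> \<otimes> (\<sigma>' \<otimes> x)))"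
      using True by (simp add: left_diff_apply)
    also have "\<dots> = u (\<lambda>x. f ((\<sigma> \<otimes> \<sigma>') \<otimes> x))"
      by (rule tangent_vector_cong_carrier[OF u]) (simp add: m_assoc s)
    finally show ?thesis using True by (simp add: left_diff_apply m_assoc s t)
  next
    case False
    then show ?thesis by (simp add: left_diff_def differential_def m_assoc s t)
  qed
qed

lemma left_diff_one: 
  assumes u: "u \<in> tangent_space M \<tau>" shows "left_diff G M \<one> \<tau> u = u"
proof (rule ext)
  fix f
  have t: "\<tau> \<in> carrier G" by (rule tangent_space_imp_carrier[OF u])
  show "left_diff G M \<one> \<tau> u f = u f"
  proof (cases "smooth_near M \<tau> f")
    case True
    have "u (\<lambda>x. f (\<one> \<otimes> x)) = u f" by (rule tangent_vector_cong_carrier[OF u]) simp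
    then show ?thesis using True t by (simp add: left_diff_apply)
  next
    case False
    then show ?thesis using tangent_vector_not_smooth[OF u] t by (simp add: left_diff_def differential_def)
  qed
qed

lemma left_diff_inverse:
  assumes "p \<in> carrier G" "u \<in> tangent_space M p"
  shows "left_diff G M p \<one> (left_diff G M (inv p) p u) = u"
  using left_diff_compose[of p "inv p" u p] left_diff_one assms by simp

lemma left_diff_inverse':
  assumes "p \<in> carrier G" "a \<in> tangent_space M \<one>"
  shows "left_diff G M (inv p) p (left_diff G M p \<one> a) = a"
  using left_diff_compose[of "inv p" p a \<one>] left_diff_one assms by simp

lemma left_field_apply: "p \<in> carrier G \<Longrightarrow> left_field G M a p = left_diff G M p \<one> a"
  by (simp add: left_field_def)

lemma left_field_eval:
  "p \<in> carrier G \<Longrightarrow> smooth_near M p f \<Longrightarrow> left_field G M a p f = a (\<lambda>x. f (p \<otimes> x))"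
  by (simp add: left_field_apply left_diff_apply)

lemma left_field_tangent:
  "p \<in> carrier G \<Longrightarrow> a \<in> tangent_space M \<one> \<Longrightarrow> left_field G M a p \<in> tangent_space M p"
  using left_diff_tangent[of p a \<one>] by (simp add: left_field_apply)

lemma left_field_one: "a \<in> tangent_space M \<one> \<Longrightarrow> left_field G M a \<one> = a"
  by (simp add: left_field_apply left_diff_one)

lemma left_field_translate:
  assumes "\<sigma> \<in> carrier G" "\<tau> \<in> carrier G" "a \<in> tangent_space M \<one>"
  shows "left_diff G M \<sigma> \<tau> (left_field G M a \<tau>) = left_field G M a (\<sigma> \<otimes> \<tau>)"
  using left_diff_compose[of \<sigma> \<tau> a \<one>] assms by (simp add: left_field_apply)

text \<open>The field is \<open>p \<mapsto> a (q \<mapsto> f (p q))\<close>, a partial derivative of the multiplication.\<close>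

lemma left_field_vector_field:
  assumes a: "a \<in> tangent_space M \<one>"
  shows "left_field G M a \<in> vector_fields M"
  unfolding vector_fields_def
proof (intro CollectI conjI ballI allI impI)
  show "left_field G M a p \<in> tangent_space M p" if "p \<in> points M" for p
    using left_field_tangent[OF _ a] that by (simp add: points_eq_carrier)
  show "left_field G M a p = 0" if "p \<notin> points M" for p
    using that by (simp add: left_field_def points_eq_carrier)
  fix W f assume f: "smooth_fun M W f"
  have W: "W \<subseteq> carrier G" using smooth_fun_subset_points[OF f] points_eq_carrier by simp
  let ?P = "product_manifold M M"
  have "smooth_fun M {p \<in> points M. (p, \<one>) \<in> {z \<in> points ?P. (\<lambda>(x, y). x \<otimes> y) z \<in> W}}
      (\<lambda>p. a (\<lambda>q. f ((\<lambda>(x, y). x \<otimes> y) (p, q))))"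
  proof (rule smooth_fun_partial[OF manifold_M manifold_M])
    show "smooth_fun ?P {z \<in> points ?P. (\<lambda>(x, y). x \<otimes> y) z \<in> W} (\<lambda>z. f ((\<lambda>(x, y). x \<otimes> y) z))"
      by (rule smooth_fun_pullback[OF smooth_manifold_product[OF manifold_M manifold_M]
            manifold_M smooth_mult f])
    show "smooth_map M M (\<lambda>p. \<one>)"
      by (rule smooth_map_const[OF manifold_M manifold_M]) (simp add: points_eq_carrier)
    show "a \<in> tangent_space M \<one>" by (rule a)
    show "smooth_fun M {p \<in> points M. \<one> \<in> V} (\<lambda>p. a (\<lambda>q. \<psi> q \<bullet> b))" for V and \<psi> :: "'m \<Rightarrow> 'e" and b
      by (rule smooth_fun_const) (cases "\<one> \<in> V"; simp)
  qed
  moreover have "{p \<in> points M. (p, \<one>) \<in> {z \<in> points ?P. (\<lambda>(x, y). x \<otimes> y) z \<in> W}} = W"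
    using W by (auto simp: points_eq_carrier)
  ultimately have "smooth_fun M W (\<lambda>p. a (\<lambda>q. f (p \<otimes> q)))" by simp
  then show "smooth_fun M W (\<lambda>p. left_field G M a p f)"
    by (rule smooth_fun_cong) (use W left_field_eval smooth_nearI[OF f] in auto)
qed

text \<open>Read off at \<open>p\<close>, the left trivialisation of \<open>X\<close> differentiates \<open>q \<mapsto> \<phi> (p\<inverse> q)\<close> at \<open>q = p\<close>. The
  function \<open>(p, q) \<mapsto> \<phi> (p\<inverse> q)\<close> is smooth near the diagonal. This gives smooth coefficients with
  respect to a left invariant frame without inverting a matrix of functions.\<close>

lemma left_translated_smooth:
  assumes X: "X \<in> vector_fields M" and U: "(U, \<phi>) \<in> atlas M" "\<one> \<in> U"
  shows "smooth_fun M (points M) (\<lambda>p. left_diff G M (inv p) p (X p) (\<lambda>q. \<phi> q \<bullet> b))"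
proof -
  let ?P = "product_manifold M M" and ?d = "\<lambda>z. inv (fst z) \<otimes> snd z"
  note sm = manifold_M and P = smooth_manifold_product[OF manifold_M manifold_M]
  have "smooth_map ?P M (\<lambda>z. (\<lambda>(x, y). x \<otimes> y) (inv (fst z), snd z))"
    by (rule smooth_map_compose[OF P P sm smooth_map_Pair[OF P sm sm
            smooth_map_compose[OF P sm sm smooth_map_fst[OF sm sm] smooth_inv] smooth_map_snd[OF sm sm]] smooth_mult])
  then have d: "smooth_map ?P M ?d" by simp
  have "smooth_fun M {p \<in> points M. (p, p) \<in> {z \<in> points ?P. ?d z \<in> U}} (\<lambda>p. X p (\<lambda>q. \<phi> (?d (p, q)) \<bullet> b))"
  proof (rule smooth_fun_partial[OF sm sm _ smooth_map_ident[OF sm]])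
    show "smooth_fun ?P {z \<in> points ?P. ?d z \<in> U} (\<lambda>z. \<phi> (?d z) \<bullet> b)"
      by (rule smooth_fun_pullback[OF P sm d smooth_fun_coordinate[OF U(1)]])
    show "X p \<in> tangent_space M p" if "p \<in> points M" for p by (rule vector_field_tangent[OF X that])
    fix V and \<psi> :: "'m \<Rightarrow> 'e" and b' assume V: "(V, \<psi>) \<in> atlas M"
    have "{p \<in> points M. p \<in> V} = V" using chart_subset[OF V] by blast
    then show "smooth_fun M {p \<in> points M. p \<in> V} (\<lambda>p. X p (\<lambda>q. \<psi> q \<bullet> b'))"
      using vector_field_smooth[OF X smooth_fun_coordinate[OF V]] by simp
  qed
  moreover have "{p \<in> points M. (p, p) \<in> {z \<in> points ?P. ?d z \<in> U}} = points M"
    using U(2) by (auto simp: points_eq_carrier)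
  ultimately have "smooth_fun M (points M) (\<lambda>p. X p (\<lambda>q. \<phi> (inv p \<otimes> q) \<bullet> b))" by simp
  then show ?thesis
  proof (rule smooth_fun_cong)
    fix p assume "p \<in> points M"
    then show "left_diff G M (inv p) p (X p) (\<lambda>q. \<phi> q \<bullet> b) = X p (\<lambda>q. \<phi> (inv p \<otimes> q) \<bullet> b)"
      using smooth_near_coordinate[OF U] by (simp add: left_diff_apply points_eq_carrier)
  qed
qed

text \<open>Left translation by \<open>p\<close> carries left invariant fields to themselves, hence also their brackets;
  thus the structure functions of a left invariant frame are constant.\<close>

lemma lie_bracket_left_field:
  assumes a: "a \<in> tangent_space M \<one>" and b: "b \<in> tangent_space M \<one>" and p: "p \<in> carrier G"
  shows "lie_bracket M (left_field G M a) (left_field G M b) p =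
    left_diff G M p \<one> (lie_bracket M (left_field G M a) (left_field G M b) \<one>)"
proof (rule ext)
  fix f
  show "lie_bracket M (left_field G M a) (left_field G M b) p f =
    left_diff G M p \<one> (lie_bracket M (left_field G M a) (left_field G M b) \<one>) f"
  proof (cases "smooth_near M p f")
    case True
    then obtain W where W: "p \<in> W" "smooth_fun M W f" unfolding smooth_near_def by blast
    have p1: "p \<otimes> \<one> = p" using p by simp
    have near: "smooth_near M \<one> (\<lambda>x. f (p \<otimes> x))"
      using smooth_near_left_translate[OF p one_closed] True by (simp add: p1)
    have second: "left_field G M a p (\<lambda>q. left_field G M b q f) =
        left_field G M a \<one> (\<lambda>q. left_field G M b q (\<lambda>x. f (p \<otimes> x)))"
      if a: "a \<in> tangent_space M \<one>" and b: "b \<in> tangent_space M \<one>" for a b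
    proof -
      have "left_field G M a p (\<lambda>q. left_field G M b q f) = a (\<lambda>x. left_field G M b (p \<otimes> x) f)"
        by (rule left_field_eval[OF p vector_field_smooth_near[OF left_field_vector_field[OF b] True]])
      also have "\<dots> = a (\<lambda>q. left_field G M b q (\<lambda>x. f (p \<otimes> x)))"
      proof (rule tangent_vector_cong[OF a])
        show "openin (mtop M) {q \<in> points M. p \<otimes> q \<in> W}"
          by (rule smooth_fun_openin[OF smooth_fun_pullback[OF manifold_M manifold_M
                  smooth_left_translation[OF p] W(2)]])
        show "\<one> \<in> {q \<in> points M. p \<otimes> q \<in> W}" using p1 W(1) by (simp add: points_eq_carrier)
        fix q assume q: "q \<in> {q \<in> points M. p \<otimes> q \<in> W}"
        then show "left_field G M b (p \<otimes> q) f = left_field G M b q (\<lambda>x. f (p \<otimes> x))"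
          using left_diff_apply[OF smooth_nearI[OF W(2)]] left_field_translate[OF p _ b, of q]
          by (metis (no_types, lifting) mem_Collect_eq points_eq_carrier)
      qed
      finally show ?thesis by (simp add: left_field_one a)
    qed
    show ?thesis
      using True near left_diff_apply[of p \<one> f] by (simp add: lie_bracket_def second a b p1)
  next
    case False
    then show ?thesis using p by (simp add: lie_bracket_def left_diff_def differential_def)
  qed
qed

text \<open>A left invariant structure on a Lie group is determined by its value at the unit. In the
  coordinates of a chart at the unit, a pseudo-Kaehler structure on the Lie algebra therefore
  spreads to a left invariant pseudo-Kaehler structure on the group.\<close>

lemma pseudo_kaehler_from_lie_algebra:
  fixes \<Omega> :: "'e \<Rightarrow> 'e \<Rightarrow> real"
  assumes U: "(U, \<phi>) \<in> atlas M" "\<one> \<in> U"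
    and br: "\<And>u w. lie_bracket M (left_field G M (chart_tangent M U \<phi> \<one> u))
        (left_field G M (chart_tangent M U \<phi> \<one> w)) \<one> = chart_tangent M U \<phi> \<one> (br u w)"
    and \<Omega>: "bilinear \<Omega>" and alt: "\<And>x. \<Omega> x x = 0" and nd: "\<And>x. (\<And>y. \<Omega> x y = 0) \<Longrightarrow> x = 0"
    and cocycle: "\<And>x y z. \<Omega> (br x y) z + \<Omega> (br y z) x + \<Omega> (br z x) y = 0"
    and J: "linear J" and JJ: "\<And>x. J (J x) = - x"
    and nijenhuis: "\<And>x y. br (J x) (J y) - J (br (J x) y) - J (br x (J y)) - br x y = 0"
    and compat: "\<And>x y. \<Omega> x (J y) = \<Omega> y (J x)"
  shows "\<exists>\<omega> j. pseudo_kaehler_lie_group G M \<omega> j"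
proof -
  let ?K = "chart_tangent M U \<phi> \<one>"
  have K: "?K w \<in> tangent_space M \<one>" for w using tangent_space_chart[OF U] by blast
  define E where "E w = left_field G M (?K w)" for w
  define coef where "coef p u = (\<Sum>b\<in>Basis. left_diff G M (inv p) p u (\<lambda>q. \<phi> q \<bullet> b) *\<^sub>R b)" for p and u :: "'m tangent"
  have K_coef: "?K (coef p u) = left_diff G M (inv p) p u" if "u \<in> tangent_space M p" for p u
  proof -
    have p: "p \<in> carrier G" by (rule tangent_space_imp_carrier[OF that])
    then have "left_diff G M (inv p) p u \<in> tangent_space M \<one>" using left_diff_tangent[OF _ that, of "inv p"] by simp
    from tangent_vector_coordinates[OF U this] show ?thesis by (simp add: coef_def)
  qed
  have Ep: "E w p = left_diff G M p \<one> (?K w)" if "p \<in> carrier G" for w p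
    using that by (simp add: E_def left_field_apply)
  interpret F: framed_manifold M E coef br
  proof (intro framed_manifold.intro framed_manifold_axioms.intro)
    show "smooth_manifold M" by (rule manifold_M)
    show "E w \<in> vector_fields M" for w unfolding E_def by (rule left_field_vector_field[OF K])
    show "linear (\<lambda>w. E w p)" if "p \<in> points M" for p
      using that by (intro linearI) (simp_all add: Ep points_eq_carrier left_diff_def
          chart_tangent_add[OF U] chart_tangent_scaleR[OF U] differential_add differential_scaleR)
    show "E (coef p v) p = v" if "v \<in> tangent_space M p" for p v
      using tangent_space_imp_carrier[OF that] that by (simp add: Ep K_coef left_diff_inverse)
    show "coef p (E w p) = w" if "p \<in> points M" for p w
    proof -
      have p: "p \<in> carrier G" using that points_eq_carrier by simp
      have "?K (coef p (E w p)) = ?K w"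
        using left_field_tangent[OF p K] by (simp add: K_coef E_def left_field_apply p left_diff_inverse' K)
      then show ?thesis using injD[OF inj_chart_tangent[OF U]] by blast
    qed
    show "smooth_fun M (points M) (\<lambda>p. coef p (X p) \<bullet> b)" if X: "X \<in> vector_fields M" for X b
    proof -
      have "smooth_fun M (points M) (\<lambda>p. \<Sum>c\<in>Basis. left_diff G M (inv p) p (X p) (\<lambda>q. \<phi> q \<bullet> c) * (c \<bullet> b))"
        by (intro smooth_fun_sum smooth_fun_mult left_translated_smooth[OF X U] smooth_fun_const openin_topspace)
      then show ?thesis by (simp add: coef_def inner_sum_left)
    qed
    show "lie_bracket M (E u) (E w) p = E (br u w) p" if "p \<in> points M" for p u w
      unfolding E_def using that
      by (simp add: points_eq_carrier left_field_apply lie_bracket_left_field[OF K K, of p] br)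
    show "points M \<noteq> {}" using points_eq_carrier one_closed by blast
  qed
  have coef_inv: "coef (\<sigma> \<otimes> \<tau>) (left_diff G M \<sigma> \<tau> u) = coef \<tau> u"
    if s: "\<sigma> \<in> carrier G" and u: "u \<in> tangent_space M \<tau>" for \<sigma> \<tau> u
  proof -
    have t: "\<tau> \<in> carrier G" by (rule tangent_space_imp_carrier[OF u])
    have "left_diff G M (inv (\<sigma> \<otimes> \<tau>)) (\<sigma> \<otimes> \<tau>) (left_diff G M \<sigma> \<tau> u) = left_diff G M (inv \<tau>) \<tau> u"
      using left_diff_compose[OF _ s u, of "inv (\<sigma> \<otimes> \<tau>)"] s t by (simp add: inv_mult_group m_assoc)
    then show ?thesis by (simp add: coef_def)
  qed
  define \<omega> where "\<omega> p u v = \<Omega> (coef p u) (coef p v)" for p u v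
  define j where "j p u = E (J (coef p u)) p" for p u
  have g: "\<omega> p u (j p v) = \<Omega> (coef p u) (J (coef p v))"
    if "u \<in> tangent_space M p" "v \<in> tangent_space M p" for p u v
    using F.coef_frame[OF tangent_space_imp_point[OF that(1)]] by (simp add: \<omega>_def j_def)
  have "lie_group G M" by unfold_locales
  moreover have "symplectic_form M \<omega>"
    by (rule F.symplectic_form_frame[OF \<Omega> alt nd cocycle]) (simp_all add: \<omega>_def)
  moreover have "left_invariant_bilinear G M \<omega>"
    unfolding left_invariant_bilinear_def by (simp add: \<omega>_def coef_inv)
  moreover have "complex_structure M j"
    by (rule F.complex_structure_frame[OF J JJ nijenhuis]) (simp add: j_def)
  moreover have "left_invariant_endo G M j"
    unfolding left_invariant_endo_def
    by (simp add: j_def coef_inv E_def left_field_translate K)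
  moreover have "pseudo_riemannian_metric M (\<lambda>p a b. \<omega> p a (j p b))"
  proof (rule F.pseudo_riemannian_metric_frame[where B = "\<lambda>x y. \<Omega> x (J y)"])
    show "bilinear (\<lambda>x y. \<Omega> x (J y))"
      using \<Omega> linear_compose[OF J, of "\<Omega> _"] unfolding bilinear_def o_def by blast
    show "\<Omega> x (J y) = \<Omega> y (J x)" for x y by (rule compat)
    show "x = 0" if 0: "\<And>y. \<Omega> x (J y) = 0" for x
    proof (rule nd)
      fix y
      have "\<Omega> x (J (J y)) = 0" by (rule 0)
      then show "\<Omega> x y = 0" by (simp add: JJ bilinear_rneg[OF \<Omega>])
    qed
  qed (rule g)
  moreover have "left_invariant_bilinear G M (\<lambda>p a b. \<omega> p a (j p b))"
    unfolding left_invariant_bilinear_def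
    by (simp add: g left_diff_tangent coef_inv)
  ultimately show ?thesis
    unfolding pseudo_kaehler_lie_group_def symplectic_lie_group_def by blast
qed

end

section \<open>The cotangent group of a pseudo-Hessian Lie group\<close>

lemma smooth_map_cong:
  assumes M: "smooth_manifold M" and N: "smooth_manifold N"
    and G: "smooth_map M N G" and eq: "\<And>p. p \<in> points M \<Longrightarrow> F p = G p"
  shows "smooth_map M N F"
proof (rule smooth_mapI[OF M N])
  show "F p \<in> points N" if "p \<in> points M" for p
    using smooth_map_points[OF G that] eq[OF that] by simp
  fix W f assume f: "smooth_fun N W f"
  have "{p \<in> points M. F p \<in> W} = {p \<in> points M. G p \<in> W}" using eq by auto
  moreover have "smooth_fun M {p \<in> points M. G p \<in> W} (\<lambda>p. f (F p))"
    by (rule smooth_manifold.smooth_fun_cong[OF M smooth_fun_pullback[OF M N G f]]) (simp add: eq)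
  ultimately show "smooth_fun M {p \<in> points M. F p \<in> W} (\<lambda>p. f (F p))" by simp
qed

lemma subspace_dual_space:
  assumes "subspace V"
  shows "subspace (dual_space V)"
  using subspace_add[OF assms] subspace_scale[OF assms]
  unfolding subspace_def dual_space_def lin_on_def
  by (auto simp: scaleR_fun_def algebra_simps)

lemma (in smooth_manifold) subspace_tangent_space: "p \<in> points M \<Longrightarrow> subspace (tangent_space M p)"
  unfolding subspace_def by (simp add: tangent_space_zero tangent_space_add tangent_space_scaleR)

text \<open>A chart at the unit of the group is fixed; through it, elements of the Lie algebra become vectors
  of the model space.\<close>

locale cotangent_group_setup =
  fixes G :: "'m monoid" (structure)
    and M :: "('m, 'e::euclidean_space) manifold"
    and nabla :: "'m vfield \<Rightarrow> 'm vfield \<Rightarrow> 'm vfield"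
    and g :: "'m \<Rightarrow> 'm tangent \<Rightarrow> 'm tangent \<Rightarrow> real"
    and \<rho> :: "'m \<Rightarrow> ('m tangent \<Rightarrow> real) \<Rightarrow> ('m tangent \<Rightarrow> real)"
    and U :: "'m set" and \<phi> :: "'m \<Rightarrow> 'e"
  assumes hessian: "pseudo_hessian_lie_group G M nabla g"
    and representation: "dual_representation G M \<rho>"
    and differential_\<rho>: "\<And>a \<beta>. a \<in> lie_algebra G M \<Longrightarrow> \<beta> \<in> dual_space (lie_algebra G M) \<Longrightarrow>
           representation_differential \<rho> a \<beta> =
           - transpose_on (lie_algebra G M) (left_symmetric_product G M nabla a) \<beta>"
    and chart: "(U, \<phi>) \<in> atlas M" "\<one> \<in> U"

sublocale cotangent_group_setup \<subseteq> lie_group G M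
  using hessian unfolding pseudo_hessian_lie_group_def flat_affine_lie_group_def by blast

context cotangent_group_setup
begin

abbreviation "\<gg> \<equiv> tangent_space M \<one>"
abbreviation "V \<equiv> dual_space \<gg>"
abbreviation "\<kappa> \<equiv> chart_tangent M U \<phi> \<one>"
abbreviation dot (infixl "\<cdot>" 70) where "a \<cdot> b \<equiv> left_symmetric_product G M nabla a b"
abbreviation "\<eta> \<equiv> g \<one>"
abbreviation "H \<equiv> cotangent_group G M \<rho>"
abbreviation "N \<equiv> cotangent_manifold G M"

lemma lie_algebra_eq: "lie_algebra G M = \<gg>" by (simp add: lie_algebra_def)

lemma one_point: "\<one> \<in> points M" by (simp add: points_eq_carrier)

lemma \<kappa>_tangent: "\<kappa> w \<in> \<gg>" using tangent_space_chart[OF chart] by blast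

lemma \<kappa>_surj: "a \<in> \<gg> \<Longrightarrow> \<exists>w. a = \<kappa> w" using tangent_space_chart[OF chart] by blast

lemmas \<kappa>_add = chart_tangent_add[OF chart]
lemmas \<kappa>_scaleR = chart_tangent_scaleR[OF chart]

lemma linear_\<kappa>: "linear \<kappa>" by (rule linearI) (simp_all add: \<kappa>_add \<kappa>_scaleR)

lemma connection_field: "X \<in> vector_fields M \<Longrightarrow> Y \<in> vector_fields M \<Longrightarrow> nabla X Y \<in> vector_fields M"
  using hessian unfolding pseudo_hessian_lie_group_def flat_affine_lie_group_def linear_connection_def by blast

lemma dot_tangent: "x \<in> \<gg> \<Longrightarrow> y \<in> \<gg> \<Longrightarrow> x \<cdot> y \<in> \<gg>"
  unfolding left_symmetric_product_def
  by (intro vector_field_tangent[OF connection_field] left_field_vector_field one_point)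

lemma commutator:
  assumes "x \<in> \<gg>" "y \<in> \<gg>"
  shows "lie_bracket M (left_field G M x) (left_field G M y) \<one> = x \<cdot> y - y \<cdot> x"
proof -
  have "torsion_free M nabla"
    using hessian unfolding pseudo_hessian_lie_group_def flat_affine_lie_group_def by blast
  then have "nabla (left_field G M x) (left_field G M y) - nabla (left_field G M y) (left_field G M x) =
      lie_bracket M (left_field G M x) (left_field G M y)"
    using left_field_vector_field[OF assms(1)] left_field_vector_field[OF assms(2)]
    unfolding torsion_free_def by blast
  from fun_cong[OF this, of \<one>] show ?thesis by (simp add: left_symmetric_product_def)
qed

lemma left_field_left_invariant:
  assumes "x \<in> \<gg>" shows "left_field G M x \<in> left_invariant_fields G M"
proof -
  have "left_push G M \<sigma> (left_field G M x) \<tau> = left_field G M x \<tau>" if s: "\<sigma> \<in> carrier G" for \<sigma> \<tau>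
  proof (cases "\<tau> \<in> carrier G")
    case True
    have "\<sigma> \<otimes> (inv \<sigma> \<otimes> \<tau>) = \<tau>" using s True by (simp add: m_assoc[symmetric])
    then show ?thesis using left_field_translate[OF s _ assms, of "inv \<sigma> \<otimes> \<tau>"] s True
      by (simp add: left_push_def)
  qed (simp add: left_push_def left_field_def)
  then show ?thesis
    using left_field_vector_field[OF assms] by (simp add: left_invariant_fields_def fun_eq_iff)
qed

lemma hessian_identity:
  assumes "x \<in> \<gg>" "y \<in> \<gg>" "z \<in> \<gg>"
  shows "\<eta> (x \<cdot> y) z - \<eta> x (y \<cdot> z) = \<eta> (y \<cdot> x) z - \<eta> y (x \<cdot> z)"
proof -
  have "\<forall>X\<in>left_invariant_fields G M. \<forall>Y\<in>left_invariant_fields G M. \<forall>Z\<in>left_invariant_fields G M. \<forall>p\<in>carrier G.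
      g p (nabla X Y p) (Z p) - g p (X p) (nabla Y Z p) = g p (nabla Y X p) (Z p) - g p (Y p) (nabla X Z p)"
    using hessian unfolding pseudo_hessian_lie_group_def by blast
  then have "\<eta> (nabla (left_field G M x) (left_field G M y) \<one>) (left_field G M z \<one>)
      - \<eta> (left_field G M x \<one>) (nabla (left_field G M y) (left_field G M z) \<one>)
      = \<eta> (nabla (left_field G M y) (left_field G M x) \<one>) (left_field G M z \<one>)
      - \<eta> (left_field G M y \<one>) (nabla (left_field G M x) (left_field G M z) \<one>)"
    using left_field_left_invariant assms one_closed by blast
  then show ?thesis using assms by (simp add: left_field_one left_symmetric_product_def)
qed

lemma metric_bilinear: "bilin_form_on \<gg> \<eta>"
  using hessian one_point
  unfolding pseudo_hessian_lie_group_def pseudo_riemannian_metric_def smooth_bilinear_field_def by blast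

lemma metric_sym: "x \<in> \<gg> \<Longrightarrow> y \<in> \<gg> \<Longrightarrow> \<eta> x y = \<eta> y x"
  using hessian one_point unfolding pseudo_hessian_lie_group_def pseudo_riemannian_metric_def by blast

lemma metric_nondegenerate: "x \<in> \<gg> \<Longrightarrow> (\<And>y. y \<in> \<gg> \<Longrightarrow> \<eta> x y = 0) \<Longrightarrow> x = 0"
  using hessian one_point
  unfolding pseudo_hessian_lie_group_def pseudo_riemannian_metric_def nondegenerate_on_def by blast

lemma metric_add_left: "x \<in> \<gg> \<Longrightarrow> y \<in> \<gg> \<Longrightarrow> z \<in> \<gg> \<Longrightarrow> \<eta> (x + y) z = \<eta> x z + \<eta> y z"
  and metric_add_right: "x \<in> \<gg> \<Longrightarrow> y \<in> \<gg> \<Longrightarrow> z \<in> \<gg> \<Longrightarrow> \<eta> x (y + z) = \<eta> x y + \<eta> x z"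
  and metric_scale_left: "x \<in> \<gg> \<Longrightarrow> y \<in> \<gg> \<Longrightarrow> \<eta> (c *\<^sub>R x) y = c * \<eta> x y"
  and metric_scale_right: "x \<in> \<gg> \<Longrightarrow> y \<in> \<gg> \<Longrightarrow> \<eta> x (c *\<^sub>R y) = c * \<eta> x y"
  using metric_bilinear unfolding bilin_form_on_def lin_on_def by simp_all

lemma metric_diff_right:
  assumes "x \<in> \<gg>" "y \<in> \<gg>" "z \<in> \<gg>"
  shows "\<eta> x (y - z) = \<eta> x y - \<eta> x z"
  using metric_add_right[OF assms(1,2) tangent_space_scaleR[OF assms(3), of "-1"]]
    metric_scale_right[OF assms(1,3), of "-1"] by simp

lemma metric_diff_left:
  assumes "x \<in> \<gg>" "y \<in> \<gg>" "z \<in> \<gg>"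
  shows "\<eta> (x - y) z = \<eta> x z - \<eta> y z"
  using metric_add_left[OF assms(1) tangent_space_scaleR[OF assms(2), of "-1"] assms(3)]
    metric_scale_left[OF assms(2,3), of "-1"] by simp

text \<open>The metric at the unit in the coordinates of the chart.\<close>

definition h :: "'e \<Rightarrow> 'e \<Rightarrow> real" where "h u v = \<eta> (\<kappa> u) (\<kappa> v)"

lemma bilinear_h: "bilinear h"
  unfolding bilinear_def h_def
  by (intro conjI allI linearI)
     (simp_all add: \<kappa>_add \<kappa>_scaleR metric_add_left metric_add_right metric_scale_left metric_scale_right \<kappa>_tangent)

lemma h_sym: "h u v = h v u"
  by (simp add: h_def metric_sym \<kappa>_tangent)

lemma h_nondegenerate:
  assumes "\<And>v. h u v = 0" shows "u = 0"
proof -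
  have "\<kappa> u = 0"
    using assms \<kappa>_surj unfolding h_def by (intro metric_nondegenerate \<kappa>_tangent) blast
  also have "0 = \<kappa> 0" by (rule linear_0[OF linear_\<kappa>, symmetric])
  finally show ?thesis using injD[OF inj_chart_tangent[OF chart]] by blast
qed

text \<open>The covector dual to the tangent vector with coordinates \<open>w\<close>; outside the Lie algebra it takes the
  value \<open>0\<close> that the elements of the dual space have there. Its inverse serves as a chart of the
  dual space, so that duality becomes the identity in coordinates.\<close>

definition flat_map :: "'e \<Rightarrow> 'm tangent \<Rightarrow> real" where
  "flat_map w = (\<lambda>c. if c \<in> \<gg> then \<eta> (\<kappa> w) c else 0)"

lemma flat_map_\<kappa>: "flat_map w (\<kappa> c) = h w c"
  by (simp add: flat_map_def h_def \<kappa>_tangent)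

lemma flat_map_dual: "flat_map w \<in> V"
  unfolding dual_space_def lin_on_def flat_map_def
  by (auto simp: tangent_space_add tangent_space_scaleR metric_add_right metric_scale_right \<kappa>_tangent)

lemma dual_eqI:
  assumes "\<alpha> \<in> V" "\<beta> \<in> V" "\<And>c. \<alpha> (\<kappa> c) = \<beta> (\<kappa> c)"
  shows "\<alpha> = \<beta>"
proof
  fix c show "\<alpha> c = \<beta> c"
    using assms \<kappa>_surj[of c] by (cases "c \<in> \<gg>") (auto simp: dual_space_def)
qed

lemma flat_map_add: "flat_map (u + w) = flat_map u + flat_map w"
  by (auto simp: flat_map_def fun_eq_iff \<kappa>_add metric_add_left \<kappa>_tangent)

lemma flat_map_scaleR: "flat_map (c *\<^sub>R w) = c *\<^sub>R flat_map w"
proof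
  have "(c *\<^sub>R flat_map w) v = c * flat_map w v" for v by (simp add: scaleR_fun_def)
  then show "flat_map (c *\<^sub>R w) v = (c *\<^sub>R flat_map w) v" for v
    by (simp add: flat_map_def \<kappa>_scaleR metric_scale_left \<kappa>_tangent)
qed

text \<open>Injectivity is nondegeneracy. Surjectivity follows since both spaces have the dimension of the
  model space: an arbitrary functional agrees with \<open>h w\<close> on a basis for a suitable \<open>w\<close>.\<close>

lemma bij_flat_map: "bij_betw flat_map UNIV V"
  unfolding bij_betw_def
proof (intro conjI equalityI subsetI)
  show "inj flat_map"
  proof (rule injI)
    fix u w assume eq: "flat_map u = flat_map w"
    have "h (u - w) c = 0" for c
      using fun_cong[OF eq, of "\<kappa> c"] by (simp add: flat_map_\<kappa> bilinear_lsub[OF bilinear_h])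
    then show "u = w" using h_nondegenerate[of "u - w"] by simp
  qed
  show "\<alpha> \<in> V" if "\<alpha> \<in> range flat_map" for \<alpha> using that flat_map_dual by blast
  fix \<alpha> assume \<alpha>: "\<alpha> \<in> V"
  \<comment> \<open>\<open>T w\<close> collects the values of \<open>h w\<close> on the basis.\<close>
  define T where "T w = (\<Sum>c\<in>Basis. h w c *\<^sub>R c)" for w
  have h_lin: "linear (\<lambda>w. h w c)" "linear (h w)" for c w using bilinear_h unfolding bilinear_def by blast+
  have T_inner: "T w \<bullet> c = h w c" if "c \<in> Basis" for w c using that by (simp add: T_def)
  have "linear T"
    unfolding T_def by (intro linearI)
      (simp_all add: linear_add[OF h_lin(1)] linear_scale[OF h_lin(1)] scaleR_add_left sum.distrib scaleR_sum_right)
  moreover have "inj T"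
  proof (rule linear_injective_0[OF \<open>linear T\<close>, THEN iffD2], intro allI impI)
    fix w assume "T w = 0"
    then have "h w c = 0" if "c \<in> Basis" for c using T_inner[OF that, of w] by simp
    then have "h w v = 0" for v using linear_expand[OF h_lin(2), of w v] by simp
    then show "w = 0" by (rule h_nondegenerate)
  qed
  ultimately have "surj T" by (rule linear_injective_imp_surjective) simp
  then obtain w where w: "T w = (\<Sum>c\<in>Basis. \<alpha> (\<kappa> c) *\<^sub>R c)" by (metis surjD)
  have basis: "h w c = \<alpha> (\<kappa> c)" if "c \<in> Basis" for c
    using T_inner[OF that, of w] that by (simp add: w)
  have "linear (\<lambda>v. \<alpha> (\<kappa> v))"
    using \<alpha> \<kappa>_tangent unfolding dual_space_def lin_on_def by (intro linearI) (simp_all add: \<kappa>_add \<kappa>_scaleR)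
  then have "h w v = \<alpha> (\<kappa> v)" for v
    using linear_expand[of "\<lambda>v. \<alpha> (\<kappa> v)" v] linear_expand[OF h_lin(2), of w v] by (simp add: basis)
  then have "flat_map w = \<alpha>" by (intro dual_eqI flat_map_dual \<alpha>) (simp add: flat_map_\<kappa>)
  then show "\<alpha> \<in> range flat_map" by blast
qed

definition sharp_map :: "('m tangent \<Rightarrow> real) \<Rightarrow> 'e" where "sharp_map = inv_into UNIV flat_map"

lemma flat_sharp: "\<alpha> \<in> V \<Longrightarrow> flat_map (sharp_map \<alpha>) = \<alpha>"
  unfolding sharp_map_def using bij_flat_map by (simp add: bij_betw_def f_inv_into_f)

lemma sharp_flat: "sharp_map (flat_map w) = w"
  unfolding sharp_map_def using bij_flat_map by (simp add: bij_betw_def)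

lemma subspace_V: "subspace V"
  by (rule subspace_dual_space[OF subspace_tangent_space[OF one_point]])

lemma sharp_lin_iso: "sharp_map \<in> lin_isos V"
proof -
  have "sharp_map (\<alpha> + \<beta>) = sharp_map \<alpha> + sharp_map \<beta>" if "\<alpha> \<in> V" "\<beta> \<in> V" for \<alpha> \<beta>
    using sharp_flat[of "sharp_map \<alpha> + sharp_map \<beta>"] by (simp add: flat_map_add flat_sharp that)
  moreover have "sharp_map (c *\<^sub>R \<alpha>) = c *\<^sub>R sharp_map \<alpha>" if "\<alpha> \<in> V" for c \<alpha>
    using sharp_flat[of "c *\<^sub>R sharp_map \<alpha>"] by (simp add: flat_map_scaleR flat_sharp that)
  moreover have "bij_betw sharp_map V UNIV"
    unfolding sharp_map_def by (rule bij_betw_inv_into[OF bij_flat_map])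
  ultimately show ?thesis unfolding lin_isos_def lin_on_def by blast
qed

sublocale dual: finite_dim_subspace V sharp_map
  by unfold_locales (rule subspace_V, rule sharp_lin_iso)

lemma inv_sharp: "inv_into V sharp_map x = flat_map x"
  using dual.lin_iso_inverse(1,2)[OF sharp_lin_iso] flat_sharp by metis

lemma dual_manifold_eq: "dual_manifold G M = dual.VM"
  by (simp add: dual_manifold_def lie_algebra_def)

lemma N_eq: "N = product_manifold dual.VM M"
  by (simp add: cotangent_manifold_def dual_manifold_eq)

lemma smooth_manifold_N: "smooth_manifold N"
  unfolding N_eq by (rule smooth_manifold_product[OF dual.smooth_manifold_VM manifold_M])

lemma points_N: "points N = V \<times> carrier G"
  by (simp add: N_eq points_eq_carrier)

lemma \<rho>_dual: "\<sigma> \<in> carrier G \<Longrightarrow> \<beta> \<in> V \<Longrightarrow> \<rho> \<sigma> \<beta> \<in> V"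
  using representation unfolding dual_representation_def Let_def lie_algebra_eq by blast

lemma \<rho>_lin: "\<sigma> \<in> carrier G \<Longrightarrow> lin_on V (\<rho> \<sigma>)"
  using representation unfolding dual_representation_def Let_def lie_algebra_eq by blast

lemma \<rho>_one: "\<beta> \<in> V \<Longrightarrow> \<rho> \<one> \<beta> = \<beta>"
  using representation unfolding dual_representation_def Let_def lie_algebra_eq by blast

lemma \<rho>_mult: "\<sigma> \<in> carrier G \<Longrightarrow> \<tau> \<in> carrier G \<Longrightarrow> \<beta> \<in> V \<Longrightarrow> \<rho> (\<sigma> \<otimes> \<tau>) \<beta> = \<rho> \<sigma> (\<rho> \<tau> \<beta>)"
  using representation unfolding dual_representation_def Let_def lie_algebra_eq by blast

lemma \<rho>_smooth: "smooth_map (product_manifold M dual.VM) dual.VM (\<lambda>(\<sigma>, \<beta>). \<rho> \<sigma> \<beta>)"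
  using representation unfolding dual_representation_def Let_def dual_manifold_eq by blast

lemma \<rho>_add: "\<sigma> \<in> carrier G \<Longrightarrow> \<alpha> \<in> V \<Longrightarrow> \<beta> \<in> V \<Longrightarrow> \<rho> \<sigma> (\<alpha> + \<beta>) = \<rho> \<sigma> \<alpha> + \<rho> \<sigma> \<beta>"
  using \<rho>_lin unfolding lin_on_def by blast

lemma V_add: "\<alpha> \<in> V \<Longrightarrow> \<beta> \<in> V \<Longrightarrow> \<alpha> + \<beta> \<in> V" by (rule subspace_add[OF subspace_V])
lemma V_neg: "\<alpha> \<in> V \<Longrightarrow> - \<alpha> \<in> V" by (rule subspace_neg[OF subspace_V])
lemma V_zero: "0 \<in> V" by (rule subspace_0[OF subspace_V])

lemma carrier_H: "carrier H = V \<times> carrier G"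
  by (simp add: cotangent_group_def lie_algebra_eq)

lemma one_H: "\<one>\<^bsub>H\<^esub> = (0, \<one>)" by (simp add: cotangent_group_def)

lemma mult_H: "x \<otimes>\<^bsub>H\<^esub> y = (fst x + \<rho> (snd x) (fst y), snd x \<otimes> snd y)"
  by (simp add: cotangent_group_def case_prod_beta)

lemma group_H: "group H"
proof (rule groupI)
  show "\<one>\<^bsub>H\<^esub> \<in> carrier H" by (simp add: one_H carrier_H V_zero)
  fix x assume x: "x \<in> carrier H"
  show "\<one>\<^bsub>H\<^esub> \<otimes>\<^bsub>H\<^esub> x = x" using x by (auto simp: mult_H one_H carrier_H \<rho>_one)
  show "\<exists>y\<in>carrier H. y \<otimes>\<^bsub>H\<^esub> x = \<one>\<^bsub>H\<^esub>"
    using x by (intro bexI[of _ "(- \<rho> (inv (snd x)) (fst x), inv (snd x))"])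
      (auto simp: mult_H one_H carrier_H V_neg \<rho>_dual)
  fix y assume y: "y \<in> carrier H"
  show "x \<otimes>\<^bsub>H\<^esub> y \<in> carrier H" using x y by (auto simp: mult_H carrier_H \<rho>_dual V_add)
  fix z assume z: "z \<in> carrier H"
  show "x \<otimes>\<^bsub>H\<^esub> y \<otimes>\<^bsub>H\<^esub> z = x \<otimes>\<^bsub>H\<^esub> (y \<otimes>\<^bsub>H\<^esub> z)"
    using x y z by (auto simp: mult_H carrier_H \<rho>_add \<rho>_mult \<rho>_dual m_assoc add.assoc)
qed

lemma inv_H:
  assumes "x \<in> carrier H"
  shows "inv\<^bsub>H\<^esub> x = (- \<rho> (inv (snd x)) (fst x), inv (snd x))"
  using assms by (intro group.inv_equality[OF group_H]) (auto simp: mult_H one_H carrier_H V_neg \<rho>_dual)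

lemma lie_group_H: "lie_group H N"
proof -
  note vm = dual.smooth_manifold_VM and m = manifold_M and n = smooth_manifold_N
  note nn = smooth_manifold_product[OF n n] and mm = smooth_manifold_product[OF m m]
    and mv = smooth_manifold_product[OF m vm]
  have f: "smooth_map N dual.VM fst" and s: "smooth_map N M snd"
    unfolding N_eq by (rule smooth_map_fst[OF vm m], rule smooth_map_snd[OF vm m])
  note P1 = smooth_map_fst[OF n n] and P2 = smooth_map_snd[OF n n]
  note ff = smooth_map_compose[OF nn n vm P1 f] and sf = smooth_map_compose[OF nn n m P1 s]
    and fs = smooth_map_compose[OF nn n vm P2 f] and ss = smooth_map_compose[OF nn n m P2 s]
  have "smooth_map (product_manifold N N) dual.VM (\<lambda>z. fst (fst z) + (\<lambda>(\<sigma>, \<beta>). \<rho> \<sigma> \<beta>) (snd (fst z), fst (snd z)))"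
    by (rule dual.smooth_map_add[OF nn ff smooth_map_compose[OF nn mv vm smooth_map_Pair[OF nn m vm sf fs] \<rho>_smooth]])
  moreover have "smooth_map (product_manifold N N) M (\<lambda>z. (\<lambda>(x, y). x \<otimes> y) (snd (fst z), snd (snd z)))"
    by (rule smooth_map_compose[OF nn mm m smooth_map_Pair[OF nn m m sf ss] smooth_mult])
  ultimately have "smooth_map (product_manifold N N) N
      (\<lambda>z. (fst (fst z) + (\<lambda>(\<sigma>, \<beta>). \<rho> \<sigma> \<beta>) (snd (fst z), fst (snd z)), (\<lambda>(x, y). x \<otimes> y) (snd (fst z), snd (snd z))))"
    unfolding N_eq by (rule smooth_map_Pair[OF nn[unfolded N_eq] vm m])
  moreover have "(\<lambda>(x, y). x \<otimes>\<^bsub>H\<^esub> y) =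
      (\<lambda>z. (fst (fst z) + (\<lambda>(\<sigma>, \<beta>). \<rho> \<sigma> \<beta>) (snd (fst z), fst (snd z)), (\<lambda>(x, y). x \<otimes> y) (snd (fst z), snd (snd z))))"
    by (simp add: fun_eq_iff mult_H)
  ultimately have mult: "smooth_map (product_manifold N N) N (\<lambda>(x, y). x \<otimes>\<^bsub>H\<^esub> y)" by simp
  note si = smooth_map_compose[OF n m m s smooth_inv]
  have "smooth_map N N (\<lambda>z. (- (\<lambda>(\<sigma>, \<beta>). \<rho> \<sigma> \<beta>) (inv (snd z), fst z), inv (snd z)))"
    unfolding N_eq
    by (rule smooth_map_Pair[OF n[unfolded N_eq] vm m dual.smooth_map_minus[OF n[unfolded N_eq]
            smooth_map_compose[OF n[unfolded N_eq] mv vm smooth_map_Pair[OF n[unfolded N_eq] m vm] \<rho>_smooth]]])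
       (use si f in \<open>simp_all add: N_eq\<close>)
  then have inv: "smooth_map N N (\<lambda>x. inv\<^bsub>H\<^esub> x)"
    by (rule smooth_map_cong[OF n n]) (simp add: inv_H carrier_H points_N)
  show ?thesis
    by (intro lie_group.intro lie_group_axioms.intro group_H n mult inv)
       (simp add: points_N carrier_H)
qed

text \<open>The tangent space of the cotangent group at the unit, in the product of the chart
  \<open>sharp_map\<close> of the dual and the chart of \<open>G\<close>: the first component of \<open>w\<close> stands for the
  covector dual to \<open>\<kappa> (fst w)\<close>.\<close>

abbreviation "K \<equiv> chart_tangent N (V \<times> U) (map_prod sharp_map \<phi>) (0, \<one>)"

lemma chart_N: "(V \<times> U, map_prod sharp_map \<phi>) \<in> atlas N" "(0, \<one>) \<in> V \<times> U"
  unfolding N_eq using atlas_product_manifoldI[OF dual.atlas_VM chart(1)] chart(2) V_zero by auto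

lemma chart_N_inverse:
  assumes "x \<in> map_prod sharp_map \<phi> ` (V \<times> U)"
  shows "inv_into (V \<times> U) (map_prod sharp_map \<phi>) x = (flat_map (fst x), inv_into U \<phi> (snd x))"
proof -
  have "inj_on sharp_map V" using sharp_lin_iso unfolding lin_isos_def bij_betw_def by blast
  moreover have "fst x \<in> sharp_map ` V" "snd x \<in> \<phi> ` U" using assms by auto
  ultimately show ?thesis
    using inv_into_map_prod[OF _ chart_inj_on[OF chart(1)], of sharp_map V "fst x" "snd x"]
    by (simp add: inv_sharp)
qed

lemma open_chart_N: "open (map_prod sharp_map \<phi> ` (V \<times> U))"
  by (rule smooth_manifold.chart_image[OF smooth_manifold_N chart_N(1)])

lemma smooth_near_snd:
  assumes "smooth_near M (snd p) f" "p \<in> points N"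
  shows "smooth_near N p (\<lambda>q. f (snd q))"
proof (rule smooth_near_pullback[where F = snd and f = f, OF smooth_manifold_N manifold_M _ assms(2,1)])
  show "smooth_map N M snd"
    unfolding N_eq by (rule smooth_map_snd[OF dual.smooth_manifold_VM manifold_M])
qed

lemma smooth_near_fst:
  assumes "lin_on V l" "p \<in> points N"
  shows "smooth_near N p (\<lambda>q. l (fst q))"
proof -
  have "smooth_map N dual.VM fst"
    unfolding N_eq by (rule smooth_map_fst[OF dual.smooth_manifold_VM manifold_M])
  from dual.smooth_fun_linear_compose[OF smooth_manifold_N this assms(1)]
  show ?thesis using smooth_manifold.smooth_nearI[OF smooth_manifold_N] assms(2) by blast
qed

lemma one_N: "(0, \<one>) \<in> points N" by (simp add: points_N V_zero)

lemma K_tangent: "K w \<in> tangent_space N (0, \<one>)"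
  using smooth_manifold.tangent_space_chart[OF smooth_manifold_N chart_N] by blast

lemma K_snd:
  assumes "smooth_near M \<one> f"
  shows "K w (\<lambda>q. f (snd q)) = \<kappa> (snd w) f"
proof -
  have x: "(sharp_map 0, \<phi> \<one>) \<in> map_prod sharp_map \<phi> ` (V \<times> U)" using chart_N(2) by force
  have near: "smooth_near N (0, \<one>) (\<lambda>q. f (snd q))" using smooth_near_snd[OF _ one_N] assms by simp
  have eq: "\<D> ((\<lambda>q. f (snd q)) \<circ> inv_into (V \<times> U) (map_prod sharp_map \<phi>)) (sharp_map 0, \<phi> \<one>) =
      \<D> (\<lambda>z. (f \<circ> inv_into U \<phi>) (snd z)) (sharp_map 0, \<phi> \<one>)"
    by (rule frechet_derivative_cong_open[OF open_chart_N x]) (simp add: chart_N_inverse)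
  have "\<D> (\<lambda>z. (f \<circ> inv_into U \<phi>) (snd z)) (sharp_map 0, \<phi> \<one>) w = \<D> (f \<circ> inv_into U \<phi>) (\<phi> \<one>) (snd w)"
  proof (rule frechet_derivative_eqI)
    have d: "((f \<circ> inv_into U \<phi>) has_derivative \<D> (f \<circ> inv_into U \<phi>) (\<phi> \<one>))
        (at (snd (sharp_map (0 :: 'm tangent \<Rightarrow> real), \<phi> \<one>)))"
      using frechet_derivative_works[THEN iffD1, OF smooth_near_chart_differentiable[OF chart assms]] by simp
    have "(snd has_derivative snd) (at (sharp_map (0 :: 'm tangent \<Rightarrow> real), \<phi> \<one>))"
      by (rule bounded_linear_imp_has_derivative[OF bounded_linear_snd])
    from diff_chain_at[OF this d]
    show "((\<lambda>z. (f \<circ> inv_into U \<phi>) (snd z)) has_derivative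
        (\<lambda>w. \<D> (f \<circ> inv_into U \<phi>) (\<phi> \<one>) (snd w))) (at (sharp_map 0, \<phi> \<one>))"
      by (simp add: o_def)
  qed
  then show ?thesis using near assms by (simp add: chart_tangent_def eq)
qed

lemma K_fst:
  assumes l: "lin_on V l"
  shows "K w (\<lambda>q. l (fst q)) = l (flat_map (fst w))"
proof -
  have x: "(sharp_map 0, \<phi> \<one>) \<in> map_prod sharp_map \<phi> ` (V \<times> U)" using chart_N(2) by force
  have near: "smooth_near N (0, \<one>) (\<lambda>q. l (fst q))" by (rule smooth_near_fst[OF l one_N])
  have lin: "linear (\<lambda>x. l (flat_map x))"
    using dual.linear_lin_iso_inverse[OF sharp_lin_iso l] by (simp add: inv_sharp)
  have eq: "\<D> ((\<lambda>q. l (fst q)) \<circ> inv_into (V \<times> U) (map_prod sharp_map \<phi>)) (sharp_map 0, \<phi> \<one>) =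
      \<D> (\<lambda>z. l (flat_map (fst z))) (sharp_map 0, \<phi> \<one>)"
    by (rule frechet_derivative_cong_open[OF open_chart_N x]) (simp add: chart_N_inverse)
  have "\<D> (\<lambda>z. l (flat_map (fst z))) (sharp_map 0, \<phi> \<one>) w = l (flat_map (fst w))"
  proof (rule frechet_derivative_eqI)
    have "bounded_linear (\<lambda>z :: 'e \<times> 'e. l (flat_map (fst z)))"
      using bounded_linear_compose[OF linear_conv_bounded_linear[THEN iffD1, OF lin] bounded_linear_fst] .
    then show "((\<lambda>z. l (flat_map (fst z))) has_derivative (\<lambda>w. l (flat_map (fst w)))) (at (sharp_map 0, \<phi> \<one>))"
      by (rule bounded_linear_imp_has_derivative)
  qed
  then show ?thesis using near by (simp add: chart_tangent_def eq)
qed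

text \<open>The projection to \<open>G\<close> is a homomorphism, hence it maps left invariant fields to left invariant
  fields.\<close>

lemma left_field_H_snd:
  assumes p: "p \<in> carrier H" and f: "smooth_near M (snd p) f"
  shows "left_field H N (K w) p (\<lambda>q. f (snd q)) = left_field G M (\<kappa> (snd w)) (snd p) f"
proof -
  have s: "snd p \<in> carrier G" and pN: "p \<in> points N" using p by (auto simp: carrier_H points_N)
  have "left_field H N (K w) p (\<lambda>q. f (snd q)) = K w (\<lambda>q. f (snd p \<otimes> snd q))"
    using lie_group.left_field_eval[OF lie_group_H p smooth_near_snd[OF f pN], of "K w"] by (simp add: mult_H)
  also have "\<dots> = \<kappa> (snd w) (\<lambda>x. f (snd p \<otimes> x))"
    by (rule K_snd[OF smooth_near_left_translate[OF s one_closed]]) (use f s in simp)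
  also have "\<dots> = left_field G M (\<kappa> (snd w)) (snd p) f"
    by (rule left_field_eval[OF s f, symmetric])
  finally show ?thesis .
qed

lemma lin_on_eval: "c \<in> \<gg> \<Longrightarrow> lin_on V (\<lambda>\<beta>. \<beta> c)"
  by (simp add: lin_on_def scaleR_fun_def)

text \<open>On an evaluation \<open>\<beta> \<mapsto> \<beta> c\<close> of the covector variable a left invariant field takes the values of an
  orbit map of the representation: the group law is affine in the second covector, with linear part \<open>\<rho> \<sigma>\<close>.\<close>

lemma left_field_H_fst:
  assumes p: "p \<in> carrier H" and c: "c \<in> \<gg>"
  shows "left_field H N (K w) p (\<lambda>q. fst q c) = \<rho> (snd p) (flat_map (fst w)) c"
proof -
  interpret N: smooth_manifold N by (rule smooth_manifold_N)
  have s: "snd p \<in> carrier G" and pN: "p \<in> points N" using p by (auto simp: carrier_H points_N)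
  have l: "lin_on V (\<lambda>\<beta>. \<rho> (snd p) \<beta> c)"
    using \<rho>_lin[OF s] by (simp add: lin_on_def scaleR_fun_def)
  have "left_field H N (K w) p (\<lambda>q. fst q c) = K w (\<lambda>q. fst p c + \<rho> (snd p) (fst q) c)"
    using lie_group.left_field_eval[OF lie_group_H p smooth_near_fst[OF lin_on_eval[OF c] pN], of "K w"]
    by (simp add: mult_H)
  also have "\<dots> = K w (\<lambda>q. \<rho> (snd p) (fst q) c)"
    using N.tangent_vector_add[OF K_tangent N.smooth_near_const[OF one_N] smooth_near_fst[OF l one_N]]
      N.tangent_vector_const[OF K_tangent] by simp
  also have "\<dots> = \<rho> (snd p) (flat_map (fst w)) c" by (rule K_fst[OF l])
  finally show ?thesis .
qed

text \<open>This is where the condition on the differential of the representation enters.\<close>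

lemma \<kappa>_orbit:
  assumes "c \<in> \<gg>"
  shows "\<kappa> u (\<lambda>\<sigma>. \<rho> \<sigma> (flat_map v) c) = - \<eta> (\<kappa> v) (\<kappa> u \<cdot> c)"
proof -
  have "representation_differential \<rho> (\<kappa> u) (flat_map v) c = - transpose_on \<gg> (left_symmetric_product G M nabla (\<kappa> u)) (flat_map v) c"
    using differential_\<rho>[of "\<kappa> u" "flat_map v"] \<kappa>_tangent flat_map_dual by (simp add: lie_algebra_eq)
  then show ?thesis
    using assms dot_tangent[OF \<kappa>_tangent assms]
    by (simp add: representation_differential_def transpose_on_def flat_map_def)
qed

lemma smooth_near_orbit:
  assumes "c \<in> \<gg>" "\<beta> \<in> V" "p \<in> points M"
  shows "smooth_near M p (\<lambda>\<sigma>. \<rho> \<sigma> \<beta> c)"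
proof -
  note m = manifold_M and vm = dual.smooth_manifold_VM
  have "smooth_map M dual.VM (\<lambda>\<sigma>. (\<lambda>(\<sigma>, \<beta>). \<rho> \<sigma> \<beta>) (\<sigma>, \<beta>))"
    by (rule smooth_map_compose[OF m smooth_manifold_product[OF m vm] vm
          smooth_map_Pair[OF m m vm smooth_map_ident[OF m] smooth_map_const[OF m vm]] \<rho>_smooth])
       (simp add: assms)
  then have "smooth_map M dual.VM (\<lambda>\<sigma>. \<rho> \<sigma> \<beta>)" by simp
  from dual.smooth_fun_linear_compose[OF m this lin_on_eval[OF assms(1)]]
  show ?thesis using smooth_nearI assms(3) by blast
qed

text \<open>The structure constants of the cotangent group in the coordinates of the chart. They are
  identified below by inserting the two kinds of test functions into the bracket.\<close>

definition br :: "'e \<times> 'e \<Rightarrow> 'e \<times> 'e \<Rightarrow> 'e \<times> 'e" where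
  "br w z = (SOME x. lie_bracket N (left_field H N (K w)) (left_field H N (K z)) (0, \<one>) = K x)"

lemma bracket_H: "lie_bracket N (left_field H N (K w)) (left_field H N (K z)) (0, \<one>) = K (br w z)"
proof -
  have f: "left_field H N (K w) \<in> vector_fields N" for w
    using lie_group.left_field_vector_field[OF lie_group_H] K_tangent by (simp add: one_H)
  have "lie_bracket N (left_field H N (K w)) (left_field H N (K z)) (0, \<one>) \<in> tangent_space N (0, \<one>)"
    by (rule smooth_manifold.lie_bracket_tangent[OF smooth_manifold_N f f one_N])
  then have "\<exists>x. lie_bracket N (left_field H N (K w)) (left_field H N (K z)) (0, \<one>) = K x"
    using smooth_manifold.tangent_space_chart[OF smooth_manifold_N chart_N] by blast
  then show ?thesis unfolding br_def by (rule someI_ex)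
qed

lemma left_field_H_one: "left_field H N (K w) (0, \<one>) = K w"
  using lie_group.left_field_one[OF lie_group_H] K_tangent by (simp add: one_H)

text \<open>The bracket is tested on functions of the group variable, where it is a bracket of left invariant
  fields of \<open>G\<close>; since the connection is torsion free, this is a commutator of the product.\<close>

lemma \<kappa>_snd_br: "\<kappa> (snd (br w z)) = \<kappa> (snd w) \<cdot> \<kappa> (snd z) - \<kappa> (snd z) \<cdot> \<kappa> (snd w)"
proof (rule ext)
  fix f
  interpret N: smooth_manifold N by (rule smooth_manifold_N)
  let ?d = "\<kappa> (snd w) \<cdot> \<kappa> (snd z) - \<kappa> (snd z) \<cdot> \<kappa> (snd w)"
  have d: "?d \<in> \<gg>" by (intro tangent_space_diff dot_tangent \<kappa>_tangent)
  show "\<kappa> (snd (br w z)) f = ?d f"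
  proof (cases "smooth_near M \<one> f")
    case True
    then obtain W where W: "\<one> \<in> W" "smooth_fun M W f" unfolding smooth_near_def by blast
    have near: "smooth_near N (0, \<one>) (\<lambda>q. f (snd q))" using smooth_near_snd[OF _ one_N] True by simp
    have second: "left_field H N (K w) (0, \<one>) (\<lambda>q. left_field H N (K z) q (\<lambda>q. f (snd q))) =
        left_field G M (\<kappa> (snd w)) \<one> (\<lambda>\<sigma>. left_field G M (\<kappa> (snd z)) \<sigma> f)" for w z
    proof -
      let ?W = "{q \<in> points N. snd q \<in> W}"
      have "smooth_map N M snd"
        unfolding N_eq by (rule smooth_map_snd[OF dual.smooth_manifold_VM manifold_M])
      then have op: "openin (mtop N) ?W"
        by (rule N.smooth_fun_openin[OF smooth_fun_pullback[OF smooth_manifold_N manifold_M _ W(2)]])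
      have "K w (\<lambda>q. left_field H N (K z) q (\<lambda>q. f (snd q))) = K w (\<lambda>q. left_field G M (\<kappa> (snd z)) (snd q) f)"
      proof (rule N.tangent_vector_cong[OF K_tangent op])
        show "(0, \<one>) \<in> ?W" using one_N W(1) by simp
        show "left_field H N (K z) q (\<lambda>q. f (snd q)) = left_field G M (\<kappa> (snd z)) (snd q) f" if "q \<in> ?W" for q
          using that smooth_nearI[OF W(2)] by (intro left_field_H_snd) (auto simp: carrier_H points_N)
      qed
      also have "\<dots> = \<kappa> (snd w) (\<lambda>\<sigma>. left_field G M (\<kappa> (snd z)) \<sigma> f)"
        by (rule K_snd[OF vector_field_smooth_near[OF left_field_vector_field[OF \<kappa>_tangent] True]])
      finally show ?thesis by (simp add: left_field_H_one left_field_one \<kappa>_tangent)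
    qed
    have "\<kappa> (snd (br w z)) f = K (br w z) (\<lambda>q. f (snd q))" by (rule K_snd[OF True, symmetric])
    also have "\<dots> = lie_bracket M (left_field G M (\<kappa> (snd w))) (left_field G M (\<kappa> (snd z))) \<one> f"
      unfolding bracket_H[symmetric] using True near by (simp add: lie_bracket_def second)
    finally show ?thesis by (simp add: commutator \<kappa>_tangent)
  next
    case False
    then show ?thesis using tangent_vector_not_smooth[OF d] tangent_vector_not_smooth[OF \<kappa>_tangent] by metis
  qed
qed

text \<open>The covector part of the bracket is the difference of the two coadjoint type actions, obtained by
  differentiating the orbit maps at the unit.\<close>

lemma \<kappa>_fst_br:
  assumes "c \<in> \<gg>"
  shows "\<eta> (\<kappa> (fst (br w z))) c = \<eta> (\<kappa> (fst w)) (\<kappa> (snd z) \<cdot> c) - \<eta> (\<kappa> (fst z)) (\<kappa> (snd w) \<cdot> c)"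
proof -
  interpret N: smooth_manifold N by (rule smooth_manifold_N)
  have near: "smooth_near N (0, \<one>) (\<lambda>q. fst q c)" by (rule smooth_near_fst[OF lin_on_eval[OF assms] one_N])
  have second: "left_field H N (K w) (0, \<one>) (\<lambda>q. left_field H N (K z) q (\<lambda>q. fst q c)) =
      - \<eta> (\<kappa> (fst z)) (\<kappa> (snd w) \<cdot> c)" for w z
  proof -
    have "K w (\<lambda>q. left_field H N (K z) q (\<lambda>q. fst q c)) = K w (\<lambda>q. \<rho> (snd q) (flat_map (fst z)) c)"
      by (rule N.tangent_vector_cong[OF K_tangent openin_topspace one_N])
         (simp add: left_field_H_fst assms carrier_H points_N)
    also have "\<dots> = \<kappa> (snd w) (\<lambda>\<sigma>. \<rho> \<sigma> (flat_map (fst z)) c)"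
      by (rule K_snd[OF smooth_near_orbit[OF assms flat_map_dual one_point]])
    also have "\<dots> = - \<eta> (\<kappa> (fst z)) (\<kappa> (snd w) \<cdot> c)" by (rule \<kappa>_orbit[OF assms])
    finally show ?thesis by (simp add: left_field_H_one)
  qed
  have "\<eta> (\<kappa> (fst (br w z))) c = K (br w z) (\<lambda>q. fst q c)"
    using K_fst[OF lin_on_eval[OF assms]] assms by (simp add: flat_map_def)
  also have "\<dots> = - \<eta> (\<kappa> (fst z)) (\<kappa> (snd w) \<cdot> c) + \<eta> (\<kappa> (fst w)) (\<kappa> (snd z) \<cdot> c)"
    unfolding bracket_H[symmetric] using near by (simp add: lie_bracket_def second)
  finally show ?thesis by simp
qed

text \<open>The canonical pairing of covectors and vectors, and the complex structure that exchanges a vector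
  and its dual covector up to sign.\<close>

definition \<Omega> :: "'e \<times> 'e \<Rightarrow> 'e \<times> 'e \<Rightarrow> real" where
  "\<Omega> w z = h (fst w) (snd z) - h (fst z) (snd w)"

definition J :: "'e \<times> 'e \<Rightarrow> 'e \<times> 'e" where "J w = (- snd w, fst w)"

lemma h_fst_br:
  "h (fst (br w z)) c = \<eta> (\<kappa> (fst w)) (\<kappa> (snd z) \<cdot> \<kappa> c) - \<eta> (\<kappa> (fst z)) (\<kappa> (snd w) \<cdot> \<kappa> c)"
  unfolding h_def by (rule \<kappa>_fst_br[OF \<kappa>_tangent])

lemma h_snd_br:
  "h c (snd (br w z)) = \<eta> (\<kappa> c) (\<kappa> (snd w) \<cdot> \<kappa> (snd z)) - \<eta> (\<kappa> c) (\<kappa> (snd z) \<cdot> \<kappa> (snd w))"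
  unfolding h_def \<kappa>_snd_br by (rule metric_diff_right) (simp_all add: dot_tangent \<kappa>_tangent)

text \<open>With the bracket on \<open>G\<close> written as a commutator, each term occurs twice with opposite signs.\<close>

lemma \<Omega>_cocycle: "\<Omega> (br x y) z + \<Omega> (br y z) x + \<Omega> (br z x) y = 0"
  unfolding \<Omega>_def h_fst_br h_snd_br by simp

text \<open>The Hessian identity in the form in which it enters the Nijenhuis tensor.\<close>

lemma h_snd_br_hessian:
  "h (snd (br x y)) c = \<eta> (\<kappa> (snd x)) (\<kappa> (snd y) \<cdot> \<kappa> c) - \<eta> (\<kappa> (snd y)) (\<kappa> (snd x) \<cdot> \<kappa> c)"
  unfolding h_def \<kappa>_snd_br
  using hessian_identity[OF \<kappa>_tangent \<kappa>_tangent \<kappa>_tangent, of "snd x" "snd y" c]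
  by (simp add: metric_diff_left dot_tangent \<kappa>_tangent)

text \<open>Both components of the Nijenhuis tensor are tested against the nondegenerate form \<open>h\<close>. After the
  Hessian identity has replaced the commutators, every term has the form \<open>\<eta> u (v \<cdot> c)\<close>, and the
  terms cancel in pairs.\<close>

lemma J_nijenhuis: "br (J x) (J y) - J (br (J x) y) - J (br x (J y)) - br x y = 0"
proof -
  have neg: "\<eta> (\<kappa> (- u)) v = - \<eta> (\<kappa> u) v" if "v \<in> \<gg>" for u v
    using metric_scale_left[OF \<kappa>_tangent that, of "-1" u] \<kappa>_scaleR[of "-1" u] by simp
  let ?N = "br (J x) (J y) - J (br (J x) y) - J (br x (J y)) - br x y"
  have "h (fst ?N) c = 0" for c
    by (simp add: J_def bilinear_lsub[OF bilinear_h] bilinear_ladd[OF bilinear_h] bilinear_lneg[OF bilinear_h]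
        h_fst_br h_snd_br_hessian neg dot_tangent \<kappa>_tangent)
  moreover have "h (snd ?N) c = 0" for c
    by (simp add: J_def bilinear_lsub[OF bilinear_h] bilinear_ladd[OF bilinear_h] bilinear_lneg[OF bilinear_h]
        h_fst_br h_snd_br_hessian neg dot_tangent \<kappa>_tangent)
  ultimately have "fst ?N = 0" "snd ?N = 0" using h_nondegenerate by blast+
  then show ?thesis by (simp add: prod_eq_iff)
qed

lemma pseudo_kaehler_cotangent: "\<exists>\<omega> j. pseudo_kaehler_lie_group H N \<omega> j"
proof (rule lie_group.pseudo_kaehler_from_lie_algebra[OF lie_group_H, where \<Omega> = \<Omega> and J = J and br = br])
  show "(V \<times> U, map_prod sharp_map \<phi>) \<in> atlas N" "\<one>\<^bsub>H\<^esub> \<in> V \<times> U" using chart_N by (simp_all add: one_H)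
  show "lie_bracket N (left_field H N (chart_tangent N (V \<times> U) (map_prod sharp_map \<phi>) \<one>\<^bsub>H\<^esub> u))
      (left_field H N (chart_tangent N (V \<times> U) (map_prod sharp_map \<phi>) \<one>\<^bsub>H\<^esub> w)) \<one>\<^bsub>H\<^esub> =
      chart_tangent N (V \<times> U) (map_prod sharp_map \<phi>) \<one>\<^bsub>H\<^esub> (br u w)" for u w
    by (simp add: one_H bracket_H)
  show "bilinear \<Omega>"
    unfolding bilinear_def \<Omega>_def
    by (intro conjI allI linearI)
       (simp_all add: bilinear_ladd[OF bilinear_h] bilinear_radd[OF bilinear_h]
         bilinear_lmul[OF bilinear_h] bilinear_rmul[OF bilinear_h] algebra_simps)
  show "\<Omega> x x = 0" for x by (simp add: \<Omega>_def)
  show "x = 0" if 0: "\<And>y. \<Omega> x y = 0" for x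
  proof -
    have "h (fst x) c = 0" for c using 0[of "(0, c)"] by (simp add: \<Omega>_def bilinear_lzero[OF bilinear_h])
    moreover have "h (snd x) c = 0" for c
      using 0[of "(c, 0)"] by (simp add: \<Omega>_def bilinear_rzero[OF bilinear_h] h_sym[of "snd x"])
    ultimately show ?thesis using h_nondegenerate by (simp add: prod_eq_iff)
  qed
  show "\<Omega> (br x y) z + \<Omega> (br y z) x + \<Omega> (br z x) y = 0" for x y z by (rule \<Omega>_cocycle)
  show "linear J" by (rule linearI) (simp_all add: J_def)
  show "J (J x) = - x" for x by (simp add: J_def prod_eq_iff)
  show "br (J x) (J y) - J (br (J x) y) - J (br x (J y)) - br x y = 0" for x y by (rule J_nijenhuis)
  show "\<Omega> x (J y) = \<Omega> y (J x)" for x y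
    by (simp add: \<Omega>_def J_def bilinear_lneg[OF bilinear_h] bilinear_rneg[OF bilinear_h] h_sym)
qed

end

theorem theorem12:
  fixes G :: "'m monoid"
    and M :: "('m, 'e::euclidean_space) manifold"
    and nabla :: "'m vfield \<Rightarrow> 'm vfield \<Rightarrow> 'm vfield"
    and g :: "'m \<Rightarrow> 'm tangent \<Rightarrow> 'm tangent \<Rightarrow> real"
    and \<rho> :: "'m \<Rightarrow> ('m tangent \<Rightarrow> real) \<Rightarrow> ('m tangent \<Rightarrow> real)"
  assumes "pseudo_hessian_lie_group G M nabla g"
    and "dual_representation G M \<rho>"
    and "\<And>a \<beta>. a \<in> lie_algebra G M \<Longrightarrow> \<beta> \<in> dual_space (lie_algebra G M) \<Longrightarrow>
           representation_differential \<rho> a \<beta> =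
           - transpose_on (lie_algebra G M) (left_symmetric_product G M nabla a) \<beta>"
  shows "\<exists>\<omega> j. pseudo_kaehler_lie_group (cotangent_group G M \<rho>) (cotangent_manifold G M) \<omega> j"
proof -
  interpret lie_group G M
    using assms(1) unfolding pseudo_hessian_lie_group_def flat_affine_lie_group_def by blast
  obtain U \<phi> where "(U, \<phi>) \<in> atlas M" "\<one>\<^bsub>G\<^esub> \<in> U"
    using obtain_chart points_eq_carrier one_closed by metis
  then interpret cotangent_group_setup G M nabla g \<rho> U \<phi>
    using assms by (intro cotangent_group_setup.intro)
  show ?thesis by (rule pseudo_kaehler_cotangent)
qed

end
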